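(* Let $\iota_Y\colon A\to Y$ and $\phi\colon M\to Y$ be maps of $\mathcal M$. Let $P$ be the homotopy pullback of $\iota_Y$ and $\phi$, with maps $\pi\colon P\to A$ and $\iota_M'\colon P\to M$; let $\tilde M$ be the homotopy pushout of $\pi$ and $\iota_M'$, with structure maps $\iota_{\tilde M}\colon A\to\tilde M$ and $M\to\tilde M$. Then $$\mathrm{Relcat}(\iota_{\tilde M})\leq\mathrm{Relcat}(\iota_M')\leq\mathrm{Relcat}(\iota_Y)$$ and $$\mathrm{relcat}(\iota_{\tilde M})\leq\mathrm{relcat}(\iota_M')\leq\mathrm{relcat}(\iota_Y).$$
   Context: Setting. $\mathcal M$ is a closed model category satisfying the Cube axiom: in any homotopy commutative cube whose bottom face is a homotopy pushout and whose four vertical faces are homotopy pullbacks, the top face is a homotopy pushout. (Main example: the category of well-pointed topological spaces, i.e. pointed spaces whose base point inclusion is a closed cofibration.) Objects are taken cofibrant-fibrant (replacing them if necessary), and $\simeq$ denotes homotopy of maps. A homotopy commutative diagram includes a choice of mutually compatible homotopies. The whisker map is the map (unique up to homotopy once homotopies are fixed) induced out of a homotopy pushout, or into a homotopy pullback, by a homotopy commutative square. Ganea construction. For a map $\iota_X\colon A\to X$, put $G_0=A$, $g_0=\iota_X$, $\alpha_0=\mathrm{id}_A$. Given $g_i\colon G_i\to X$, let $F_i$ be the homotopy pullback of $\iota_X\colon A\to X$ and $g_i\colon G_i\to X$, with maps $\eta_i\colon F_i\to A$, $\beta_i\colon F_i\to G_i$; let $G_{i+1}$ be the homotopy pushout of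 $\eta_i$ and $\beta_i$, with maps $\alpha_{i+1}\colon A\to G_{i+1}$, $\gamma_i\colon G_i\to G_{i+1}$; and let $g_{i+1}\colon G_{i+1}\to X$ be the whisker map induced by $\iota_X$ and $g_i$. Write $G_i=G_i(\iota_X)$. $\mathrm{relcat}(\iota_X)$ (relative category) is the least $n\ge0$ such that $g_n\colon G_n(\iota_X)\to X$ has a homotopy section $\sigma$ (i.e. $g_n\circ\sigma\simeq\mathrm{id}_X$) with $\sigma\circ\iota_X\simeq\alpha_n$ ($\infty$ if no such $n$ exists). $\mathrm{Relcat}(\iota_X)$ (strong relative category) is the least $n\ge0$ (or $\infty$) such that there are objects $X_0,\dots,X_n=X$ and maps $\iota_i\colon A\to X_i$ with: $\iota_0$ has a homotopy inverse; for each $0\le i<n$ there are maps $\rho_i\colon Z_i\to A$ and $\tau_i\colon Z_i\to X_i$ whose homotopy pushout is $X_{i+1}$ with structure maps $\iota_{i+1}\colon A\to X_{i+1}$ and $\chi_i\colon X_i\to X_{i+1}$, and a map $\sigma_i\colon A\to Z_i$ with $\rho_i\circ\sigma_i\simeq\mathrm{id}_A$ and $\tau_i\circ\sigma_i\simeq\iota_i$ (the whole diagram being homotopy commutative); and $\iota_n\simeq\iota_X$. *)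

theory Defs
  imports Main "HOL-Library.Extended_Nat"
begin

section \<open>Categories and finite limits\<close>

record ('o, 'm) mcat =
  Obj :: "'o set"
  Arr :: "'m set"
  Dom :: "'m \<Rightarrow> 'o"
  Cod :: "'m \<Rightarrow> 'o"
  Id :: "'o \<Rightarrow> 'm"
  comp :: "'m \<Rightarrow> 'm \<Rightarrow> 'm" (infixl \<open>\<cdot>\<index>\<close> 70)
  Weq :: "'m set"
  Cof :: "'m set"
  Fib :: "'m set"

text \<open>Composition is written in the applicative order; it is meaningful only for composable arrows.\<close>

definition Hom :: "('o, 'm) mcat \<Rightarrow> 'o \<Rightarrow> 'o \<Rightarrow> 'm set" where
  "Hom C a b = {f \<in> Arr C. Dom C f = a \<and> Cod C f = b}"

definition category :: "('o, 'm) mcat \<Rightarrow> bool" where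
  "category C \<longleftrightarrow>
     (\<forall>f \<in> Arr C. Dom C f \<in> Obj C \<and> Cod C f \<in> Obj C) \<and>
     (\<forall>a \<in> Obj C. Id C a \<in> Hom C a a) \<and>
     (\<forall>a b c f g. f \<in> Hom C a b \<longrightarrow> g \<in> Hom C b c \<longrightarrow> g \<cdot>\<^bsub>C\<^esub> f \<in> Hom C a c) \<and>
     (\<forall>a b f. f \<in> Hom C a b \<longrightarrow> f \<cdot>\<^bsub>C\<^esub> Id C a = f \<and> Id C b \<cdot>\<^bsub>C\<^esub> f = f) \<and>
     (\<forall>a b c d f g h. f \<in> Hom C a b \<longrightarrow> g \<in> Hom C b c \<longrightarrow> h \<in> Hom C c d \<longrightarrow>
        h \<cdot>\<^bsub>C\<^esub> (g \<cdot>\<^bsub>C\<^esub> f) = (h \<cdot>\<^bsub>C\<^esub> g) \<cdot>\<^bsub>C\<^esub> f)"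

text \<open>The opposite category, with cofibrations and fibrations exchanged. Dual notions below
  (colimits, fibrant objects, path objects, right homotopies, double mapping path objects) are
  the given notions read in the opposite category.\<close>

definition op :: "('o, 'm) mcat \<Rightarrow> ('o, 'm) mcat" where
  "op C = \<lparr>Obj = Obj C, Arr = Arr C, Dom = Cod C, Cod = Dom C, Id = Id C,
           comp = (\<lambda>g f. f \<cdot>\<^bsub>C\<^esub> g), Weq = Weq C, Cof = Fib C, Fib = Cof C\<rparr>"

text \<open>A finite diagram is indexed by a finite directed multigraph with vertex set \<open>V\<close> and
  edge set \<open>E\<close>.\<close>

definition finite_diagram ::
  "('o, 'm) mcat \<Rightarrow> nat set \<Rightarrow> nat set \<Rightarrow> (nat \<Rightarrow> nat) \<Rightarrow> (nat \<Rightarrow> nat) \<Rightarrow>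
   (nat \<Rightarrow> 'o) \<Rightarrow> (nat \<Rightarrow> 'm) \<Rightarrow> bool" where
  "finite_diagram C V E src tgt D d \<longleftrightarrow>
     finite V \<and> finite E \<and> src ` E \<subseteq> V \<and> tgt ` E \<subseteq> V \<and> D ` V \<subseteq> Obj C \<and>
     (\<forall>e \<in> E. d e \<in> Hom C (D (src e)) (D (tgt e)))"

definition cone ::
  "('o, 'm) mcat \<Rightarrow> nat set \<Rightarrow> nat set \<Rightarrow> (nat \<Rightarrow> nat) \<Rightarrow> (nat \<Rightarrow> nat) \<Rightarrow>
   (nat \<Rightarrow> 'o) \<Rightarrow> (nat \<Rightarrow> 'm) \<Rightarrow> 'o \<Rightarrow> (nat \<Rightarrow> 'm) \<Rightarrow> bool" where
  "cone C V E src tgt D d L p \<longleftrightarrow>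
     L \<in> Obj C \<and> (\<forall>v \<in> V. p v \<in> Hom C L (D v)) \<and> (\<forall>e \<in> E. d e \<cdot>\<^bsub>C\<^esub> p (src e) = p (tgt e))"

definition has_finite_limits :: "('o, 'm) mcat \<Rightarrow> bool" where
  "has_finite_limits C \<longleftrightarrow>
     (\<forall>V E src tgt D d. finite_diagram C V E src tgt D d \<longrightarrow>
        (\<exists>L p. cone C V E src tgt D d L p \<and>
           (\<forall>L' p'. cone C V E src tgt D d L' p' \<longrightarrow>
              (\<exists>!u. u \<in> Hom C L' L \<and> (\<forall>v \<in> V. p v \<cdot>\<^bsub>C\<^esub> u = p' v)))))"

definition initial :: "('o, 'm) mcat \<Rightarrow> 'o \<Rightarrow> bool" where
  "initial C z \<longleftrightarrow> z \<in> Obj C \<and> (\<forall>x \<in> Obj C. \<exists>!u. u \<in> Hom C z x)"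

definition coproduct :: "('o, 'm) mcat \<Rightarrow> 'o \<Rightarrow> 'o \<Rightarrow> 'o \<Rightarrow> 'm \<Rightarrow> 'm \<Rightarrow> bool" where
  "coproduct C a b S j\<^sub>0 j\<^sub>1 \<longleftrightarrow>
     j\<^sub>0 \<in> Hom C a S \<and> j\<^sub>1 \<in> Hom C b S \<and>
     (\<forall>x f g. f \<in> Hom C a x \<longrightarrow> g \<in> Hom C b x \<longrightarrow>
        (\<exists>!u. u \<in> Hom C S x \<and> u \<cdot>\<^bsub>C\<^esub> j\<^sub>0 = f \<and> u \<cdot>\<^bsub>C\<^esub> j\<^sub>1 = g))"

definition pushout ::
  "('o, 'm) mcat \<Rightarrow> 'm \<Rightarrow> 'm \<Rightarrow> 'o \<Rightarrow> 'm \<Rightarrow> 'm \<Rightarrow> bool" where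
  "pushout C f g S p q \<longleftrightarrow>
     f \<in> Arr C \<and> g \<in> Arr C \<and> Dom C f = Dom C g \<and>
     p \<in> Hom C (Cod C f) S \<and> q \<in> Hom C (Cod C g) S \<and> p \<cdot>\<^bsub>C\<^esub> f = q \<cdot>\<^bsub>C\<^esub> g \<and>
     (\<forall>x p' q'. p' \<in> Hom C (Cod C f) x \<longrightarrow> q' \<in> Hom C (Cod C g) x \<longrightarrow>
        p' \<cdot>\<^bsub>C\<^esub> f = q' \<cdot>\<^bsub>C\<^esub> g \<longrightarrow>
        (\<exists>!u. u \<in> Hom C S x \<and> u \<cdot>\<^bsub>C\<^esub> p = p' \<and> u \<cdot>\<^bsub>C\<^esub> q = q'))"

section \<open>Closed model categories\<close>

definition retract_of :: "('o, 'm) mcat \<Rightarrow> 'm \<Rightarrow> 'm \<Rightarrow> bool" where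
  "retract_of C f g \<longleftrightarrow> f \<in> Arr C \<and> g \<in> Arr C \<and>
     (\<exists>i i' r r'.
        i \<in> Hom C (Dom C f) (Dom C g) \<and> i' \<in> Hom C (Cod C f) (Cod C g) \<and>
        r \<in> Hom C (Dom C g) (Dom C f) \<and> r' \<in> Hom C (Cod C g) (Cod C f) \<and>
        r \<cdot>\<^bsub>C\<^esub> i = Id C (Dom C f) \<and> r' \<cdot>\<^bsub>C\<^esub> i' = Id C (Cod C f) \<and>
        g \<cdot>\<^bsub>C\<^esub> i = i' \<cdot>\<^bsub>C\<^esub> f \<and> f \<cdot>\<^bsub>C\<^esub> r = r' \<cdot>\<^bsub>C\<^esub> g)"

text \<open>Quillen's axioms CM1--CM5.\<close>

definition closed_model_category :: "('o, 'm) mcat \<Rightarrow> bool" where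
  "closed_model_category C \<longleftrightarrow>
     category C \<and> Weq C \<subseteq> Arr C \<and> Cof C \<subseteq> Arr C \<and> Fib C \<subseteq> Arr C \<and>
     has_finite_limits C \<and> has_finite_limits (op C) \<and>
     (\<forall>a b c f g. f \<in> Hom C a b \<longrightarrow> g \<in> Hom C b c \<longrightarrow>
        (f \<in> Weq C \<and> g \<in> Weq C \<longrightarrow> g \<cdot>\<^bsub>C\<^esub> f \<in> Weq C) \<and>
        (f \<in> Weq C \<and> g \<cdot>\<^bsub>C\<^esub> f \<in> Weq C \<longrightarrow> g \<in> Weq C) \<and>
        (g \<in> Weq C \<and> g \<cdot>\<^bsub>C\<^esub> f \<in> Weq C \<longrightarrow> f \<in> Weq C)) \<and>
     (\<forall>f g. retract_of C f g \<longrightarrow>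
        (g \<in> Weq C \<longrightarrow> f \<in> Weq C) \<and> (g \<in> Cof C \<longrightarrow> f \<in> Cof C) \<and> (g \<in> Fib C \<longrightarrow> f \<in> Fib C)) \<and>
     (\<forall>i p f g. i \<in> Cof C \<longrightarrow> p \<in> Fib C \<longrightarrow> i \<in> Weq C \<or> p \<in> Weq C \<longrightarrow>
        f \<in> Hom C (Dom C i) (Dom C p) \<longrightarrow> g \<in> Hom C (Cod C i) (Cod C p) \<longrightarrow>
        p \<cdot>\<^bsub>C\<^esub> f = g \<cdot>\<^bsub>C\<^esub> i \<longrightarrow>
        (\<exists>l \<in> Hom C (Cod C i) (Dom C p). l \<cdot>\<^bsub>C\<^esub> i = f \<and> p \<cdot>\<^bsub>C\<^esub> l = g)) \<and>
     (\<forall>f \<in> Arr C.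
        (\<exists>x. \<exists>i \<in> Hom C (Dom C f) x. \<exists>p \<in> Hom C x (Cod C f).
           i \<in> Cof C \<and> i \<in> Weq C \<and> p \<in> Fib C \<and> f = p \<cdot>\<^bsub>C\<^esub> i) \<and>
        (\<exists>x. \<exists>i \<in> Hom C (Dom C f) x. \<exists>p \<in> Hom C x (Cod C f).
           i \<in> Cof C \<and> p \<in> Fib C \<and> p \<in> Weq C \<and> f = p \<cdot>\<^bsub>C\<^esub> i))"

definition cofibrant :: "('o, 'm) mcat \<Rightarrow> 'o \<Rightarrow> bool" where
  "cofibrant C a \<longleftrightarrow> (\<exists>z. initial C z \<and> (\<exists>m \<in> Hom C z a. m \<in> Cof C))"

definition bifibrant :: "('o, 'm) mcat \<Rightarrow> 'o \<Rightarrow> bool" where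
  "bifibrant C a \<longleftrightarrow> cofibrant C a \<and> cofibrant (op C) a"

section \<open>Homotopies\<close>

text \<open>A homotopy is stored as a cylinder object together with a map \<open>hmap\<close> out of it, so that it
  carries its endpoints \<open>hmap \<cdot> end0\<close> and \<open>hmap \<cdot> end1\<close>. Read in the opposite category, the same
  record is a path object \<open>cyl\<close> with evaluations \<open>end0\<close>, \<open>end1\<close>, constant paths
  \<open>proj\<close>, and a map \<open>hmap\<close> into it.\<close>

record ('o, 'm) cylinder =
  cyl :: 'o
  end0 :: 'm
  end1 :: 'm
  proj :: 'm

record ('o, 'm) htpy = "('o, 'm) cylinder" +
  hmap :: 'm

definition is_cylinder :: "('o, 'm) mcat \<Rightarrow> 'o \<Rightarrow> ('o, 'm, 'z) cylinder_scheme \<Rightarrow> bool" where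
  "is_cylinder C a I \<longleftrightarrow>
     end0 I \<in> Hom C a (cyl I) \<and> end1 I \<in> Hom C a (cyl I) \<and> proj I \<in> Hom C (cyl I) a \<and>
     proj I \<in> Weq C \<and> proj I \<cdot>\<^bsub>C\<^esub> end0 I = Id C a \<and> proj I \<cdot>\<^bsub>C\<^esub> end1 I = Id C a \<and>
     (\<exists>S j\<^sub>0 j\<^sub>1. coproduct C a a S j\<^sub>0 j\<^sub>1 \<and>
        (\<exists>m \<in> Hom C S (cyl I). m \<in> Cof C \<and> m \<cdot>\<^bsub>C\<^esub> j\<^sub>0 = end0 I \<and> m \<cdot>\<^bsub>C\<^esub> j\<^sub>1 = end1 I))"

definition left_homotopy :: "('o, 'm) mcat \<Rightarrow> ('o, 'm) htpy \<Rightarrow> 'm \<Rightarrow> 'm \<Rightarrow> bool" where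
  "left_homotopy C H f g \<longleftrightarrow>
     f \<in> Arr C \<and> g \<in> Hom C (Dom C f) (Cod C f) \<and> is_cylinder C (Dom C f) H \<and>
     hmap H \<in> Hom C (cyl H) (Cod C f) \<and>
     hmap H \<cdot>\<^bsub>C\<^esub> end0 H = f \<and> hmap H \<cdot>\<^bsub>C\<^esub> end1 H = g"

abbreviation right_homotopy :: "('o, 'm) mcat \<Rightarrow> ('o, 'm) htpy \<Rightarrow> 'm \<Rightarrow> 'm \<Rightarrow> bool" where
  "right_homotopy C \<equiv> left_homotopy (op C)"

definition homotopic :: "('o, 'm) mcat \<Rightarrow> 'm \<Rightarrow> 'm \<Rightarrow> bool" where
  "homotopic C f g \<longleftrightarrow> (\<exists>H. left_homotopy C H f g)"

text \<open>Quillen's correspondence between left and right homotopies, both from \<open>f\<close> to \<open>g\<close>. For a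
  cofibrant source and a fibrant target it is a bijection between homotopy classes of left and of
  right homotopies from \<open>f\<close> to \<open>g\<close>; in particular two left homotopies are in the same class
  iff they correspond to a common right homotopy.\<close>

definition corresponds ::
  "('o, 'm) mcat \<Rightarrow> 'm \<Rightarrow> 'm \<Rightarrow> ('o, 'm) htpy \<Rightarrow> ('o, 'm) htpy \<Rightarrow> bool" where
  "corresponds C f g H K \<longleftrightarrow>
     left_homotopy C H f g \<and> right_homotopy C K f g \<and>
     (\<exists>T \<in> Hom C (cyl H) (cyl K).
        T \<cdot>\<^bsub>C\<^esub> end0 H = hmap K \<and> T \<cdot>\<^bsub>C\<^esub> end1 H = proj K \<cdot>\<^bsub>C\<^esub> g \<and>
        end0 K \<cdot>\<^bsub>C\<^esub> T = hmap H \<and> end1 K \<cdot>\<^bsub>C\<^esub> T = g \<cdot>\<^bsub>C\<^esub> proj H)"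

definition same_class ::
  "('o, 'm) mcat \<Rightarrow> 'm \<Rightarrow> 'm \<Rightarrow> ('o, 'm) htpy \<Rightarrow> ('o, 'm) htpy \<Rightarrow> bool" where
  "same_class C f g H H' \<longleftrightarrow> (\<exists>K. corresponds C f g H K \<and> corresponds C f g H' K)"

definition postcomp :: "('o, 'm) mcat \<Rightarrow> 'm \<Rightarrow> ('o, 'm) htpy \<Rightarrow> ('o, 'm) htpy" where
  "postcomp C w H = H\<lparr>hmap := w \<cdot>\<^bsub>C\<^esub> hmap H\<rparr>"

text \<open>A left homotopy from \<open>f\<close> to \<open>g\<close> cannot be precomposed with \<open>x\<close> on the nose, but a
  right homotopy can: \<open>H'\<close>, from \<open>f \<cdot> x\<close> to \<open>g \<cdot> x\<close>, represents the precomposite of \<open>H\<close>.\<close>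

definition precomp ::
  "('o, 'm) mcat \<Rightarrow> 'm \<Rightarrow> 'm \<Rightarrow> ('o, 'm) htpy \<Rightarrow> 'm \<Rightarrow> ('o, 'm) htpy \<Rightarrow> bool" where
  "precomp C f g H x H' \<longleftrightarrow>
     (\<exists>K. corresponds C f g H K \<and>
          corresponds C (f \<cdot>\<^bsub>C\<^esub> x) (g \<cdot>\<^bsub>C\<^esub> x) H' (K\<lparr>hmap := hmap K \<cdot>\<^bsub>C\<^esub> x\<rparr>))"

text \<open>\<open>K\<close> is \<open>H\<close> followed by \<open>H'\<close>, on the cylinder glued from those of \<open>H\<close> and \<open>H'\<close>.\<close>

definition concat ::
  "('o, 'm) mcat \<Rightarrow> ('o, 'm) htpy \<Rightarrow> ('o, 'm) htpy \<Rightarrow> ('o, 'm) htpy \<Rightarrow> bool" where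
  "concat C H H' K \<longleftrightarrow>
     (\<exists>p q. pushout C (end1 H) (end0 H') (cyl K) p q \<and>
        end0 K = p \<cdot>\<^bsub>C\<^esub> end0 H \<and> end1 K = q \<cdot>\<^bsub>C\<^esub> end1 H' \<and>
        proj K \<in> Hom C (cyl K) (Dom C (end0 K)) \<and>
        proj K \<cdot>\<^bsub>C\<^esub> p = proj H \<and> proj K \<cdot>\<^bsub>C\<^esub> q = proj H' \<and>
        hmap K \<in> Hom C (cyl K) (Cod C (hmap H)) \<and>
        hmap K \<cdot>\<^bsub>C\<^esub> p = hmap H \<and> hmap K \<cdot>\<^bsub>C\<^esub> q = hmap H')"

section \<open>Homotopy pushouts and homotopy pullbacks\<close>

text \<open>The homotopy commutative square with maps \<open>f : c \<rightarrow> a\<close>, \<open>g : c \<rightarrow> b\<close>,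
  \<open>u : a \<rightarrow> d\<close>, \<open>v : b \<rightarrow> d\<close> and chosen homotopy \<open>H\<close> from \<open>u \<cdot> f\<close> to
  \<open>v \<cdot> g\<close>.\<close>

definition hsquare ::
  "('o, 'm) mcat \<Rightarrow> 'm \<Rightarrow> 'm \<Rightarrow> 'm \<Rightarrow> 'm \<Rightarrow> ('o, 'm) htpy \<Rightarrow> bool" where
  "hsquare C f g u v H \<longleftrightarrow>
     (\<exists>c a b d. bifibrant C c \<and> bifibrant C a \<and> bifibrant C b \<and> bifibrant C d \<and>
        f \<in> Hom C c a \<and> g \<in> Hom C c b \<and> u \<in> Hom C a d \<and> v \<in> Hom C b d) \<and>
     left_homotopy C H (u \<cdot>\<^bsub>C\<^esub> f) (v \<cdot>\<^bsub>C\<^esub> g)"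

text \<open>A cocone of the zigzag \<open>a \<leftarrow> c \<rightarrow> cyl I \<leftarrow> c \<rightarrow> b\<close>, where the outer maps are \<open>f\<close> and
  \<open>g\<close>: the same as a pair of maps out of \<open>a\<close> and \<open>b\<close> with a homotopy on \<open>I\<close> between their
  composites with \<open>f\<close> and \<open>g\<close>. Its colimit is the double mapping cylinder of \<open>f\<close> and \<open>g\<close>.\<close>

definition dmc_cocone ::
  "('o, 'm) mcat \<Rightarrow> 'm \<Rightarrow> 'm \<Rightarrow> ('o, 'm, 'z) cylinder_scheme \<Rightarrow> 'o \<Rightarrow> 'm \<Rightarrow> 'm \<Rightarrow> 'm \<Rightarrow> bool" where
  "dmc_cocone C f g I x u h v \<longleftrightarrow>
     u \<in> Hom C (Cod C f) x \<and> h \<in> Hom C (cyl I) x \<and> v \<in> Hom C (Cod C g) x \<and>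
     h \<cdot>\<^bsub>C\<^esub> end0 I = u \<cdot>\<^bsub>C\<^esub> f \<and> h \<cdot>\<^bsub>C\<^esub> end1 I = v \<cdot>\<^bsub>C\<^esub> g"

definition dmc_map ::
  "('o, 'm) mcat \<Rightarrow> 'o \<Rightarrow> 'm \<Rightarrow> 'm \<Rightarrow> 'm \<Rightarrow> 'o \<Rightarrow> 'm \<Rightarrow> 'm \<Rightarrow> 'm \<Rightarrow> 'm \<Rightarrow> bool" where
  "dmc_map C D a t b x u h v e \<longleftrightarrow>
     e \<in> Hom C D x \<and> e \<cdot>\<^bsub>C\<^esub> a = u \<and> e \<cdot>\<^bsub>C\<^esub> t = h \<and> e \<cdot>\<^bsub>C\<^esub> b = v"

definition double_mapping_cylinder ::
  "('o, 'm) mcat \<Rightarrow> 'm \<Rightarrow> 'm \<Rightarrow> ('o, 'm, 'z) cylinder_scheme \<Rightarrow> 'o \<Rightarrow> 'm \<Rightarrow> 'm \<Rightarrow> 'm \<Rightarrow> bool" where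
  "double_mapping_cylinder C f g I D a t b \<longleftrightarrow>
     dmc_cocone C f g I D a t b \<and>
     (\<forall>x u h v. dmc_cocone C f g I x u h v \<longrightarrow> (\<exists>!e. dmc_map C D a t b x u h v e))"

definition dmc_comparison_weq ::
  "('o, 'm) mcat \<Rightarrow> 'm \<Rightarrow> 'm \<Rightarrow> 'm \<Rightarrow> 'm \<Rightarrow> ('o, 'm) htpy \<Rightarrow> bool" where
  "dmc_comparison_weq C f g u v H \<longleftrightarrow>
     (\<exists>D a t b e. double_mapping_cylinder C f g H D a t b \<and>
        dmc_map C D a t b (Cod C u) u (hmap H) v e \<and> e \<in> Weq C)"

definition hpushout ::
  "('o, 'm) mcat \<Rightarrow> 'm \<Rightarrow> 'm \<Rightarrow> 'm \<Rightarrow> 'm \<Rightarrow> ('o, 'm) htpy \<Rightarrow> bool" where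
  "hpushout C f g u v H \<longleftrightarrow> hsquare C f g u v H \<and> dmc_comparison_weq C f g u v H"

text \<open>Dually, the map induced by a right homotopy corresponding to \<open>H\<close>, from \<open>c\<close> into the double
  mapping path object of \<open>u\<close> and \<open>v\<close>, is a weak equivalence.\<close>

definition hpullback ::
  "('o, 'm) mcat \<Rightarrow> 'm \<Rightarrow> 'm \<Rightarrow> 'm \<Rightarrow> 'm \<Rightarrow> ('o, 'm) htpy \<Rightarrow> bool" where
  "hpullback C f g u v H \<longleftrightarrow> hsquare C f g u v H \<and>
     (\<exists>K. corresponds C (u \<cdot>\<^bsub>C\<^esub> f) (v \<cdot>\<^bsub>C\<^esub> g) H K \<and> dmc_comparison_weq (op C) u v f g K)"

text \<open>\<open>w\<close> is the whisker map from the homotopy pushout \<open>(f, g, u, v, H)\<close> to the homotopy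
  commutative square \<open>(f, g, x, y)\<close> whose homotopy \<open>k\<close> lives on the cylinder of \<open>H\<close>:
  up to homotopy it is the strict map induced by \<open>(x, k, y)\<close> on the double mapping cylinder.\<close>

definition whisker ::
  "('o, 'm) mcat \<Rightarrow> 'm \<Rightarrow> 'm \<Rightarrow> 'm \<Rightarrow> 'm \<Rightarrow> ('o, 'm) htpy \<Rightarrow> 'm \<Rightarrow> 'm \<Rightarrow> 'm \<Rightarrow> 'm \<Rightarrow> bool" where
  "whisker C f g u v H x y k w \<longleftrightarrow>
     (\<exists>D a t b e d. double_mapping_cylinder C f g H D a t b \<and>
        dmc_map C D a t b (Cod C u) u (hmap H) v e \<and>
        dmc_map C D a t b (Cod C x) x k y d \<and>
        w \<in> Hom C (Cod C u) (Cod C x) \<and> homotopic C (w \<cdot>\<^bsub>C\<^esub> e) d)"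

section \<open>The Cube axiom\<close>

text \<open>A cube with top face \<open>(f, g, u, v)\<close> from \<open>c\<close> to \<open>d\<close>, bottom face \<open>(f', g', u', v')\<close>
  from \<open>c'\<close> to \<open>d'\<close>, and vertical maps \<open>pc\<close>, \<open>pa\<close>, \<open>pb\<close>, \<open>pd\<close>. The homotopies on
  its faces are compatible if the two ways of pasting them to homotopies
  \<open>pd \<cdot> u \<cdot> f \<simeq> pd \<cdot> v \<cdot> g \<simeq> v' \<cdot> pb \<cdot> g \<simeq> v' \<cdot> g' \<cdot> pc\<close> and
  \<open>pd \<cdot> u \<cdot> f \<simeq> u' \<cdot> pa \<cdot> f \<simeq> u' \<cdot> f' \<cdot> pc \<simeq> v' \<cdot> g' \<cdot> pc\<close> agree.\<close>

definition hcube ::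
  "('o, 'm) mcat \<Rightarrow> 'm \<Rightarrow> 'm \<Rightarrow> 'm \<Rightarrow> 'm \<Rightarrow> 'm \<Rightarrow> 'm \<Rightarrow> 'm \<Rightarrow> 'm \<Rightarrow> 'm \<Rightarrow> 'm \<Rightarrow> 'm \<Rightarrow> 'm \<Rightarrow>
   ('o, 'm) htpy \<Rightarrow> ('o, 'm) htpy \<Rightarrow> ('o, 'm) htpy \<Rightarrow> ('o, 'm) htpy \<Rightarrow> ('o, 'm) htpy \<Rightarrow>
   ('o, 'm) htpy \<Rightarrow> bool" where
  "hcube C f g u v f' g' u' v' pc pa pb pd Ht Hb Hca Hcb Had Hbd \<longleftrightarrow>
     hsquare C f g u v Ht \<and> hsquare C f' g' u' v' Hb \<and>
     hsquare C f pc pa f' Hca \<and> hsquare C g pc pb g' Hcb \<and>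
     hsquare C u pa pd u' Had \<and> hsquare C v pb pd v' Hbd \<and>
     (\<exists>Jbd Jad Jb K L K' L'.
        precomp C (pd \<cdot>\<^bsub>C\<^esub> v) (v' \<cdot>\<^bsub>C\<^esub> pb) Hbd g Jbd \<and>
        precomp C (pd \<cdot>\<^bsub>C\<^esub> u) (u' \<cdot>\<^bsub>C\<^esub> pa) Had f Jad \<and>
        precomp C (u' \<cdot>\<^bsub>C\<^esub> f') (v' \<cdot>\<^bsub>C\<^esub> g') Hb pc Jb \<and>
        concat C (postcomp C pd Ht) Jbd K \<and> concat C K (postcomp C v' Hcb) L \<and>
        concat C Jad (postcomp C u' Hca) K' \<and> concat C K' Jb L' \<and>
        same_class C (pd \<cdot>\<^bsub>C\<^esub> (u \<cdot>\<^bsub>C\<^esub> f)) (v' \<cdot>\<^bsub>C\<^esub> (g' \<cdot>\<^bsub>C\<^esub> pc)) L L')"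

definition cube_axiom :: "('o, 'm) mcat \<Rightarrow> bool" where
  "cube_axiom C \<longleftrightarrow>
     (\<forall>f g u v f' g' u' v' pc pa pb pd Ht Hb Hca Hcb Had Hbd.
        hcube C f g u v f' g' u' v' pc pa pb pd Ht Hb Hca Hcb Had Hbd \<longrightarrow>
        hpushout C f' g' u' v' Hb \<longrightarrow>
        hpullback C f pc pa f' Hca \<longrightarrow> hpullback C g pc pb g' Hcb \<longrightarrow>
        hpullback C u pa pd u' Had \<longrightarrow> hpullback C v pb pd v' Hbd \<longrightarrow>
        hpushout C f g u v Ht)"

section \<open>Relative category and strong relative category\<close>

text \<open>\<open>ganea C \<iota> n g \<alpha>\<close>: the maps \<open>g\<close> and \<open>\<alpha>\<close> are \<open>g\<^sub>n : G\<^sub>n \<rightarrow> X\<close> and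
  \<open>\<alpha>\<^sub>n : A \<rightarrow> G\<^sub>n\<close> for some choice of the homotopy pullbacks, homotopy pushouts and whisker
  maps in the Ganea construction of \<open>\<iota> : A \<rightarrow> X\<close>; the object \<open>G\<^sub>n\<close> is \<open>Dom C g\<close>. The homotopy
  pullback and the homotopy pushout of a stage use one cylinder of \<open>F\<^sub>n\<close>.\<close>

inductive ganea :: "('o, 'm) mcat \<Rightarrow> 'm \<Rightarrow> nat \<Rightarrow> 'm \<Rightarrow> 'm \<Rightarrow> bool" for C \<iota> where
  "ganea C \<iota> 0 \<iota> (Id C (Dom C \<iota>))"
| "ganea C \<iota> n g \<alpha> \<Longrightarrow> hpullback C \<eta> \<beta> \<iota> g H \<Longrightarrow>
   hpushout C \<eta> \<beta> \<alpha>' \<gamma> (H\<lparr>hmap := h\<rparr>) \<Longrightarrow>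
   whisker C \<eta> \<beta> \<alpha>' \<gamma> (H\<lparr>hmap := h\<rparr>) \<iota> g (hmap H) g' \<Longrightarrow>
   ganea C \<iota> (Suc n) g' \<alpha>'"

text \<open>The empty infimum in \<open>enat\<close> is \<open>\<infinity>\<close>.\<close>

definition relcat :: "('o, 'm) mcat \<Rightarrow> 'm \<Rightarrow> enat" where
  "relcat C \<iota> = Inf {enat n | n. \<exists>g \<alpha>. ganea C \<iota> n g \<alpha> \<and>
     (\<exists>\<sigma> \<in> Hom C (Cod C \<iota>) (Dom C g).
        homotopic C (g \<cdot>\<^bsub>C\<^esub> \<sigma>) (Id C (Cod C \<iota>)) \<and> homotopic C (\<sigma> \<cdot>\<^bsub>C\<^esub> \<iota>) \<alpha>)}"

definition has_homotopy_inverse :: "('o, 'm) mcat \<Rightarrow> 'm \<Rightarrow> bool" where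
  "has_homotopy_inverse C f \<longleftrightarrow>
     (\<exists>k \<in> Hom C (Cod C f) (Dom C f).
        homotopic C (k \<cdot>\<^bsub>C\<^esub> f) (Id C (Dom C f)) \<and> homotopic C (f \<cdot>\<^bsub>C\<^esub> k) (Id C (Cod C f)))"

text \<open>The homotopies \<open>\<iota>\<^sub>i\<^sub>+\<^sub>1 \<cdot> \<rho> \<simeq> \<chi> \<cdot> \<tau>\<close>, \<open>\<rho> \<cdot> \<sigma> \<simeq> id\<close> and \<open>\<tau> \<cdot> \<sigma> \<simeq> \<iota>\<^sub>i\<close> can be chosen
  independently. The remaining triangle \<open>\<chi> \<cdot> \<iota>\<^sub>i \<simeq> \<iota>\<^sub>i\<^sub>+\<^sub>1\<close> of the diagram is filled by
  pasting these three, so it imposes no further condition.\<close>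

definition strong_relcat_le :: "('o, 'm) mcat \<Rightarrow> 'm \<Rightarrow> nat \<Rightarrow> bool" where
  "strong_relcat_le C \<iota> n \<longleftrightarrow>
     (\<exists>X i. X n = Cod C \<iota> \<and>
        (\<forall>k \<le> n. bifibrant C (X k) \<and> i k \<in> Hom C (Dom C \<iota>) (X k)) \<and>
        has_homotopy_inverse C (i 0) \<and>
        (\<forall>k < n. \<exists>Z \<rho> \<tau> \<chi> H \<sigma>.
           \<rho> \<in> Hom C Z (Dom C \<iota>) \<and> \<tau> \<in> Hom C Z (X k) \<and> \<chi> \<in> Hom C (X k) (X (Suc k)) \<and>
           hpushout C \<rho> \<tau> (i (Suc k)) \<chi> H \<and>
           \<sigma> \<in> Hom C (Dom C \<iota>) Z \<and>
           homotopic C (\<rho> \<cdot>\<^bsub>C\<^esub> \<sigma>) (Id C (Dom C \<iota>)) \<and> homotopic C (\<tau> \<cdot>\<^bsub>C\<^esub> \<sigma>) (i k)) \<and>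
        homotopic C (i n) \<iota>)"

definition Relcat :: "('o, 'm) mcat \<Rightarrow> 'm \<Rightarrow> enat" where
  "Relcat C \<iota> = Inf {enat n | n. strong_relcat_le C \<iota> n}"

end

theory Submission
  imports Defs
begin

text \<open>
  Both invariants are controlled by one inductive notion, \<open>built C n \<iota>\<close>, which is stable under base
  change and under cobase change. A map is built in \<open>0\<close> steps if it is a weak equivalence. A map
  \<open>\<iota> : A \<rightarrow> Y\<close> is built in \<open>n + 1\<close> steps if \<open>Y\<close> is a homotopy pushout of maps \<open>A \<leftarrow> Z \<rightarrow> X\<close> such that
  \<open>Z \<rightarrow> A\<close> has a section whose composite with \<open>Z \<rightarrow> X\<close> is built in \<open>n\<close> steps. Here all diagrams commute
  strictly and the notion is closed under weak equivalences of maps.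

  \<^item> \<open>Relcat \<iota> \<le> n\<close> holds iff \<open>\<iota>\<close> is built in \<open>n\<close> steps (\<open>strong_relcat_iff_built\<close>). A diagram commuting
    up to homotopy is rectified by replacing \<open>X\<close> with a mapping cylinder, so that the square commutes,
    and \<open>Z \<rightarrow> A\<close> with a fibration, so that the section becomes strict.

  \<^item> \<open>relcat \<iota> \<le> n\<close> holds iff there is a map \<open>s : X \<rightarrow> K\<close> with a homotopy retraction such that
    \<open>s \<cdot> \<iota>\<close> is built in \<open>n\<close> steps (\<open>relcat_iff_retract_built\<close>). For one direction take \<open>K = G\<^sub>n\<close>: the map
    \<open>\<alpha>\<^sub>n\<close> is built in \<open>n\<close> steps, because \<open>F\<^sub>i \<rightarrow> A\<close> has a section lifting \<open>\<alpha>\<^sub>i\<close>. For the other,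
    anything built over \<open>X\<close> in \<open>n\<close> steps maps to \<open>G\<^sub>n\<close> over \<open>X\<close> and under \<open>A\<close> up to homotopy, one attachment at a time. A
    homotopy \<open>r \<cdot> s \<simeq> id\<close> can be made an equality by deforming \<open>s\<close>, and \<open>s \<cdot> \<iota>\<close> stays built in \<open>n\<close>
    steps; so homotopy retracts behave like strict ones.

  Base change along \<open>M \<rightarrow> Y\<close> turns an attachment into a cube over it with homotopy pullbacks as vertical
  faces; by the Cube axiom the top face is again an attachment, and the section is pulled back
  (\<open>built_base_change\<close>). Cobase change along \<open>P \<rightarrow> A\<close> only needs the pasting of homotopy pushouts
  (\<open>built_cobase_change\<close>). Homotopy retracts are preserved by both operations, so the four inequalities follow.

  The first sections provide the homotopy theory used on the way: homotopies between maps of suitable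
  objects, the gluing lemma, and a calculus of homotopy pushout squares that commute strictly. The
  statements are also used in the opposite category, where they become their duals.
\<close>

section \<open>Categories and their opposites\<close>

lemma op_simps [simp]:
  "Obj (op C) = Obj C" "Arr (op C) = Arr C" "Dom (op C) = Cod C" "Cod (op C) = Dom C"
  "Id (op C) = Id C" "comp (op C) g f = comp C f g"
  "Weq (op C) = Weq C" "Cof (op C) = Fib C" "Fib (op C) = Cof C"
  by (simp_all add: op_def)

lemma op_op [simp]: "op (op C) = C"
  by (simp add: op_def)

lemma Hom_op [simp]: "Hom (op C) a b = Hom C b a"
  by (auto simp: Hom_def)

locale small_category =
  fixes C :: "('o, 'm) mcat" (structure)
  assumes category_axioms': "category C"
begin

abbreviation hom :: "'o \<Rightarrow> 'o \<Rightarrow> 'm set" where "hom \<equiv> Hom C"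

lemma comp_in: "f \<in> hom a b \<Longrightarrow> g \<in> hom b c \<Longrightarrow> g \<cdot> f \<in> hom a c"
  using category_axioms' by (simp add: category_def)

lemma Hom_iff: "f \<in> hom a b \<longleftrightarrow> f \<in> Arr C \<and> Dom C f = a \<and> Cod C f = b \<and> a \<in> Obj C \<and> b \<in> Obj C"
  using category_axioms' by (auto simp: category_def Hom_def)

lemma Id_in: "a \<in> Obj C \<Longrightarrow> Id C a \<in> hom a a"
  using category_axioms' by (simp add: category_def)

lemma Id_arr: "a \<in> Obj C \<Longrightarrow> Id C a \<in> Arr C" "a \<in> Obj C \<Longrightarrow> Dom C (Id C a) = a"
  "a \<in> Obj C \<Longrightarrow> Cod C (Id C a) = a"
  using Id_in by (auto simp: Hom_iff)

lemma arr_obj: "f \<in> Arr C \<Longrightarrow> Dom C f \<in> Obj C" "f \<in> Arr C \<Longrightarrow> Cod C f \<in> Obj C"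
  using category_axioms' by (auto simp: category_def)

lemma arr_hom: "f \<in> Arr C \<Longrightarrow> f \<in> hom (Dom C f) (Cod C f)"
  by (simp add: Hom_def)

lemma comp_arr:
  assumes "f \<in> Arr C" "g \<in> Arr C" "Cod C f = Dom C g"
  shows "g \<cdot> f \<in> Arr C" "Dom C (g \<cdot> f) = Dom C f" "Cod C (g \<cdot> f) = Cod C g"
proof -
  have "g \<cdot> f \<in> hom (Dom C f) (Cod C g)"
    using assms by (intro comp_in[of f _ "Dom C g"]) (auto simp: Hom_def)
  then show "g \<cdot> f \<in> Arr C" "Dom C (g \<cdot> f) = Dom C f" "Cod C (g \<cdot> f) = Cod C g"
    by (auto simp: Hom_def)
qed

lemma assoc_hom:
  assumes "f \<in> hom a b" "g \<in> hom b c" "h \<in> hom c d"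
  shows "h \<cdot> (g \<cdot> f) = (h \<cdot> g) \<cdot> f"
  by (rule category_axioms'[unfolded category_def, THEN conjunct2, THEN conjunct2, THEN conjunct2,
        THEN conjunct2, rule_format, OF assms])

lemma assoc:
  assumes "f \<in> Arr C" "g \<in> Arr C" "h \<in> Arr C" "Cod C f = Dom C g" "Cod C g = Dom C h"
  shows "(h \<cdot> g) \<cdot> f = h \<cdot> (g \<cdot> f)"
proof -
  have "f \<in> hom (Dom C f) (Cod C f)" "g \<in> hom (Cod C f) (Cod C g)" "h \<in> hom (Cod C g) (Cod C h)"
    using assms by (auto simp: Hom_def)
  then show ?thesis
    using assoc_hom by metis
qed

lemma Id_left: "f \<in> Arr C \<Longrightarrow> Cod C f = b \<Longrightarrow> Id C b \<cdot> f = f"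
  using category_axioms'[unfolded category_def, THEN conjunct2, THEN conjunct2, THEN conjunct2,
      THEN conjunct1, rule_format, of f "Dom C f" "Cod C f"] by (auto simp: Hom_def)

lemma Id_right: "f \<in> Arr C \<Longrightarrow> Dom C f = a \<Longrightarrow> f \<cdot> Id C a = f"
  using category_axioms'[unfolded category_def, THEN conjunct2, THEN conjunct2, THEN conjunct2,
      THEN conjunct1, rule_format, of f "Dom C f" "Cod C f"] by (auto simp: Hom_def)

text \<open>Rewriting with these rules types composites and brackets them to the right.\<close>

lemmas cs = Hom_iff Id_arr comp_arr assoc Id_left Id_right

text \<open>An equation between composites, made applicable inside a right-bracketed composite.\<close>

lemma pre:
  "x \<cdot> y = r \<Longrightarrow> y \<in> Arr C \<Longrightarrow> x \<in> Arr C \<Longrightarrow> Cod C y = Dom C x \<Longrightarrow> k \<in> Arr C \<Longrightarrow> Cod C k = Dom C y \<Longrightarrow>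
   x \<cdot> (y \<cdot> k) = r \<cdot> k"
  using assoc[of k y x] by simp

lemma pushoutD:
  assumes "pushout C f g S p q" "f \<in> hom c a" "g \<in> hom c' b"
  shows "c' = c" "p \<in> hom a S" "q \<in> hom b S" "p \<cdot> f = q \<cdot> g"
  using assms by (auto simp: pushout_def Hom_def)

lemma pushout_ex1:
  assumes "pushout C f g S p q" "f \<in> hom c a" "g \<in> hom c b" "p' \<in> hom a x" "q' \<in> hom b x"
    "p' \<cdot> f = q' \<cdot> g"
  shows "\<exists>!u. u \<in> hom S x \<and> u \<cdot> p = p' \<and> u \<cdot> q = q'"
proof -
  have "Cod C f = a" "Cod C g = b" using assms by (auto simp: Hom_def)
  then show ?thesis using assms unfolding pushout_def by metis
qed

lemma pushout_univ:
  assumes "pushout C f g S p q" "f \<in> hom c a" "g \<in> hom c b" "p' \<in> hom a x" "q' \<in> hom b x"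
    "p' \<cdot> f = q' \<cdot> g"
  obtains u where "u \<in> hom S x" "u \<cdot> p = p'" "u \<cdot> q = q'"
  using pushout_ex1[OF assms] by auto

lemma pushout_eq:
  assumes "pushout C f g S p q" "u \<in> hom S x" "w \<in> hom S x" "u \<cdot> p = w \<cdot> p" "u \<cdot> q = w \<cdot> q"
  shows "u = w"
proof -
  have t: "f \<in> Arr C" "g \<in> Arr C" "Dom C f = Dom C g" and pq: "p \<in> hom (Cod C f) S" "q \<in> hom (Cod C g) S" "p \<cdot> f = q \<cdot> g"
    using assms(1) by (auto simp: pushout_def)
  have "\<exists>!u. u \<in> hom S x \<and> u \<cdot> p = w \<cdot> p \<and> u \<cdot> q = w \<cdot> q"
  proof (rule pushout_ex1[OF assms(1)])
    show "f \<in> hom (Dom C f) (Cod C f)" "g \<in> hom (Dom C f) (Cod C g)"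
      using t by (auto simp: Hom_def)
    show "w \<cdot> p \<in> hom (Cod C f) x" "w \<cdot> q \<in> hom (Cod C g) x"
      using pq assms(3) comp_in by blast+
    show "w \<cdot> p \<cdot> f = w \<cdot> q \<cdot> g"
      using pq t assms(3) by (simp add: cs)
  qed
  then show ?thesis using assms by blast
qed

lemma pushout_sym: "pushout C f g S p q \<Longrightarrow> pushout C g f S q p"
  unfolding pushout_def by (elim conjE) (intro conjI; (simp; fail)?; metis)

lemma pushoutI:
  assumes "f \<in> hom c a" "g \<in> hom c b" "p \<in> hom a S" "q \<in> hom b S" "p \<cdot> f = q \<cdot> g"
    and "\<And>x p' q'. p' \<in> hom a x \<Longrightarrow> q' \<in> hom b x \<Longrightarrow> p' \<cdot> f = q' \<cdot> g \<Longrightarrow>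
      \<exists>u \<in> hom S x. u \<cdot> p = p' \<and> u \<cdot> q = q'"
    and "\<And>x u w. u \<in> hom S x \<Longrightarrow> w \<in> hom S x \<Longrightarrow> u \<cdot> p = w \<cdot> p \<Longrightarrow> u \<cdot> q = w \<cdot> q \<Longrightarrow> u = w"
  shows "pushout C f g S p q"
proof -
  have t: "f \<in> Arr C" "g \<in> Arr C" "Dom C f = Dom C g" "Cod C f = a" "Cod C g = b"
    using assms(1,2) by (auto simp: Hom_iff)
  have "\<exists>!u. u \<in> hom S x \<and> u \<cdot> p = p' \<and> u \<cdot> q = q'"
    if "p' \<in> hom a x" "q' \<in> hom b x" "p' \<cdot> f = q' \<cdot> g" for x p' q'
    using assms(6)[OF that] assms(7)[of _ x] by metis
  then show ?thesis
    unfolding pushout_def t using assms t by auto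
qed

lemma pushout_paste:
  assumes 1: "pushout C f g S p q" and 2: "pushout C q k T r s"
    and f: "f \<in> hom c a" and g: "g \<in> hom c b" and k: "k \<in> hom b e"
  shows "pushout C f (k \<cdot> g) T (r \<cdot> p) s"
proof -
  note D1 = pushoutD[OF 1 f g]
  note D2 = pushoutD[OF 2 D1(3) k]
  show ?thesis
  proof (rule pushoutI[OF f comp_in[OF g k] comp_in[OF D1(2) D2(2)] D2(3)])
    show "r \<cdot> p \<cdot> f = s \<cdot> (k \<cdot> g)"
      using D1 D2 f g k by (simp add: cs D1(4) D2(4) D2(4)[THEN pre])
  next
    fix x p' q' assume x: "p' \<in> hom a x" "q' \<in> hom e x" "p' \<cdot> f = q' \<cdot> (k \<cdot> g)"
    have "q' \<cdot> k \<in> hom b x" using x k comp_in by blast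
    moreover have "p' \<cdot> f = (q' \<cdot> k) \<cdot> g" using x f g k by (simp add: cs)
    ultimately obtain u where u: "u \<in> hom S x" "u \<cdot> p = p'" "u \<cdot> q = q' \<cdot> k"
      using pushout_univ[OF 1 f g x(1)] by metis
    obtain w where w: "w \<in> hom T x" "w \<cdot> r = u" "w \<cdot> s = q'"
      using pushout_univ[OF 2 D1(3) k u(1) x(2) u(3)] .
    have "w \<cdot> (r \<cdot> p) = p'"
      using w u D2 D1 by (simp add: cs w(2)[THEN pre])
    then show "\<exists>u\<in>hom T x. u \<cdot> (r \<cdot> p) = p' \<and> u \<cdot> s = q'" using w by blast
  next
    fix x u w assume x: "u \<in> hom T x" "w \<in> hom T x" "u \<cdot> (r \<cdot> p) = w \<cdot> (r \<cdot> p)" "u \<cdot> s = w \<cdot> s"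
    have "u \<cdot> r = w \<cdot> r"
    proof (rule pushout_eq[OF 1, of _ x])
      show "u \<cdot> r \<in> hom S x" "w \<cdot> r \<in> hom S x" using x D2 comp_in by blast+
      show "u \<cdot> r \<cdot> p = w \<cdot> r \<cdot> p" using x D2 D1 by (simp add: cs)
      have "u \<cdot> r \<cdot> q = u \<cdot> s \<cdot> k" using x(1) D2 D1 k by (simp add: cs)
      also have "\<dots> = w \<cdot> s \<cdot> k" using x by simp
      also have "\<dots> = w \<cdot> r \<cdot> q" using x(2) D2 D1 k by (simp add: cs)
      finally show "u \<cdot> r \<cdot> q = w \<cdot> r \<cdot> q" .
    qed
    then show "u = w" using pushout_eq[OF 2] x by blast
  qed
qed

lemma pushout_cancel:
  assumes 1: "pushout C f g S p q" and 2: "pushout C f (k \<cdot> g) T r s"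
    and f: "f \<in> hom c a" and g: "g \<in> hom c b" and k: "k \<in> hom b e"
    and t: "t \<in> hom S T" "t \<cdot> p = r" "t \<cdot> q = s \<cdot> k"
  shows "pushout C q k T t s"
proof -
  note D1 = pushoutD[OF 1 f g]
  note D2 = pushoutD[OF 2 f comp_in[OF g k]]
  show ?thesis
  proof (rule pushoutI[OF D1(3) k t(1) D2(3) t(3)])
    fix x p' q' assume x: "p' \<in> hom S x" "q' \<in> hom e x" "p' \<cdot> q = q' \<cdot> k"
    have pp: "p' \<cdot> p \<in> hom a x" using x D1 comp_in by blast
    have "p' \<cdot> p \<cdot> f = q' \<cdot> (k \<cdot> g)"
      using x D1 k f g by (simp add: cs x(3)[THEN pre])
    then obtain u where u: "u \<in> hom T x" "u \<cdot> r = p' \<cdot> p" "u \<cdot> s = q'"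
      using pushout_univ[OF 2 f comp_in[OF g k] pp x(2)] by metis
    have "u \<cdot> t = p'"
    proof (rule pushout_eq[OF 1, of _ x])
      show "u \<cdot> t \<in> hom S x" "p' \<in> hom S x" using u t x comp_in by blast+
      show "u \<cdot> t \<cdot> p = p' \<cdot> p" using u t x D1 D2 by (simp add: cs)
      have "u \<cdot> t \<cdot> q = u \<cdot> s \<cdot> k" using u(1) t x D1 D2 k by (simp add: cs)
      then show "u \<cdot> t \<cdot> q = p' \<cdot> q" using u x by simp
    qed
    then show "\<exists>u\<in>hom T x. u \<cdot> t = p' \<and> u \<cdot> s = q'" using u by blast
  next
    fix x u w assume x: "u \<in> hom T x" "w \<in> hom T x" "u \<cdot> t = w \<cdot> t" "u \<cdot> s = w \<cdot> s"
    show "u = w"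
    proof (rule pushout_eq[OF 2 x(1,2) _ x(4)])
      have "u \<cdot> t \<cdot> p = w \<cdot> t \<cdot> p" using x(3) by simp
      then show "u \<cdot> r = w \<cdot> r" using x(1,2) t D1 D2 by (simp add: cs)
    qed
  qed
qed

lemma coproductD:
  assumes "coproduct C a b S i j"
  shows "i \<in> hom a S" "j \<in> hom b S"
  using assms by (auto simp: coproduct_def)

lemma coproduct_univ:
  assumes "coproduct C a b S i j" "f \<in> hom a x" "g \<in> hom b x"
  obtains u where "u \<in> hom S x" "u \<cdot> i = f" "u \<cdot> j = g"
  using assms unfolding coproduct_def by metis

lemma coproduct_eq:
  assumes "coproduct C a b S i j" "u \<in> hom S x" "w \<in> hom S x" "u \<cdot> i = w \<cdot> i" "u \<cdot> j = w \<cdot> j"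
  shows "u = w"
proof -
  have "\<exists>!u. u \<in> hom S x \<and> u \<cdot> i = w \<cdot> i \<and> u \<cdot> j = w \<cdot> j"
    using assms comp_in[OF coproductD(1)[OF assms(1)] assms(3)]
      comp_in[OF coproductD(2)[OF assms(1)] assms(3)] unfolding coproduct_def by metis
  then show ?thesis using assms by blast
qed

lemma coproduct_sym: "coproduct C a b S i j \<Longrightarrow> coproduct C b a S j i"
  unfolding coproduct_def by metis

end

lemma category_op: "category C \<Longrightarrow> category (op C)"
proof -
  assume "category C"
  then interpret small_category C by unfold_locales
  show ?thesis
    unfolding category_def
  proof (intro conjI allI impI ballI)
    show "Id (op C) a \<in> Hom (op C) a a" if "a \<in> Obj (op C)" for a using that Id_in by simp
    show "comp (op C) g f \<in> Hom (op C) a c" if "f \<in> Hom (op C) a b" "g \<in> Hom (op C) b c" for a b c f g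
      using that comp_in by auto
    show "comp (op C) h (comp (op C) g f) = comp (op C) (comp (op C) h g) f"
      if "f \<in> Hom (op C) a b" "g \<in> Hom (op C) b c" "h \<in> Hom (op C) c d" for a b c d f g h
      using that assoc_hom[of h d c g b f a] by simp
  qed (auto simp: arr_obj Id_left Id_right Hom_def)
qed

section \<open>Finite colimits\<close>

context small_category begin

lemma colimit_ex:
  assumes "has_finite_limits (op C)" "finite_diagram (op C) V E src tgt D d"
  shows "\<exists>L p. cone (op C) V E src tgt D d L p \<and>
    (\<forall>L' p'. cone (op C) V E src tgt D d L' p' \<longrightarrow>
      (\<exists>!u. u \<in> hom L L' \<and> (\<forall>v \<in> V. u \<cdot> p v = p' v)))"
  using assms(1)[unfolded has_finite_limits_def, rule_format, OF assms(2)]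
  unfolding op_simps Hom_op .

lemma initial_ex:
  assumes "has_finite_limits (op C)"
  obtains z where "initial C z"
proof -
  have "finite_diagram (op C) {} {} (\<lambda>_. 0) (\<lambda>_. 0) (\<lambda>_. undefined) (\<lambda>_. undefined)"
    by (simp add: finite_diagram_def)
  from colimit_ex[OF assms this] obtain L where L: "L \<in> Obj C"
    "\<And>L'. L' \<in> Obj C \<Longrightarrow> \<exists>!u. u \<in> hom L L'"
    unfolding cone_def by auto
  then show ?thesis using that unfolding initial_def by blast
qed

lemma coproduct_ex:
  assumes "has_finite_limits (op C)" "a \<in> Obj C" "b \<in> Obj C"
  obtains S i j where "coproduct C a b S i j"
proof -
  let ?D = "\<lambda>v::nat. if v = 0 then a else b"
  have "finite_diagram (op C) {0,1} {} (\<lambda>_. 0) (\<lambda>_. 0) ?D (\<lambda>_. undefined)"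
    using assms by (auto simp: finite_diagram_def)
  from colimit_ex[OF assms(1) this] obtain S p where
    c: "cone (op C) {0,1} {} (\<lambda>_. 0) (\<lambda>_. 0) ?D (\<lambda>_. undefined) S p" and
    u: "\<forall>L' p'. cone (op C) {0,1} {} (\<lambda>_. 0) (\<lambda>_. 0) ?D (\<lambda>_. undefined) L' p' \<longrightarrow>
      (\<exists>!u. u \<in> hom S L' \<and> (\<forall>v \<in> {0,1}. u \<cdot> p v = p' v))"
    by (elim exE conjE)
  have "coproduct C a b S (p 0) (p 1)"
    unfolding coproduct_def
  proof (intro conjI allI impI)
    show "p 0 \<in> hom a S" "p 1 \<in> hom b S" using c by (auto simp: cone_def)
    fix x f g assume fg: "f \<in> hom a x" "g \<in> hom b x"
    have "cone (op C) {0,1} {} (\<lambda>_. 0) (\<lambda>_. 0) ?D (\<lambda>_. undefined) x (\<lambda>v. if v = 0 then f else g)"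
      using fg by (auto simp: cone_def Hom_iff)
    from u[rule_format, OF this] show "\<exists>!u. u \<in> hom S x \<and> u \<cdot> p 0 = f \<and> u \<cdot> p 1 = g" by simp
  qed
  then show ?thesis using that by blast
qed

lemma pushout_ex:
  assumes "has_finite_limits (op C)" "f \<in> hom c a" "g \<in> hom c b"
  obtains S p q where "pushout C f g S p q" "p \<in> hom a S" "q \<in> hom b S" "p \<cdot> f = q \<cdot> g"
proof -
  let ?D = "\<lambda>v::nat. if v = 0 then a else if v = 1 then b else c"
  let ?d = "\<lambda>e::nat. if e = 0 then f else g"
  let ?dg = "\<lambda>T. T {0,1,2::nat} {0,1::nat} id (\<lambda>_. 2::nat) ?D ?d"
  have "?dg (finite_diagram (op C))"
    using assms by (auto simp: finite_diagram_def Hom_iff)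
  from colimit_ex[OF assms(1) this] obtain S p where
    c: "?dg (cone (op C)) S p" and
    u: "\<forall>L' p'. ?dg (cone (op C)) L' p' \<longrightarrow>
      (\<exists>!u. u \<in> hom S L' \<and> (\<forall>v \<in> {0,1,2}. u \<cdot> p v = p' v))"
    by (elim exE conjE)
  have t: "p 0 \<in> hom a S" "p 1 \<in> hom b S" "p 0 \<cdot> f = p 2" "p 1 \<cdot> g = p 2"
    using c unfolding cone_def by simp_all
  have "pushout C f g S (p 0) (p 1)"
  proof (rule pushoutI[OF assms(2,3) t(1,2)])
    show "p 0 \<cdot> f = p 1 \<cdot> g" using t by simp
    fix x p' q' assume x: "p' \<in> hom a x" "q' \<in> hom b x" "p' \<cdot> f = q' \<cdot> g"
    have pf: "p' \<cdot> f \<in> hom c x" using x assms comp_in by blast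
    have "?dg (cone (op C)) x (\<lambda>v. if v = 0 then p' else if v = 1 then q' else p' \<cdot> f)"
      unfolding cone_def
    proof (intro conjI ballI)
      show "x \<in> Obj (op C)" using x by (simp add: Hom_iff)
      show "(if v = 0 then p' else if v = 1 then q' else p' \<cdot> f) \<in> Hom (op C) x (?D v)" for v
        using x pf by simp
      show "?d e \<cdot>\<^bsub>op C\<^esub> (if id e = 0 then p' else if id e = 1 then q' else p' \<cdot> f) =
          (if (2::nat) = 0 then p' else if (2::nat) = 1 then q' else p' \<cdot> f)" if "e \<in> {0,1}" for e
        using that x(3) by auto
    qed
    from u[rule_format, OF this] show "\<exists>u\<in>hom S x. u \<cdot> p 0 = p' \<and> u \<cdot> p 1 = q'" by auto
  next
    fix x w w' assume x: "w \<in> hom S x" "w' \<in> hom S x" "w \<cdot> p 0 = w' \<cdot> p 0" "w \<cdot> p 1 = w' \<cdot> p 1"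
    have e: "w \<cdot> p 2 = w' \<cdot> p 2"
    proof -
      have "w \<cdot> p 2 = w \<cdot> p 0 \<cdot> f" unfolding t(3)[symmetric] using x(1) t(1,2) assms(2,3) by (simp add: cs)
      also have "\<dots> = w' \<cdot> p 0 \<cdot> f" using x by simp
      also have "\<dots> = w' \<cdot> p 2" unfolding t(3)[symmetric] using x(2) t(1,2) assms(2,3) by (simp add: cs)
      finally show ?thesis .
    qed
    have "?dg (cone (op C)) x (\<lambda>v. w' \<cdot> p v)"
      unfolding cone_def
    proof (intro conjI ballI)
      show "x \<in> Obj (op C)" using x by (simp add: Hom_iff)
      have p2: "p 2 \<in> hom c S" using c by (auto simp: cone_def)
      show "w' \<cdot> p v \<in> Hom (op C) x (?D v)" if "v \<in> {0,1,2}" for v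
        using that x t p2 comp_in by auto
      show "?d e \<cdot>\<^bsub>op C\<^esub> (w' \<cdot> p (id e)) = w' \<cdot> p 2" if "e \<in> {0,1}" for e
        using that x(2) t(1,2) assms(2,3) t(3)[symmetric] t(4) by (auto simp: cs)
    qed
    from u[rule_format, OF this] show "w = w'" using x e by auto
  qed
  then show ?thesis using that t by auto
qed

end

section \<open>Lifting and factorization in a model category\<close>

lemma retract_ofI:
  assumes "f \<in> Arr C" "g \<in> Arr C"
    and "i \<in> Hom C (Dom C f) (Dom C g)" "i' \<in> Hom C (Cod C f) (Cod C g)"
    and "r \<in> Hom C (Dom C g) (Dom C f)" "r' \<in> Hom C (Cod C g) (Cod C f)"
    and "comp C r i = Id C (Dom C f)" "comp C r' i' = Id C (Cod C f)"
    and "comp C g i = comp C i' f" "comp C f r = comp C r' g"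
  shows "retract_of C f g"
  using assms unfolding retract_of_def by blast

lemma retract_of_op: "retract_of (op C) f g \<Longrightarrow> retract_of C f g"
proof -
  assume "retract_of (op C) f g"
  then obtain i i' r r' where "f \<in> Arr C" "g \<in> Arr C"
    "i \<in> Hom C (Cod C g) (Cod C f)" "i' \<in> Hom C (Dom C g) (Dom C f)"
    "r \<in> Hom C (Cod C f) (Cod C g)" "r' \<in> Hom C (Dom C f) (Dom C g)"
    "comp C i r = Id C (Cod C f)" "comp C i' r' = Id C (Dom C f)"
    "comp C i g = comp C f i'" "comp C r f = comp C g r'"
    unfolding retract_of_def op_simps Hom_op by blast
  then show ?thesis by (intro retract_ofI[of f C g r' r i' i]) auto
qed

locale model_category =
  fixes C :: "('o, 'm) mcat" (structure)
  assumes cmc: "closed_model_category C"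
begin

lemma is_category: "category C"
  using cmc by (simp add: closed_model_category_def)

end

sublocale model_category \<subseteq> small_category
  by unfold_locales (rule is_category)

context model_category begin

lemmas cmc_axioms = cmc[unfolded closed_model_category_def, THEN conjunct2]

lemma Weq_Arr: "Weq C \<subseteq> Arr C" and Cof_Arr: "Cof C \<subseteq> Arr C" and Fib_Arr: "Fib C \<subseteq> Arr C"
  and limits: "has_finite_limits C" and colimits: "has_finite_limits (op C)"
  using cmc_axioms by simp_all

lemma two_of_three:
  assumes "f \<in> hom a b" "g \<in> hom b c"
  shows "f \<in> Weq C \<Longrightarrow> g \<in> Weq C \<Longrightarrow> g \<cdot> f \<in> Weq C"
    and "f \<in> Weq C \<Longrightarrow> g \<cdot> f \<in> Weq C \<Longrightarrow> g \<in> Weq C"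
    and "g \<in> Weq C \<Longrightarrow> g \<cdot> f \<in> Weq C \<Longrightarrow> f \<in> Weq C"
  using cmc_axioms[THEN conjunct2, THEN conjunct2, THEN conjunct2, THEN conjunct2,
      THEN conjunct2, THEN conjunct1, rule_format, OF assms] by blast+

lemma retract_closed:
  assumes "retract_of C f g"
  shows "g \<in> Weq C \<Longrightarrow> f \<in> Weq C" "g \<in> Cof C \<Longrightarrow> f \<in> Cof C" "g \<in> Fib C \<Longrightarrow> f \<in> Fib C"
  using cmc_axioms[THEN conjunct2, THEN conjunct2, THEN conjunct2, THEN conjunct2,
      THEN conjunct2, THEN conjunct2, THEN conjunct1, rule_format, OF assms] by blast+

lemma lift:
  assumes "i \<in> Cof C" "p \<in> Fib C" "i \<in> Weq C \<or> p \<in> Weq C"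
    and "i \<in> hom a b" "p \<in> hom e d" "f \<in> hom a e" "g \<in> hom b d" "p \<cdot> f = g \<cdot> i"
  obtains l where "l \<in> hom b e" "l \<cdot> i = f" "p \<cdot> l = g"
proof -
  have "f \<in> Hom C (Dom C i) (Dom C p)" "g \<in> Hom C (Cod C i) (Cod C p)"
    using assms by (auto simp: Hom_iff)
  from cmc_axioms[THEN conjunct2, THEN conjunct2, THEN conjunct2, THEN conjunct2, THEN conjunct2,
      THEN conjunct2, THEN conjunct2, THEN conjunct1, rule_format, OF assms(1-3) this assms(8)]
  show ?thesis using that assms by (auto simp: Hom_iff)
qed

lemma factor_acof:
  assumes "f \<in> hom a b"
  obtains x i p where "i \<in> hom a x" "p \<in> hom x b" "i \<in> Cof C" "i \<in> Weq C" "p \<in> Fib C" "p \<cdot> i = f"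
proof -
  have f: "f \<in> Arr C" "Dom C f = a" "Cod C f = b" using assms by (auto simp: Hom_iff)
  from cmc_axioms[THEN conjunct2, THEN conjunct2, THEN conjunct2, THEN conjunct2, THEN conjunct2,
      THEN conjunct2, THEN conjunct2, THEN conjunct2, rule_format, OF f(1), THEN conjunct1]
  show ?thesis using that f by blast
qed

lemma factor_afib:
  assumes "f \<in> hom a b"
  obtains x i p where "i \<in> hom a x" "p \<in> hom x b" "i \<in> Cof C" "p \<in> Fib C" "p \<in> Weq C" "p \<cdot> i = f"
proof -
  have f: "f \<in> Arr C" "Dom C f = a" "Cod C f = b" using assms by (auto simp: Hom_iff)
  from cmc_axioms[THEN conjunct2, THEN conjunct2, THEN conjunct2, THEN conjunct2, THEN conjunct2,
      THEN conjunct2, THEN conjunct2, THEN conjunct2, rule_format, OF f(1), THEN conjunct2]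
  show ?thesis using that f by blast
qed

lemma dual: "model_category (op C)"
proof
  show "closed_model_category (op C)"
    unfolding closed_model_category_def op_op
  proof (intro conjI allI impI ballI, goal_cases)
    case 1 show ?case using is_category by (rule category_op)
  next
    case 2 show ?case using Weq_Arr by simp
  next
    case 3 show ?case using Fib_Arr by simp
  next
    case 4 show ?case using Cof_Arr by simp
  next
    case 5 show ?case using colimits .
  next
    case 6 show ?case using limits by simp
  next
    case (7 a b c f g) then show ?case using two_of_three(1)[of g c b f a] by simp
  next
    case (8 a b c f g) then show ?case using two_of_three(3)[of g c b f a] by simp
  next
    case (9 a b c f g) then show ?case using two_of_three(2)[of g c b f a] by simp
  next
    case (10 f g) then show ?case using retract_closed[OF retract_of_op] by simp
  next
    case (11 f g) then show ?case using retract_closed[OF retract_of_op] by simp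
  next
    case (12 f g) then show ?case using retract_closed[OF retract_of_op] by simp
  next
    case (13 i p f g)
    then show ?case
      using lift[of p i "Dom C p" "Cod C p" "Dom C i" "Cod C i" g f]
        Cof_Arr Fib_Arr by (simp add: Hom_def) (metis (lifting) subsetD)
  next
    case (14 f)
    then show ?case using factor_afib[of f "Dom C f" "Cod C f"] by (simp add: Hom_def) metis
  next
    case (15 f)
    then show ?case using factor_acof[of f "Dom C f" "Cod C f"] by (simp add: Hom_def) metis
  qed
qed

lemma comp_weq_iff:
  assumes "f \<in> hom a b" "g \<in> hom b c"
  shows "f \<in> Weq C \<Longrightarrow> g \<cdot> f \<in> Weq C \<longleftrightarrow> g \<in> Weq C"
    and "g \<in> Weq C \<Longrightarrow> g \<cdot> f \<in> Weq C \<longleftrightarrow> f \<in> Weq C"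
  using two_of_three[OF assms] by blast+

lemma Id_weq: "a \<in> Obj C \<Longrightarrow> Id C a \<in> Weq C"
proof -
  assume a: "a \<in> Obj C"
  obtain x i p where p: "p \<in> hom x a" "p \<in> Weq C"
    using factor_afib[OF Id_in[OF a]] by metis
  then show ?thesis using two_of_three(2)[OF p(1) Id_in[OF a]] by (simp add: cs)
qed

lemma Id_in_weq: "a \<in> Obj C \<Longrightarrow> Id C a \<in> hom a a" "a \<in> Obj C \<Longrightarrow> Id C a \<in> Weq C"
  using Id_in Id_weq by auto

lemma weq_section: "s \<in> hom a b \<Longrightarrow> r \<in> hom b a \<Longrightarrow> r \<cdot> s = Id C a \<Longrightarrow> r \<in> Weq C \<longleftrightarrow> s \<in> Weq C"
proof -
  assume s: "s \<in> hom a b" and r: "r \<in> hom b a" and e: "r \<cdot> s = Id C a"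
  have "r \<cdot> s \<in> Weq C" unfolding e using s by (intro Id_weq) (simp add: Hom_iff)
  then show ?thesis using two_of_three(2,3)[OF s r] by blast
qed

text \<open>The retract argument: a map with the left lifting property against acyclic fibrations is a
  retract of the first factor in its factorization.\<close>

lemma cof_by_lifting:
  assumes f: "f \<in> hom a b"
    and l: "\<And>p e d t s. p \<in> hom e d \<Longrightarrow> p \<in> Fib C \<Longrightarrow> p \<in> Weq C \<Longrightarrow> t \<in> hom a e \<Longrightarrow> s \<in> hom b d \<Longrightarrow>
      p \<cdot> t = s \<cdot> f \<Longrightarrow> \<exists>l \<in> hom b e. l \<cdot> f = t \<and> p \<cdot> l = s"
  shows "f \<in> Cof C"
proof -
  obtain x i p where i: "i \<in> hom a x" "p \<in> hom x b" "i \<in> Cof C" "p \<in> Fib C" "p \<in> Weq C" "p \<cdot> i = f"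
    using factor_afib[OF f] by metis
  have b: "b \<in> Obj C" using f by (simp add: Hom_iff)
  have "p \<cdot> i = Id C b \<cdot> f" using i f by (simp add: cs)
  then obtain l where l: "l \<in> hom b x" "l \<cdot> f = i" "p \<cdot> l = Id C b"
    using l[OF i(2,4,5,1) Id_in[OF b]] by blast
  have "retract_of C f i"
    by (rule retract_ofI[of _ _ _ "Id C a" l "Id C a" p]) (use f i l in \<open>simp_all add: cs\<close>)
  then show ?thesis using retract_closed i by blast
qed

lemma acof_by_lifting:
  assumes f: "f \<in> hom a b"
    and l: "\<And>p e d t s. p \<in> hom e d \<Longrightarrow> p \<in> Fib C \<Longrightarrow> t \<in> hom a e \<Longrightarrow> s \<in> hom b d \<Longrightarrow>
      p \<cdot> t = s \<cdot> f \<Longrightarrow> \<exists>l \<in> hom b e. l \<cdot> f = t \<and> p \<cdot> l = s"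
  shows "f \<in> Cof C" "f \<in> Weq C"
proof -
  obtain x i p where i: "i \<in> hom a x" "p \<in> hom x b" "i \<in> Cof C" "i \<in> Weq C" "p \<in> Fib C" "p \<cdot> i = f"
    using factor_acof[OF f] by metis
  have b: "b \<in> Obj C" using f by (simp add: Hom_iff)
  have "p \<cdot> i = Id C b \<cdot> f" using i f by (simp add: cs)
  then obtain l where l: "l \<in> hom b x" "l \<cdot> f = i" "p \<cdot> l = Id C b"
    using l[OF i(2,5,1) Id_in[OF b]] by blast
  have "retract_of C f i"
    by (rule retract_ofI[of _ _ _ "Id C a" l "Id C a" p]) (use f i l in \<open>simp_all add: cs\<close>)
  then show "f \<in> Cof C" "f \<in> Weq C" using retract_closed i by blast+
qed

text \<open>Closure properties of cofibrations and acyclic cofibrations follow from their lifting properties.\<close>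

lemma cof_comp:
  assumes f: "f \<in> hom a b" "f \<in> Cof C" and g: "g \<in> hom b c" "g \<in> Cof C"
  shows "g \<cdot> f \<in> Cof C"
proof (rule cof_by_lifting[OF comp_in[OF f(1) g(1)]])
  fix p e d t s
  assume p: "p \<in> hom e d" "p \<in> Fib C" "p \<in> Weq C" "t \<in> hom a e" "s \<in> hom c d" "p \<cdot> t = s \<cdot> (g \<cdot> f)"
  have "p \<cdot> t = (s \<cdot> g) \<cdot> f" using p f g by (simp add: cs)
  then obtain l where l: "l \<in> hom b e" "l \<cdot> f = t" "p \<cdot> l = s \<cdot> g"
    using lift[OF f(2) p(2) _ f(1) p(1) p(4) comp_in[OF g(1) p(5)]] p(3) by metis
  obtain k where k: "k \<in> hom c e" "k \<cdot> g = l" "p \<cdot> k = s"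
    using lift[OF g(2) p(2) _ g(1) p(1) l(1) p(5) l(3)] p(3) by metis
  have "k \<cdot> (g \<cdot> f) = t" using k f g l by (simp add: cs k(2)[THEN pre])
  then show "\<exists>l\<in>hom c e. l \<cdot> (g \<cdot> f) = t \<and> p \<cdot> l = s" using k by blast
qed

lemma pushout_lift:
  assumes po: "pushout C f g S p q" "f \<in> hom c a" "g \<in> hom c b"
    and k: "k \<in> hom e d" "t \<in> hom b e" "s \<in> hom S d" "k \<cdot> t = s \<cdot> q"
    and l: "l \<in> hom a e" "l \<cdot> f = t \<cdot> g" "k \<cdot> l = s \<cdot> p"
  shows "\<exists>l \<in> hom S e. l \<cdot> q = t \<and> k \<cdot> l = s"
proof -
  note D = pushoutD[OF po]
  obtain u where u: "u \<in> hom S e" "u \<cdot> p = l" "u \<cdot> q = t"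
    using pushout_univ[OF po l(1) k(2) l(2)] .
  have "k \<cdot> u = s"
  proof (rule pushout_eq[OF po(1) comp_in[OF u(1) k(1)] k(3)])
    show "k \<cdot> u \<cdot> p = s \<cdot> p" using u(1) k(1) D(2) by (simp add: cs u(2) l(3))
    show "k \<cdot> u \<cdot> q = s \<cdot> q" using u(1) k(1) D(3) by (simp add: cs u(3) k(4))
  qed
  then show ?thesis using u by blast
qed

lemma pushout_cof:
  assumes po: "pushout C f g S p q" "f \<in> hom c a" "g \<in> hom c b" and f: "f \<in> Cof C"
  shows "q \<in> Cof C"
proof (rule cof_by_lifting)
  note D = pushoutD[OF po]
  show "q \<in> hom b S" by (rule D)
  fix k e d t s
  assume k: "k \<in> hom e d" "k \<in> Fib C" "k \<in> Weq C" "t \<in> hom b e" "s \<in> hom S d" "k \<cdot> t = s \<cdot> q"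
  have "k \<cdot> (t \<cdot> g) = (s \<cdot> p) \<cdot> f"
    using k(1,4,5) D(2,3) po(2,3) by (simp add: cs D(4) k(6)[THEN pre])
  then obtain l where "l \<in> hom a e" "l \<cdot> f = t \<cdot> g" "k \<cdot> l = s \<cdot> p"
    using lift[OF f k(2) _ po(2) k(1) comp_in[OF po(3) k(4)] comp_in[OF D(2) k(5)]] k(3) by metis
  then show "\<exists>l\<in>hom S e. l \<cdot> q = t \<and> k \<cdot> l = s"
    using pushout_lift[OF po k(1,4,5,6)] by blast
qed

lemma pushout_acof:
  assumes po: "pushout C f g S p q" "f \<in> hom c a" "g \<in> hom c b" and f: "f \<in> Cof C" "f \<in> Weq C"
  shows "q \<in> Weq C"
proof (rule acof_by_lifting)
  note D = pushoutD[OF po]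
  show "q \<in> hom b S" by (rule D)
  fix k e d t s
  assume k: "k \<in> hom e d" "k \<in> Fib C" "t \<in> hom b e" "s \<in> hom S d" "k \<cdot> t = s \<cdot> q"
  have "k \<cdot> (t \<cdot> g) = (s \<cdot> p) \<cdot> f"
    using k(1,3,4) D(2,3) po(2,3) by (simp add: cs D(4) k(5)[THEN pre])
  then obtain l where "l \<in> hom a e" "l \<cdot> f = t \<cdot> g" "k \<cdot> l = s \<cdot> p"
    using lift[OF f(1) k(2) _ po(2) k(1) comp_in[OF po(3) k(3)] comp_in[OF D(2) k(4)]] f(2) by metis
  then show "\<exists>l\<in>hom S e. l \<cdot> q = t \<and> k \<cdot> l = s"
    using pushout_lift[OF po k(1,3,4,5)] by blast
qed

lemma pushout_exists:
  assumes "f \<in> hom c a" "g \<in> hom c b"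
  obtains S p q where "pushout C f g S p q" "p \<in> hom a S" "q \<in> hom b S" "p \<cdot> f = q \<cdot> g"
  using pushout_ex[OF colimits assms] by metis

lemma coproduct_exists:
  assumes "a \<in> Obj C" "b \<in> Obj C"
  obtains S i j where "coproduct C a b S i j"
  using coproduct_ex[OF colimits assms] by metis

subsection \<open>Cofibrant and fibrant objects\<close>

lemma cofibrant_obj: "cofibrant C a \<Longrightarrow> a \<in> Obj C"
  by (auto simp: cofibrant_def Hom_iff)

lemma cofibrant_lift:
  assumes "cofibrant C a" "p \<in> Fib C" "p \<in> Weq C" "p \<in> hom e d" "g \<in> hom a d"
  obtains l where "l \<in> hom a e" "p \<cdot> l = g"
proof -
  obtain z m where z: "initial C z" "m \<in> hom z a" "m \<in> Cof C"
    using assms(1) by (auto simp: cofibrant_def)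
  have u: "\<exists>!u. u \<in> hom z x" if "x \<in> Obj C" for x
    by (rule bspec[OF conjunct2[OF z(1)[unfolded initial_def]] that])
  have o: "e \<in> Obj C" "d \<in> Obj C" using assms(4) by (simp_all add: Hom_iff)
  obtain t where t: "t \<in> hom z e" using ex1_implies_ex[OF u[OF o(1)]] by (elim exE)
  have "p \<cdot> t = g \<cdot> m"
    using u[OF o(2)] comp_in[OF t assms(4)] comp_in[OF z(2) assms(5)] by (elim ex1E) metis
  then show ?thesis
    using lift[OF z(3) assms(2) _ z(2) assms(4) t assms(5)] assms(3) that by metis
qed

lemma cofibrant_cof: "cofibrant C a \<Longrightarrow> f \<in> hom a b \<Longrightarrow> f \<in> Cof C \<Longrightarrow> cofibrant C b"
  unfolding cofibrant_def using cof_comp comp_in by blast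

lemma cofibrant_replacement:
  assumes "a \<in> Obj C"
  obtains q p where "cofibrant C q" "p \<in> hom q a" "p \<in> Fib C" "p \<in> Weq C"
proof -
  obtain z where z: "initial C z" using initial_ex[OF colimits] .
  have "\<exists>!u. u \<in> hom z a" by (rule bspec[OF conjunct2[OF z[unfolded initial_def]] assms])
  then have "\<exists>u. u \<in> hom z a" by (rule ex1_implies_ex)
  then obtain u where u: "u \<in> hom z a" by (elim exE)
  obtain x i p where i: "i \<in> hom z x" "p \<in> hom x a" "i \<in> Cof C" "p \<in> Fib C" "p \<in> Weq C" "p \<cdot> i = u"
    using factor_afib[OF u] .
  have "cofibrant C x" unfolding cofibrant_def using z i(1,3) by (intro exI[of _ z] conjI bexI[of _ i])
  then show ?thesis by (rule that[OF _ i(2,4,5)])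
qed

end

abbreviation fibrant :: "('o, 'm) mcat \<Rightarrow> 'o \<Rightarrow> bool" where
  "fibrant C \<equiv> cofibrant (op C)"

context model_category begin

text \<open>Statements about the opposite category, rewritten into \<open>C\<close>: pushouts, cofibrations and cylinders become
  pullbacks, fibrations and path objects.\<close>

lemmas dualize = op_simps Hom_op op_op
lemmas fib_comp = model_category.cof_comp[OF dual, unfolded dualize]
lemmas fibrant_obj = model_category.cofibrant_obj[OF dual, unfolded dualize]
lemmas fibrant_fib = model_category.cofibrant_cof[OF dual, unfolded dualize]
lemmas fibrant_extend = model_category.cofibrant_lift[OF dual, unfolded dualize]
lemmas fibrant_replacement = model_category.cofibrant_replacement[OF dual, unfolded dualize]
lemmas pullback_exists = model_category.pushout_exists[OF dual, unfolded dualize]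
lemmas pullback_fib = model_category.pushout_cof[OF dual, unfolded dualize]
lemmas pullback_afib = model_category.pushout_acof[OF dual, unfolded dualize]
lemma bifibrant_op [simp]: "bifibrant (op C) = bifibrant C"
  by (auto simp: bifibrant_def)

lemma small_dual: "small_category (op C)"
  using category_op[OF is_category] by unfold_locales

lemmas pullbackD = small_category.pushoutD[OF small_dual, unfolded dualize]
lemmas pullback_univ = small_category.pushout_univ[OF small_dual, unfolded dualize]
lemmas pullback_eq = small_category.pushout_eq[OF small_dual, unfolded dualize]

end

section \<open>Cylinders and homotopies\<close>

context model_category begin

lemma cylinderD:
  assumes "is_cylinder C a I"
  shows "end0 I \<in> hom a (cyl I)" "end1 I \<in> hom a (cyl I)" "proj I \<in> hom (cyl I) a" "proj I \<in> Weq C"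
    "proj I \<cdot> end0 I = Id C a" "proj I \<cdot> end1 I = Id C a"
  using assms by (auto simp: is_cylinder_def)

lemma cylinder_lift:
  assumes I: "is_cylinder C a I" and p: "p \<in> hom e d" "p \<in> Fib C" "p \<in> Weq C"
    and f: "f0 \<in> hom a e" "f1 \<in> hom a e" "g \<in> hom (cyl I) d" "p \<cdot> f0 = g \<cdot> end0 I" "p \<cdot> f1 = g \<cdot> end1 I"
  obtains l where "l \<in> hom (cyl I) e" "l \<cdot> end0 I = f0" "l \<cdot> end1 I = f1" "p \<cdot> l = g"
proof -
  obtain S j0 j1 m where S: "coproduct C a a S j0 j1" and m: "m \<in> hom S (cyl I)" "m \<in> Cof C"
    "m \<cdot> j0 = end0 I" "m \<cdot> j1 = end1 I"
    using I by (auto simp: is_cylinder_def)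
  note j = coproductD[OF S]
  obtain u where u: "u \<in> hom S e" "u \<cdot> j0 = f0" "u \<cdot> j1 = f1"
    using coproduct_univ[OF S f(1,2)] .
  have "p \<cdot> u = g \<cdot> m"
    by (rule coproduct_eq[OF S, of _ d]) (use p(1) u f j m in \<open>simp_all add: cs\<close>)
  then obtain l where l: "l \<in> hom (cyl I) e" "l \<cdot> m = u" "p \<cdot> l = g"
    using lift[OF m(2) p(2) _ m(1) p(1) u(1) f(3)] p(3) by metis
  have "l \<cdot> end0 I = f0" "l \<cdot> end1 I = f1"
    unfolding m(3,4)[symmetric] using l m(1) j u by (simp_all add: cs l(2)[THEN pre])
  with l that show ?thesis by blast
qed

text \<open>The hypothesis is the lifting property of the map out of the coproduct, with the coproduct eliminated.\<close>

lemma cylinder_by_lifting: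
  assumes I: "end0 I \<in> hom a (cyl I)" "end1 I \<in> hom a (cyl I)" "proj I \<in> hom (cyl I) a" "proj I \<in> Weq C"
    "proj I \<cdot> end0 I = Id C a" "proj I \<cdot> end1 I = Id C a"
    and l: "\<And>p e d f0 f1 g. p \<in> hom e d \<Longrightarrow> p \<in> Fib C \<Longrightarrow> p \<in> Weq C \<Longrightarrow> f0 \<in> hom a e \<Longrightarrow> f1 \<in> hom a e \<Longrightarrow>
      g \<in> hom (cyl I) d \<Longrightarrow> p \<cdot> f0 = g \<cdot> end0 I \<Longrightarrow> p \<cdot> f1 = g \<cdot> end1 I \<Longrightarrow>
      \<exists>l \<in> hom (cyl I) e. l \<cdot> end0 I = f0 \<and> l \<cdot> end1 I = f1 \<and> p \<cdot> l = g"
  shows "is_cylinder C a I"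
proof -
  have a: "a \<in> Obj C" using I by (simp add: Hom_iff)
  obtain S j0 j1 where S: "coproduct C a a S j0 j1" using coproduct_exists[OF a a] .
  note j = coproductD[OF S]
  obtain m where m: "m \<in> hom S (cyl I)" "m \<cdot> j0 = end0 I" "m \<cdot> j1 = end1 I"
    using coproduct_univ[OF S I(1,2)] .
  have "m \<in> Cof C"
  proof (rule cof_by_lifting[OF m(1)])
    fix p e d t s
    assume p: "p \<in> hom e d" "p \<in> Fib C" "p \<in> Weq C" "t \<in> hom S e" "s \<in> hom (cyl I) d" "p \<cdot> t = s \<cdot> m"
    have t: "t \<cdot> j0 \<in> hom a e" "t \<cdot> j1 \<in> hom a e" using p j comp_in by blast+
    have "p \<cdot> (t \<cdot> j0) = s \<cdot> end0 I" "p \<cdot> (t \<cdot> j1) = s \<cdot> end1 I"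
      using p(1,4,5) j m by (simp_all add: cs p(6)[THEN pre])
    then obtain l where l: "l \<in> hom (cyl I) e" "l \<cdot> end0 I = t \<cdot> j0" "l \<cdot> end1 I = t \<cdot> j1" "p \<cdot> l = s"
      using l[OF p(1-3) t p(5)] by blast
    have "l \<cdot> m = t"
      by (rule coproduct_eq[OF S, of _ e]) (use l(1-3) m p(4) j in \<open>simp_all add: cs\<close>)
    then show "\<exists>l\<in>hom (cyl I) e. l \<cdot> m = t \<and> p \<cdot> l = s" using l by blast
  qed
  then show ?thesis unfolding is_cylinder_def using I S m by blast
qed

lemma cylinder_exists:
  assumes a: "a \<in> Obj C"
  obtains I :: "('o, 'm) htpy" where "is_cylinder C a I" "proj I \<in> Fib C"
proof -
  obtain S j0 j1 where S: "coproduct C a a S j0 j1" using coproduct_exists[OF a a] .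
  note j = coproductD[OF S]
  obtain u where u: "u \<in> hom S a" "u \<cdot> j0 = Id C a" "u \<cdot> j1 = Id C a"
    using coproduct_univ[OF S Id_in Id_in] a by metis
  obtain x m p where m: "m \<in> hom S x" "p \<in> hom x a" "m \<in> Cof C" "p \<in> Fib C" "p \<in> Weq C" "p \<cdot> m = u"
    using factor_afib[OF u(1)] .
  let ?I = "\<lparr>cyl = x, end0 = m \<cdot> j0, end1 = m \<cdot> j1, proj = p, hmap = p\<rparr>"
  have "is_cylinder C a ?I"
    unfolding is_cylinder_def using S j u m by (intro conjI exI[of _ S] exI[of _ j0] exI[of _ j1] bexI[of _ m]) (simp_all add: cs m(6)[THEN pre])
  then show ?thesis using that m by force
qed

lemma cylinder_more [simp]:
  "is_cylinder C a (I\<lparr>hmap := h\<rparr>) = is_cylinder C a I"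
  by (simp add: is_cylinder_def)

text \<open>For a cofibrant object a lifting problem on one end extends to both ends, since the other end can be
  lifted freely.\<close>

lemma cylinder_ends:
  assumes I: "is_cylinder C a I"
  shows "end0 I \<in> Weq C" "end1 I \<in> Weq C"
    "cofibrant C a \<Longrightarrow> end0 I \<in> Cof C" "cofibrant C a \<Longrightarrow> end1 I \<in> Cof C"
proof -
  note D = cylinderD[OF I]
  show "end0 I \<in> Weq C" "end1 I \<in> Weq C" using weq_section D by blast+
  assume a: "cofibrant C a"
  have "\<exists>l\<in>hom (cyl I) e. l \<cdot> end0 I = t \<and> p \<cdot> l = s"
    if p: "p \<in> hom e d" "p \<in> Fib C" "p \<in> Weq C" "t \<in> hom a e" "s \<in> hom (cyl I) d" "p \<cdot> t = s \<cdot> end0 I"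
    for p e d t s
  proof -
    obtain t' where "t' \<in> hom a e" "p \<cdot> t' = s \<cdot> end1 I"
      using cofibrant_lift[OF a p(2,3,1) comp_in[OF D(2) p(5)]] .
    then show ?thesis using cylinder_lift[OF I p(1-3) p(4) _ p(5) p(6)] by metis
  qed
  then show "end0 I \<in> Cof C" by (rule cof_by_lifting[OF D(1)])
  have "\<exists>l\<in>hom (cyl I) e. l \<cdot> end1 I = t \<and> p \<cdot> l = s"
    if p: "p \<in> hom e d" "p \<in> Fib C" "p \<in> Weq C" "t \<in> hom a e" "s \<in> hom (cyl I) d" "p \<cdot> t = s \<cdot> end1 I"
    for p e d t s
  proof -
    obtain t' where "t' \<in> hom a e" "p \<cdot> t' = s \<cdot> end0 I"
      using cofibrant_lift[OF a p(2,3,1) comp_in[OF D(1) p(5)]] .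
    then show ?thesis using cylinder_lift[OF I p(1-3) _ p(4) p(5) _ p(6)] by metis
  qed
  then show "end1 I \<in> Cof C" by (rule cof_by_lifting[OF D(2)])
qed

lemmas pathD = model_category.cylinderD[OF dual, unfolded dualize]
lemmas path_lift = model_category.cylinder_lift[OF dual, unfolded dualize]
lemmas path_exists = model_category.cylinder_exists[OF dual, unfolded dualize]
lemmas path_ends = model_category.cylinder_ends[OF dual, unfolded dualize]
lemmas path_more [simp] = model_category.cylinder_more[OF dual]

lemma left_homotopyD:
  assumes "left_homotopy C H f g" "f \<in> hom a x"
  shows "g \<in> hom a x" "is_cylinder C a H" "hmap H \<in> hom (cyl H) x"
    "hmap H \<cdot> end0 H = f" "hmap H \<cdot> end1 H = g"
  using assms by (simp_all add: left_homotopy_def Hom_iff)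

lemma left_homotopyI:
  assumes "is_cylinder C a H" "hmap H \<in> hom (cyl H) x" "hmap H \<cdot> end0 H = f" "hmap H \<cdot> end1 H = g"
  shows "left_homotopy C H f g"
proof -
  note D = cylinderD[OF assms(1)]
  have "f \<in> hom a x" "g \<in> hom a x"
    using comp_in[OF D(1) assms(2)] comp_in[OF D(2) assms(2)] unfolding assms(3,4) .
  then show ?thesis using assms by (simp_all add: left_homotopy_def Hom_iff)
qed

text \<open>The homotopy together with the constant homotopy at its end is lifted, against the fibration from the
  path object to the pairs of its endpoints, from the end where both agree with the constant path.\<close>

lemma corresponds_exists:
  assumes H: "left_homotopy C H f g" "f \<in> hom a x" and a: "cofibrant C a" and J: "is_cylinder (op C) x J"
  obtains k where "corresponds C f g H (J\<lparr>hmap := k\<rparr>)"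
proof -
  note D = left_homotopyD[OF H] note I = cylinderD[OF D(2)] and P = pathD[OF J]
  obtain T where T: "T \<in> hom (cyl H) (cyl J)" "end0 J \<cdot> T = hmap H" "end1 J \<cdot> T = g \<cdot> proj H"
    "T \<cdot> end1 H = proj J \<cdot> g"
  proof (rule path_lift[OF J I(2) cylinder_ends(4)[OF D(2) a] cylinder_ends(2)[OF D(2)]])
    show "hmap H \<in> hom (cyl H) x" "g \<cdot> proj H \<in> hom (cyl H) x" "proj J \<cdot> g \<in> hom a (cyl J)"
      using D I P comp_in by blast+
    show "hmap H \<cdot> end1 H = end0 J \<cdot> (proj J \<cdot> g)" "g \<cdot> proj H \<cdot> end1 H = end1 J \<cdot> (proj J \<cdot> g)"
      using D I P by (simp_all add: cs P(5,6)[THEN pre])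
  qed
  have "T \<cdot> end0 H \<in> hom a (cyl J)" using comp_in I T by blast
  moreover have "end0 J \<cdot> (T \<cdot> end0 H) = f"  "end1 J \<cdot> (T \<cdot> end0 H) = g"
    using D T(1) I P by (simp_all add: cs T(2,3)[THEN pre])
  moreover have "f \<in> hom a x" by fact
  ultimately have "right_homotopy C (J\<lparr>hmap := T \<cdot> end0 H\<rparr>) f g"
    using J D unfolding left_homotopy_def by (simp add: Hom_iff)
  then have "corresponds C f g H (J\<lparr>hmap := T \<cdot> end0 H\<rparr>)"
    unfolding corresponds_def using H T by (intro conjI bexI[of _ T]) simp_all
  then show ?thesis using that by blast
qed

lemma homotopic_hom: "homotopic C f g \<Longrightarrow> f \<in> hom a x \<Longrightarrow> g \<in> hom a x"
  unfolding homotopic_def using left_homotopyD by blast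

lemma homotopic_refl: "f \<in> hom a x \<Longrightarrow> homotopic C f f"
proof -
  assume f: "f \<in> hom a x"
  then have "a \<in> Obj C" by (simp add: Hom_iff)
  then obtain I :: "('o,'m) htpy" where I: "is_cylinder C a I" using cylinder_exists by metis
  note D = cylinderD[OF I]
  have "left_homotopy C (I\<lparr>hmap := f \<cdot> proj I\<rparr>) f f"
    by (rule left_homotopyI[of a _ x]) (use I D f comp_in in \<open>simp_all add: cs\<close>)
  then show ?thesis unfolding homotopic_def by blast
qed

lemma homotopic_sym: "homotopic C f g \<Longrightarrow> homotopic C g f"
proof -
  assume "homotopic C f g"
  then obtain H where H: "left_homotopy C H f g" by (auto simp: homotopic_def)
  have f: "f \<in> hom (Dom C f) (Cod C f)" using H arr_hom by (simp add: left_homotopy_def)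
  note D = left_homotopyD[OF H f]
  have "is_cylinder C (Dom C f) (H\<lparr>end0 := end1 H, end1 := end0 H\<rparr>)"
  proof -
    obtain S j0 j1 m where S: "coproduct C (Dom C f) (Dom C f) S j0 j1" and m: "m \<in> hom S (cyl H)" "m \<in> Cof C"
      "m \<cdot> j0 = end0 H" "m \<cdot> j1 = end1 H"
      using D(2) by (auto simp: is_cylinder_def)
    show ?thesis
      unfolding is_cylinder_def using cylinderD[OF D(2)] coproduct_sym[OF S] m
      by (intro conjI exI[of _ S] exI[of _ j1] exI[of _ j0] bexI[of _ m]) simp_all
  qed
  then have "left_homotopy C (H\<lparr>end0 := end1 H, end1 := end0 H\<rparr>) g f"
    using D by (intro left_homotopyI[of "Dom C f" _ "Cod C f"]) simp_all
  then show ?thesis unfolding homotopic_def by blast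
qed

lemma right_of_left:
  assumes "homotopic C f g" "f \<in> hom a x" "cofibrant C a" "is_cylinder (op C) x J"
  obtains k where "right_homotopy C (J\<lparr>hmap := k\<rparr>) f g"
  using assms corresponds_exists unfolding homotopic_def corresponds_def by metis

lemma right_homotopic:
  assumes "homotopic C f g" "f \<in> hom a x" "cofibrant C a"
  shows "homotopic (op C) f g"
proof -
  have "x \<in> Obj C" using assms by (simp add: Hom_iff)
  then obtain J :: "('o,'m) htpy" where "is_cylinder (op C) x J" using path_exists by metis
  then show ?thesis using right_of_left[OF assms] unfolding homotopic_def by metis
qed


lemmas left_of_right = model_category.right_of_left[OF dual, unfolded dualize]
lemmas left_homotopic = model_category.right_homotopic[OF dual, unfolded dualize]
lemmas right_homotopyD = model_category.left_homotopyD[OF dual, unfolded dualize]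
lemmas right_homotopyI = model_category.left_homotopyI[OF dual, unfolded dualize]

text \<open>Homotopies are composed without gluing cylinders: the given left homotopy and a constant one are lifted
  to a path object, starting with the other homotopy at one end of the cylinder; the other end is the
  composite.\<close>

lemma homotopic_trans:
  assumes "homotopic C f g" "homotopic C g h" "f \<in> hom a x" "cofibrant C a" "fibrant C x"
  shows "homotopic C f h"
proof -
  obtain H where H: "left_homotopy C H g f" using homotopic_sym[OF assms(1)] by (auto simp: homotopic_def)
  have g: "g \<in> hom a x" using assms homotopic_hom by blast
  note D = left_homotopyD[OF H g] note I = cylinderD[OF D(2)]
  obtain J :: "('o,'m) htpy" where J: "is_cylinder (op C) x J"
    using path_exists fibrant_obj[OF assms(5)] by metis
  obtain k where K: "right_homotopy C (J\<lparr>hmap := k\<rparr>) g h" using right_of_left[OF assms(2) g assms(4) J] .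
  note E = right_homotopyD[OF K g, simplified]
  obtain T where T: "T \<in> hom (cyl H) (cyl J)" "end0 J \<cdot> T = hmap H" "end1 J \<cdot> T = h \<cdot> proj H" "T \<cdot> end0 H = k"
  proof (rule path_lift[OF J I(1) cylinder_ends(3)[OF D(2) assms(4)] cylinder_ends(1)[OF D(2)]])
    show "hmap H \<in> hom (cyl H) x" "h \<cdot> proj H \<in> hom (cyl H) x" "k \<in> hom a (cyl J)"
      using D E I comp_in by blast+
    show "hmap H \<cdot> end0 H = end0 J \<cdot> k" "h \<cdot> proj H \<cdot> end0 H = end1 J \<cdot> k" using D E I by (simp_all add: cs)
  qed
  have "right_homotopy C (J\<lparr>hmap := T \<cdot> end1 H\<rparr>) f h"
  proof (rule right_homotopyI[of x])
    show "hmap (J\<lparr>hmap := T \<cdot> end1 H\<rparr>) \<in> hom a (cyl (J\<lparr>hmap := T \<cdot> end1 H\<rparr>))"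
      using comp_in[OF I(2) T(1)] by simp
    show "end0 (J\<lparr>hmap := T \<cdot> end1 H\<rparr>) \<cdot> hmap (J\<lparr>hmap := T \<cdot> end1 H\<rparr>) = f"
     "end1 (J\<lparr>hmap := T \<cdot> end1 H\<rparr>) \<cdot> hmap (J\<lparr>hmap := T \<cdot> end1 H\<rparr>) = h"
      using T(1) I D E pathD[OF J] by (simp_all add: cs T(2,3)[THEN pre])
  qed (use J in simp)
  then have "homotopic (op C) f h" by (auto simp: homotopic_def)
  then show ?thesis using left_homotopic assms by blast
qed

lemma homotopic_post:
  assumes "homotopic C f g" "f \<in> hom a x" "w \<in> hom x y"
  shows "homotopic C (w \<cdot> f) (w \<cdot> g)"
proof -
  obtain H where H: "left_homotopy C H f g" using assms by (auto simp: homotopic_def)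
  note D = left_homotopyD[OF H assms(2)] note I = cylinderD[OF D(2)]
  have "left_homotopy C (H\<lparr>hmap := w \<cdot> hmap H\<rparr>) (w \<cdot> f) (w \<cdot> g)"
    by (rule left_homotopyI[of a _ y]) (use D I assms comp_in in \<open>simp_all add: cs\<close>)
  then show ?thesis by (auto simp: homotopic_def)
qed

text \<open>Right homotopies can be precomposed on the nose.\<close>

lemma homotopic_pre:
  assumes "homotopic C f g" "f \<in> hom a x" "w \<in> hom b a" "cofibrant C a" "cofibrant C b" "fibrant C x"
  shows "homotopic C (f \<cdot> w) (g \<cdot> w)"
proof -
  have "homotopic (op C) f g" using assms right_homotopic by blast
  from model_category.homotopic_post[OF dual this, of x a w b] assms
  have "homotopic (op C) (f \<cdot> w) (g \<cdot> w)" by simp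
  then show ?thesis using left_homotopic assms comp_in by blast
qed

lemma homotopic_weq:
  assumes "homotopic C f g" "f \<in> hom a x" "f \<in> Weq C"
  shows "g \<in> Weq C"
proof -
  obtain H where H: "left_homotopy C H f g" using assms by (auto simp: homotopic_def)
  note D = left_homotopyD[OF H assms(2)] note I = cylinderD[OF D(2)]
  have "hmap H \<in> Weq C" using two_of_three(2)[OF I(1) D(3)] cylinder_ends[OF D(2)] D assms by simp
  then show ?thesis using two_of_three(1)[OF I(2) D(3)] cylinder_ends[OF D(2)] D by simp
qed

lemma homotopic_by_afib:
  assumes "p \<in> hom e d" "p \<in> Fib C" "p \<in> Weq C" "f \<in> hom a e" "g \<in> hom a e" "p \<cdot> f = p \<cdot> g"
  shows "homotopic C f g"
proof -
  have "a \<in> Obj C" using assms by (simp add: Hom_iff)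
  then obtain I :: "('o,'m) htpy" where I: "is_cylinder C a I" using cylinder_exists by metis
  note D = cylinderD[OF I]
  have pf: "p \<cdot> f \<cdot> proj I \<in> hom (cyl I) d" using assms D comp_in by blast
  have "p \<cdot> f = (p \<cdot> f \<cdot> proj I) \<cdot> end0 I" "p \<cdot> g = (p \<cdot> f \<cdot> proj I) \<cdot> end1 I"
    using assms(1,4) D comp_in[OF assms(4,1)] assms(6)[symmetric] by (simp_all add: cs)
  then obtain l where "l \<in> hom (cyl I) e" "l \<cdot> end0 I = f" "l \<cdot> end1 I = g"
    using cylinder_lift[OF I assms(1-5) pf] by metis
  then have "left_homotopy C (I\<lparr>hmap := l\<rparr>) f g" using I by (intro left_homotopyI[of a _ e]) simp_all
  then show ?thesis by (auto simp: homotopic_def)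
qed

text \<open>The homotopy is lifted starting with \<open>f\<close>; the other end of the lift is \<open>f'\<close>.\<close>

lemma homotopy_lifting:
  assumes p: "p \<in> hom e d" "p \<in> Fib C" and f: "f \<in> hom a e" "cofibrant C a"
    and h: "homotopic C (p \<cdot> f) g"
  obtains f' where "f' \<in> hom a e" "homotopic C f f'" "p \<cdot> f' = g"
proof -
  obtain H where H: "left_homotopy C H (p \<cdot> f) g" using h by (auto simp: homotopic_def)
  note D = left_homotopyD[OF H comp_in[OF f(1) p(1)]] note I = cylinderD[OF D(2)]
  obtain l where l: "l \<in> hom (cyl H) e" "l \<cdot> end0 H = f" "p \<cdot> l = hmap H"
    using lift[OF cylinder_ends(3)[OF D(2) f(2)] p(2) _ I(1) p(1) f(1) D(3)]
      cylinder_ends(1)[OF D(2)] D(4) by metis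
  have "left_homotopy C (H\<lparr>hmap := l\<rparr>) f (l \<cdot> end1 H)"
    using D l by (intro left_homotopyI[of a _ e]) simp_all
  then have 1: "homotopic C f (l \<cdot> end1 H)" by (auto simp: homotopic_def)
  have 2: "p \<cdot> (l \<cdot> end1 H) = g" using l p I D by (simp add: cs l(3)[THEN pre])
  show ?thesis by (rule that[OF _ 1 2]) (use l I comp_in in blast)
qed

text \<open>A weak equivalence between cofibrant objects is an acyclic cofibration, along which maps to fibrant
  objects extend, followed by an acyclic fibration with a section.\<close>

lemma weq_extend:
  assumes d: "d \<in> hom a b" "d \<in> Weq C" and c: "cofibrant C a" "cofibrant C b"
    and f: "f \<in> hom a x" "fibrant C x"
  obtains f' where "f' \<in> hom b x" "homotopic C (f' \<cdot> d) f"
proof -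
  obtain e j q where e: "j \<in> hom a e" "q \<in> hom e b" "j \<in> Cof C" "j \<in> Weq C" "q \<in> Fib C" "q \<cdot> j = d"
    using factor_acof[OF d(1)] .
  have q: "q \<in> Weq C" using two_of_three(2)[OF e(1,2)] e d by simp
  obtain s where s: "s \<in> hom b e" "q \<cdot> s = Id C b"
    using cofibrant_lift[OF c(2) e(5) q e(2) Id_in] cofibrant_obj[OF c(2)] by metis
  obtain g where g: "g \<in> hom e x" "g \<cdot> j = f" using fibrant_extend[OF f(2) e(3,4,1) f(1)] .
  have ec: "cofibrant C e" using cofibrant_cof[OF c(1) e(1,3)] .
  have "homotopic C (s \<cdot> d) j"
    by (rule homotopic_by_afib[OF e(2,5) q comp_in[OF d(1) s(1)] e(1)])
       (use e s d in \<open>simp add: cs s(2)[THEN pre]\<close>)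
  from homotopic_post[OF this comp_in[OF d(1) s(1)] g(1)]
  have "homotopic C ((g \<cdot> s) \<cdot> d) f" using g s d by (simp add: cs)
  then show ?thesis using that comp_in[OF s(1) g(1)] by blast
qed

lemma weq_cancel:
  assumes d: "d \<in> hom a b" "d \<in> Weq C" and c: "cofibrant C a" "cofibrant C b"
    and f: "f \<in> hom b x" "g \<in> hom b x" "fibrant C x" and h: "homotopic C (f \<cdot> d) (g \<cdot> d)"
  shows "homotopic C f g"
proof -
  obtain e j q where e: "j \<in> hom a e" "q \<in> hom e b" "j \<in> Cof C" "j \<in> Weq C" "q \<in> Fib C" "q \<cdot> j = d"
    using factor_acof[OF d(1)] .
  have q: "q \<in> Weq C" using two_of_three(2)[OF e(1,2)] e d by simp
  obtain s where s: "s \<in> hom b e" "q \<cdot> s = Id C b"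
    using cofibrant_lift[OF c(2) e(5) q e(2) Id_in] cofibrant_obj[OF c(2)] by metis
  have ec: "cofibrant C e" using cofibrant_cof[OF c(1) e(1,3)] .
  obtain J :: "('o,'m) htpy" where J: "is_cylinder (op C) x J"
    using path_exists fibrant_obj[OF f(3)] by metis
  obtain k where K: "right_homotopy C (J\<lparr>hmap := k\<rparr>) (f \<cdot> d) (g \<cdot> d)"
    using right_of_left[OF h comp_in[OF d(1) f(1)] c(1) J] .
  note E = right_homotopyD[OF K comp_in[OF d(1) f(1)], simplified]
  have fq: "f \<cdot> q \<in> hom e x" "g \<cdot> q \<in> hom e x" using f e comp_in by blast+
  obtain l where l: "l \<in> hom e (cyl J)" "end0 J \<cdot> l = f \<cdot> q" "end1 J \<cdot> l = g \<cdot> q"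
    using path_lift[OF J e(1,3,4) fq, of k] E e f by (simp add: cs) metis
  have "right_homotopy C (J\<lparr>hmap := l\<rparr>) (f \<cdot> q) (g \<cdot> q)"
    using J l by (intro right_homotopyI[of x _ e]) simp_all
  then have "homotopic C (f \<cdot> q) (g \<cdot> q)"
    using left_homotopic fq ec f(3) unfolding homotopic_def by blast
  from homotopic_pre[OF this fq(1) s(1) ec c(2) f(3)] show ?thesis
    using f e s by (simp add: cs)
qed

lemma homotopy_inverse:
  assumes d: "d \<in> hom a b" "d \<in> Weq C" and c: "bifibrant C a" "bifibrant C b"
  obtains k where "k \<in> hom b a" "homotopic C (k \<cdot> d) (Id C a)" "homotopic C (d \<cdot> k) (Id C b)" "k \<in> Weq C"
proof -
  have c': "cofibrant C a" "cofibrant C b" "fibrant C a" "fibrant C b" using c by (simp_all add: bifibrant_def)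
  have o: "a \<in> Obj C" "b \<in> Obj C" using c'(1,2) cofibrant_obj by blast+
  obtain k where k: "k \<in> hom b a" "homotopic C (k \<cdot> d) (Id C a)"
    using weq_extend[OF d c'(1,2) Id_in[OF o(1)] c'(3)] .
  have "homotopic C (d \<cdot> k \<cdot> d) (Id C b \<cdot> d)"
    using homotopic_post[OF k(2) comp_in[OF d(1) k(1)] d(1)] k d by (simp add: cs)
  then have "homotopic C (d \<cdot> k) (Id C b)"
    using weq_cancel[OF d c'(1,2) comp_in[OF k(1) d(1)] Id_in[OF o(2)] c'(4)] by blast
  moreover have "k \<cdot> d \<in> Weq C"
    using homotopic_weq[OF homotopic_sym[OF k(2)] Id_in_weq[OF o(1)]] .
  then have "k \<in> Weq C" using two_of_three(2)[OF d(1) k(1) d(2)] by blast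
  ultimately show ?thesis using that k by blast
qed

text \<open>Conversely, homotopy equivalences are weak equivalences: up to an acyclic cofibration the map is a
  fibration with a strict section, hence a retract of a self-map homotopic to the identity.\<close>

lemma homotopy_equivalence_weq:
  assumes f: "f \<in> hom a b" "g \<in> hom b a" and c: "bifibrant C a" "bifibrant C b"
    and h: "homotopic C (g \<cdot> f) (Id C a)" "homotopic C (f \<cdot> g) (Id C b)"
  shows "f \<in> Weq C"
proof -
  have c': "cofibrant C a" "cofibrant C b" "fibrant C a" "fibrant C b" using c by (simp_all add: bifibrant_def)
  have o: "a \<in> Obj C" "b \<in> Obj C" using c'(1,2) cofibrant_obj by blast+
  obtain e j p where e: "j \<in> hom a e" "p \<in> hom e b" "j \<in> Cof C" "j \<in> Weq C" "p \<in> Fib C" "p \<cdot> j = f"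
    using factor_acof[OF f(1)] .
  have ec: "cofibrant C e" "fibrant C e" using cofibrant_cof[OF c'(1) e(1,3)] fibrant_fib[OF c'(4) e(2,5)] .
  then have eo: "e \<in> Obj C" using cofibrant_obj by blast
  have jg: "j \<cdot> g \<in> hom b e" using comp_in e f by blast
  have "homotopic C (p \<cdot> (j \<cdot> g)) (Id C b)" using h(2) e f by (simp add: cs e(6)[THEN pre])
  then obtain s where s: "s \<in> hom b e" "homotopic C (j \<cdot> g) s" "p \<cdot> s = Id C b"
    using homotopy_lifting[OF e(2,5) jg c'(2)] by metis
  have "homotopic C ((s \<cdot> p) \<cdot> j) (Id C e \<cdot> j)"
  proof -
    have "homotopic C (s \<cdot> f) (j \<cdot> g \<cdot> f)"
      using homotopic_sym[OF homotopic_pre[OF s(2) jg f(1) c'(2,1) ec(2)]] .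
    moreover have "homotopic C (j \<cdot> g \<cdot> f) (j)"
      using homotopic_post[OF h(1) comp_in[OF f] e(1)] e f by (simp add: cs)
    ultimately have "homotopic C (s \<cdot> f) j"
      using homotopic_trans comp_in[OF f(1) s(1)] c'(1) ec(2) by blast
    then show ?thesis using s e by (simp add: cs)
  qed
  then have "homotopic C (s \<cdot> p) (Id C e)"
    using weq_cancel[OF e(1,4) c'(1) ec(1) comp_in[OF e(2) s(1)] Id_in[OF eo] ec(2)] by blast
  then have "s \<cdot> p \<in> Weq C"
    using homotopic_weq[OF homotopic_sym Id_in_weq[OF eo]] by blast
  moreover have "retract_of C p (s \<cdot> p)"
    by (rule retract_ofI[of _ _ _ "Id C e" s "Id C e" p])
       (use e(2) s(1) eo o in \<open>simp_all add: cs s(3) s(3)[THEN pre]\<close>)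
  ultimately have "p \<in> Weq C" using retract_closed by blast
  then show ?thesis using two_of_three(1)[OF e(1,2,4)] e(6) by simp
qed

end

section \<open>Gluing weak equivalences\<close>

context model_category begin

text \<open>Base change of a weak equivalence along a cofibration between cofibrant objects. For an acyclic
  fibration \<open>q\<close> with section \<open>s0\<close>, the composite \<open>s0 \<cdot> q\<close> is homotopic to the identity over the target.
  Factoring the pushed out map \<open>Q\<close> through a fibration, this homotopy extends to one between the first
  factor and a map which admits \<open>Q\<close> as a retract.\<close>

lemma pushout_weq_afib:
  assumes po: "pushout C i q S Q k" and i: "i \<in> hom c a" "i \<in> Cof C"
    and q: "q \<in> hom c c'" "q \<in> Fib C" "q \<in> Weq C" and co: "cofibrant C c" "cofibrant C c'"
  shows "Q \<in> Weq C"
proof -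
  note D = pushoutD[OF po i(1) q(1)]
  have o: "c \<in> Obj C" "c' \<in> Obj C" "a \<in> Obj C" "S \<in> Obj C" using D(2) i(1) q(1) by (simp_all add: Hom_iff)
  obtain s0 where s0: "s0 \<in> hom c' c" "q \<cdot> s0 = Id C c'"
    using cofibrant_lift[OF co(2) q(2,3,1) Id_in[OF o(2)]] .
  obtain E s p where s: "s \<in> hom a E" "p \<in> hom E S" "s \<in> Cof C" "s \<in> Weq C" "p \<in> Fib C" "p \<cdot> s = Q"
    using factor_acof[OF D(2)] .
  have oE: "E \<in> Obj C" using s(1) by (simp add: Hom_iff)
  \<comment> \<open>A path object of \<open>E\<close> over \<open>S\<close>.\<close>
  obtain W x0 x1 where W: "pushout (op C) p p W x0 x1" "x0 \<in> hom W E" "x1 \<in> hom W E" "p \<cdot> x0 = p \<cdot> x1"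
    using pullback_exists[OF s(2) s(2)] .
  obtain dg where dg: "dg \<in> hom E W" "x0 \<cdot> dg = Id C E" "x1 \<cdot> dg = Id C E"
    using pullback_univ[OF W(1) s(2) s(2) Id_in Id_in] oE by metis
  obtain B c0 ev where B: "c0 \<in> hom E B" "ev \<in> hom B W" "c0 \<in> Cof C" "c0 \<in> Weq C" "ev \<in> Fib C" "ev \<cdot> c0 = dg"
    using factor_acof[OF dg(1)] .
  have x: "x0 \<in> Fib C" "x1 \<in> Fib C"
    using pullback_fib[OF W(1) s(2,2,5)] pullback_fib[OF small_category.pushout_sym[OF small_dual W(1)] s(2,2,5)] by auto
  have e0: "x0 \<cdot> ev \<in> hom B E" "x0 \<cdot> ev \<in> Fib C" "x0 \<cdot> ev \<cdot> c0 = Id C E"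
    using comp_in[OF B(2) W(2)] fib_comp[OF W(2) x(1) B(2,5)] B W dg by (simp_all add: cs B(6))
  have e1: "x1 \<cdot> ev \<in> hom B E" "x1 \<cdot> ev \<cdot> c0 = Id C E"
    using comp_in[OF B(2) W(3)] B W dg by (simp_all add: cs B(6))
  have ew: "x0 \<cdot> ev \<in> Weq C" "x1 \<cdot> ev \<in> Weq C"
    using weq_section[OF B(1) e0(1,3)] weq_section[OF B(1) e1] B(4) by auto
  \<comment> \<open>The homotopy from the identity of \<open>c\<close> to \<open>s0 \<cdot> q\<close>, as a path in \<open>E\<close> over \<open>S\<close>.\<close>
  obtain I :: "('o,'m) htpy" where I: "is_cylinder C c I" using cylinder_exists[OF o(1)] by metis
  note Y = cylinderD[OF I]
  obtain h where h: "h \<in> hom (cyl I) c" "h \<cdot> end0 I = Id C c" "h \<cdot> end1 I = s0 \<cdot> q" "q \<cdot> h = q \<cdot> proj I"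
  proof (rule cylinder_lift[OF I q])
    show "Id C c \<in> hom c c" "s0 \<cdot> q \<in> hom c c" "q \<cdot> proj I \<in> hom (cyl I) c'"
      using Id_in[OF o(1)] comp_in q s0 Y by blast+
    show "q \<cdot> Id C c = q \<cdot> proj I \<cdot> end0 I" "q \<cdot> (s0 \<cdot> q) = q \<cdot> proj I \<cdot> end1 I"
      using q s0 Y by (simp_all add: cs s0(2)[THEN pre])
  qed
  have si: "s \<cdot> i \<in> hom c E" using comp_in[OF i(1) s(1)] .
  have "p \<cdot> (s \<cdot> i \<cdot> proj I) = p \<cdot> (s \<cdot> i \<cdot> h)"
    using s(1,2) i(1) Y(1-3) h(1) D(2,3) q(1) by (simp add: cs s(6)[THEN pre] D(4)[THEN pre] h(4))
  then obtain g where g: "g \<in> hom (cyl I) W" "x0 \<cdot> g = s \<cdot> i \<cdot> proj I" "x1 \<cdot> g = s \<cdot> i \<cdot> h"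
    using pullback_univ[OF W(1) s(2) s(2) comp_in[OF Y(3) si] comp_in[OF h(1) si]] by metis
  have ci: "c0 \<cdot> (s \<cdot> i) \<in> hom c B" using comp_in si B by blast
  have gg: "ev \<cdot> (c0 \<cdot> (s \<cdot> i)) = g \<cdot> end0 I"
  proof (rule pullback_eq[OF W(1)])
    show "ev \<cdot> (c0 \<cdot> (s \<cdot> i)) \<in> hom c W" "g \<cdot> end0 I \<in> hom c W" using comp_in ci B g Y by blast+
    show "x0 \<cdot> (ev \<cdot> (c0 \<cdot> (s \<cdot> i))) = x0 \<cdot> (g \<cdot> end0 I)"
      using B(1,2) s(1) i(1) W(2) dg(1) g(1) Y(1-3,5) oE o by (simp add: cs B(6)[THEN pre] dg(2)[THEN pre] g(2)[THEN pre])
    show "x1 \<cdot> (ev \<cdot> (c0 \<cdot> (s \<cdot> i))) = x1 \<cdot> (g \<cdot> end0 I)"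
      using B(1,2) s(1) i(1) W(3) dg(1) g(1) Y(1-3) h(1,2) oE o by (simp add: cs B(6)[THEN pre] dg(3)[THEN pre] g(3)[THEN pre])
  qed
  obtain T where T: "T \<in> hom (cyl I) B" "T \<cdot> end0 I = c0 \<cdot> (s \<cdot> i)" "ev \<cdot> T = g"
    using lift[OF cylinder_ends(3)[OF I co(1)] B(5) disjI1[OF cylinder_ends(1)[OF I]] Y(1) B(2) ci g(1) gg] .
  have th: "T \<cdot> end1 I \<in> hom c B" using comp_in T Y by blast
  have t0: "x0 \<cdot> ev \<cdot> (T \<cdot> end1 I) = s \<cdot> i"
    using T(1) Y(1-3,6) W(2) B(2) g(1) s(1) i(1) o by (simp add: cs T(3)[THEN pre] g(2)[THEN pre])
  have t1: "x1 \<cdot> ev \<cdot> (T \<cdot> end1 I) = s \<cdot> i \<cdot> s0 \<cdot> q"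
    using T(1) Y(1-3) W(3) B(2) g(1) s(1) i(1) h(1,3) s0(1) q(1) o by (simp add: cs T(3)[THEN pre] g(3)[THEN pre])
  obtain Th where Th: "Th \<in> hom a B" "Th \<cdot> i = T \<cdot> end1 I" "x0 \<cdot> ev \<cdot> Th = s"
    using lift[OF i(2) e0(2) disjI2[OF ew(1)] i(1) e0(1) th s(1) t0] .
  have Thw: "Th \<in> Weq C" using two_of_three(3)[OF Th(1) e0(1) ew(1)] Th s by simp
  define s' where "s' = x1 \<cdot> ev \<cdot> Th"
  have s': "s' \<in> hom a E" "s' \<in> Weq C"
    unfolding s'_def using comp_in[OF Th(1) e1(1)] two_of_three(1)[OF Th(1) e1(1) Thw ew(2)] .
  have "s' \<cdot> i = (s \<cdot> i \<cdot> s0) \<cdot> q"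
    unfolding s'_def using t1 Th(1) e1 i(1) th W(3) B(2) by (simp add: cs Th(2))
  then obtain m where m: "m \<in> hom S E" "m \<cdot> Q = s'" "m \<cdot> k = s \<cdot> i \<cdot> s0"
    using pushout_univ[OF po i(1) q(1) s'(1) comp_in[OF s0(1) si]] by metis
  have ps: "p \<cdot> s' = Q"
  proof -
    have "p \<cdot> s' = p \<cdot> (x0 \<cdot> ev \<cdot> Th)"
      unfolding s'_def using s(2) W(2,3) B(2) Th(1) by (simp add: cs W(4)[THEN pre])
    then show ?thesis by (simp add: Th(3) s(6))
  qed
  have pm: "p \<cdot> m = Id C S"
  proof (rule pushout_eq[OF po comp_in[OF m(1) s(2)] Id_in[OF o(4)]])
    show "p \<cdot> m \<cdot> Q = Id C S \<cdot> Q" using m(1) s(2) D(2) by (simp add: cs m(2) ps)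
    show "p \<cdot> m \<cdot> k = Id C S \<cdot> k"
      using m(1) s(1,2) D(2,3) s0(1) i(1) q(1)
      by (simp add: cs m(3) s(6)[THEN pre] D(4)[THEN pre] s0(2))
  qed
  have "retract_of C Q s'"
    by (rule retract_ofI[of _ _ _ "Id C a" m "Id C a" p])
       (use D(2) s'(1) m(1) s(2) o in \<open>simp_all add: cs pm m(2) ps\<close>)
  then show ?thesis using retract_closed s' by blast
qed

lemma pushout_weq:
  assumes po: "pushout C i q S Q k" and i: "i \<in> hom c a" "i \<in> Cof C"
    and q: "q \<in> hom c c'" "q \<in> Weq C" and co: "cofibrant C c" "cofibrant C c'"
  shows "Q \<in> Weq C"
proof -
  note D = pushoutD[OF po i(1) q(1)]
  obtain x j r where j: "j \<in> hom c x" "r \<in> hom x c'" "j \<in> Cof C" "j \<in> Weq C" "r \<in> Fib C" "r \<cdot> j = q"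
    using factor_acof[OF q(1)] .
  have r: "r \<in> Weq C" using two_of_three(2)[OF j(1,2,4)] q j by simp
  have x: "cofibrant C x" using cofibrant_cof[OF co(1) j(1,3)] .
  obtain S1 Q1 k1 where S1: "pushout C i j S1 Q1 k1" "Q1 \<in> hom a S1" "k1 \<in> hom x S1" "Q1 \<cdot> i = k1 \<cdot> j"
    using pushout_exists[OF i(1) j(1)] .
  have 1: "Q1 \<in> Weq C" using pushout_acof[OF pushout_sym[OF S1(1)] j(1) i(1) j(3,4)] .
  have k1: "k1 \<in> Cof C" using pushout_cof[OF S1(1) i(1) j(1) i(2)] .
  have "Q \<cdot> i = (k \<cdot> r) \<cdot> j" using D(2,3,4) j i by (simp add: cs)
  then obtain t where t: "t \<in> hom S1 S" "t \<cdot> Q1 = Q" "t \<cdot> k1 = k \<cdot> r"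
    using pushout_univ[OF S1(1) i(1) j(1) D(2) comp_in[OF j(2) D(3)]] by metis
  have po': "pushout C i (r \<cdot> j) S Q k" using po j(6) by simp
  have "pushout C k1 r S t k" using pushout_cancel[OF S1(1) po' i(1) j(1,2) t] .
  then have "t \<in> Weq C" using pushout_weq_afib[OF _ S1(3) k1 j(2,5) r x co(2)] by blast
  then show ?thesis using two_of_three(1)[OF S1(2) t(1) 1] t(2) by simp
qed

text \<open>The comparison map is itself a cobase change of \<open>k\<close> along a cofibration, by pasting.\<close>

lemma glue_leg:
  assumes 1: "pushout C f g d p q" and 2: "pushout C f (k \<cdot> g) T r s"
    and f: "f \<in> hom c a" "f \<in> Cof C" and g: "g \<in> hom c b" and k: "k \<in> hom b e" "k \<in> Weq C"
    and co: "cofibrant C b" "cofibrant C e" and t: "t \<in> hom d T" "t \<cdot> p = r" "t \<cdot> q = s \<cdot> k"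
  shows "t \<in> Weq C"
  using pushout_weq[OF pushout_cancel[OF 1 2 f(1) g k(1) t] pushoutD(3)[OF 1 f(1) g]
      pushout_cof[OF 1 f(1) g f(2)] k co] .

text \<open>The map of spans is decomposed into three, each changing one corner: first \<open>b\<close>, then \<open>c\<close>, which does
  not change the pushout, and last \<open>a\<close>.\<close>

lemma gluing:
  assumes P: "pushout C f g d p q" and P': "pushout C f' g' d' p' q'"
    and f: "f \<in> hom c a" "f \<in> Cof C" and g: "g \<in> hom c b" "g \<in> Cof C" and c: "cofibrant C c"
    and f': "f' \<in> hom c' a'" "f' \<in> Cof C" and g': "g' \<in> hom c' b'" "g' \<in> Cof C" and c': "cofibrant C c'"
    and wc: "wc \<in> hom c c'" "wc \<in> Weq C" and wa: "wa \<in> hom a a'" "wa \<in> Weq C" and wb: "wb \<in> hom b b'" "wb \<in> Weq C"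
    and e: "wa \<cdot> f = f' \<cdot> wc" "wb \<cdot> g = g' \<cdot> wc"
    and t: "t \<in> hom d d'" "t \<cdot> p = p' \<cdot> wa" "t \<cdot> q = q' \<cdot> wb"
  shows "t \<in> Weq C"
proof -
  note D = pushoutD[OF P f(1) g(1)] and D' = pushoutD[OF P' f'(1) g'(1)]
  have co: "cofibrant C a" "cofibrant C b" "cofibrant C a'" "cofibrant C b'"
    using cofibrant_cof[OF c] cofibrant_cof[OF c'] f g f' g' by blast+
  have wg: "wb \<cdot> g \<in> hom c b'" using comp_in[OF g(1) wb(1)] .
  obtain T r1 s1 where T: "pushout C f (wb \<cdot> g) T r1 s1" "r1 \<in> hom a T" "s1 \<in> hom b' T" "r1 \<cdot> f = s1 \<cdot> (wb \<cdot> g)"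
    using pushout_exists[OF f(1) wg] .
  have "r1 \<cdot> f = (s1 \<cdot> wb) \<cdot> g" using T(2,3,4) wb g f by (simp add: cs)
  then obtain t1 where t1: "t1 \<in> hom d T" "t1 \<cdot> p = r1" "t1 \<cdot> q = s1 \<cdot> wb"
    using pushout_univ[OF P f(1) g(1) T(2) comp_in[OF wb(1) T(3)]] by metis
  have w1: "t1 \<in> Weq C" using glue_leg[OF P T(1) f g(1) wb co(2,4) t1] .
  obtain A1 al ph where A1: "pushout C f wc A1 al ph" "al \<in> hom a A1" "ph \<in> hom c' A1" "al \<cdot> f = ph \<cdot> wc"
    using pushout_exists[OF f(1) wc(1)] .
  have al: "al \<in> Weq C" using pushout_weq[OF A1(1) f wc c c'] .
  have phc: "ph \<in> Cof C" using pushout_cof[OF A1(1) f(1) wc(1) f(2)] .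
  obtain ka where ka: "ka \<in> hom A1 a'" "ka \<cdot> al = wa" "ka \<cdot> ph = f'"
    using pushout_univ[OF A1(1) f(1) wc(1) wa(1) f'(1) e(1)] .
  have kw: "ka \<in> Weq C" using two_of_three(2)[OF A1(2) ka(1) al] ka wa by simp
  have "r1 \<cdot> f = (s1 \<cdot> g') \<cdot> wc" using T(2,3,4) g' wc f by (simp add: cs e(2))
  then obtain ta where ta: "ta \<in> hom A1 T" "ta \<cdot> al = r1" "ta \<cdot> ph = s1 \<cdot> g'"
    using pushout_univ[OF A1(1) f(1) wc(1) T(2) comp_in[OF g'(1) T(3)]] by metis
  have T': "pushout C ph g' T ta s1"
    using pushout_cancel[OF A1(1) T(1)[unfolded e(2)] f(1) wc(1) g'(1) ta] .
  have "(p' \<cdot> ka) \<cdot> ph = q' \<cdot> g'" using ka(1,3) D'(2,3,4) A1(3) by (simp add: cs)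
  then obtain t2 where t2: "t2 \<in> hom T d'" "t2 \<cdot> ta = p' \<cdot> ka" "t2 \<cdot> s1 = q'"
    using pushout_univ[OF T' A1(3) g'(1) comp_in[OF ka(1) D'(2)] D'(3)] by metis
  have "pushout C g' (ka \<cdot> ph) d' q' p'" using pushout_sym[OF P'] ka by simp
  then have w2: "t2 \<in> Weq C"
    using glue_leg[OF pushout_sym[OF T'] _ g' A1(3) ka(1) kw cofibrant_cof[OF c' A1(3) phc] co(3) t2(1,3,2)] by blast
  have "t = t2 \<cdot> t1"
  proof (rule pushout_eq[OF P t(1) comp_in[OF t1(1) t2(1)]])
    have "t2 \<cdot> r1 = p' \<cdot> wa" unfolding ta(2)[symmetric] ka(2)[symmetric]
      using t2(1) ta(1) A1(2) D'(2) ka(1) by (simp add: cs t2(2)[THEN pre])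
    then show "t \<cdot> p = t2 \<cdot> t1 \<cdot> p" using t(1,2) t1(1,2) t2(1) D(2) by (simp add: cs)
    show "t \<cdot> q = t2 \<cdot> t1 \<cdot> q" using t(1,3) t1(1,3) t2(1) D(3) T(3) wb(1) by (simp add: cs t2(3)[THEN pre])
  qed
  then show ?thesis using two_of_three(1)[OF t1(1) t2(1) w1 w2] by simp
qed

end

section \<open>Homotopy pushout squares that commute strictly\<close>

definition square :: "('o, 'm) mcat \<Rightarrow> 'o \<Rightarrow> 'o \<Rightarrow> 'o \<Rightarrow> 'o \<Rightarrow> 'm \<Rightarrow> 'm \<Rightarrow> 'm \<Rightarrow> 'm \<Rightarrow> bool" where
  "square C c a b d f g u v \<longleftrightarrow>
     f \<in> Hom C c a \<and> g \<in> Hom C c b \<and> u \<in> Hom C a d \<and> v \<in> Hom C b d \<and> comp C u f = comp C v g"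

text \<open>A resolution replaces a span by a weakly equivalent one whose strict pushout is homotopically
  meaningful.\<close>

definition resolution :: "('o, 'm) mcat \<Rightarrow> 'o \<Rightarrow> 'o \<Rightarrow> 'o \<Rightarrow> 'm \<Rightarrow> 'm \<Rightarrow> 'o \<Rightarrow> 'o \<Rightarrow> 'o \<Rightarrow> 'm \<Rightarrow> 'm \<Rightarrow>
    'm \<Rightarrow> 'm \<Rightarrow> 'm \<Rightarrow> bool" where
  "resolution C c a b f g c' a' b' f' g' wc wa wb \<longleftrightarrow>
     f \<in> Hom C c a \<and> g \<in> Hom C c b \<and> f' \<in> Hom C c' a' \<and> g' \<in> Hom C c' b' \<and>
     cofibrant C c' \<and> f' \<in> Cof C \<and> g' \<in> Cof C \<and>
     wc \<in> Hom C c' c \<and> wa \<in> Hom C a' a \<and> wb \<in> Hom C b' b \<and>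
     wc \<in> Weq C \<and> wa \<in> Weq C \<and> wb \<in> Weq C \<and>
     comp C wa f' = comp C f wc \<and> comp C wb g' = comp C g wc"

text \<open>The square is compared with the strict pushout of a resolution, so that the notion makes sense for arbitrary
  objects and is invariant under weak equivalences.\<close>

definition hpo :: "('o, 'm) mcat \<Rightarrow> 'm \<Rightarrow> 'm \<Rightarrow> 'm \<Rightarrow> 'm \<Rightarrow> bool" where
  "hpo C f g u v \<longleftrightarrow>
     (\<exists>c a b d. square C c a b d f g u v \<and>
       (\<exists>c' a' b' f' g' wc wa wb S p q w. resolution C c a b f g c' a' b' f' g' wc wa wb \<and>
          pushout C f' g' S p q \<and> w \<in> Hom C S d \<and> comp C w p = comp C u wa \<and> comp C w q = comp C v wb \<and>
          w \<in> Weq C))"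

abbreviation hpb :: "('o, 'm) mcat \<Rightarrow> 'm \<Rightarrow> 'm \<Rightarrow> 'm \<Rightarrow> 'm \<Rightarrow> bool" where
  "hpb C f g u v \<equiv> hpo (op C) u v f g"

context model_category begin

lemma resolution_exists:
  assumes "f \<in> hom c a" "g \<in> hom c b"
  obtains c' a' b' f' g' wc wa wb where "resolution C c a b f g c' a' b' f' g' wc wa wb"
    "wc \<in> Fib C" "wa \<in> Fib C" "wb \<in> Fib C"
proof -
  have "c \<in> Obj C" using assms by (simp add: Hom_iff)
  then obtain c' wc where c: "cofibrant C c'" "wc \<in> hom c' c" "wc \<in> Fib C" "wc \<in> Weq C"
    using cofibrant_replacement by metis
  obtain a' f' wa where a: "f' \<in> hom c' a'" "wa \<in> hom a' a" "f' \<in> Cof C" "wa \<in> Fib C" "wa \<in> Weq C" "wa \<cdot> f' = f \<cdot> wc"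
    using factor_afib[OF comp_in[OF c(2) assms(1)]] .
  obtain b' g' wb where b: "g' \<in> hom c' b'" "wb \<in> hom b' b" "g' \<in> Cof C" "wb \<in> Fib C" "wb \<in> Weq C" "wb \<cdot> g' = g \<cdot> wc"
    using factor_afib[OF comp_in[OF c(2) assms(2)]] .
  show ?thesis
    by (rule that[of c' a' b' f' g' wc wa wb]) (use assms a b c in \<open>simp_all add: resolution_def\<close>)
qed

text \<open>Every resolution maps to one whose comparison maps are acyclic fibrations, and the induced map of
  pushouts is a weak equivalence by gluing. So whether the comparison map is a weak equivalence does not
  depend on the resolution.\<close>

lemma resolution_compare:
  assumes sq: "square C c a b d f g u v"
    and 1: "resolution C c a b f g c1 a1 b1 f1 g1 wc1 wa1 wb1"
    and 2: "resolution C c a b f g c2 a2 b2 f2 g2 wc2 wa2 wb2" "wc2 \<in> Fib C" "wa2 \<in> Fib C" "wb2 \<in> Fib C"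
    and P1: "pushout C f1 g1 S1 p1 q1" "w1 \<in> hom S1 d" "w1 \<cdot> p1 = u \<cdot> wa1" "w1 \<cdot> q1 = v \<cdot> wb1"
    and P2: "pushout C f2 g2 S2 p2 q2" "w2 \<in> hom S2 d" "w2 \<cdot> p2 = u \<cdot> wa2" "w2 \<cdot> q2 = v \<cdot> wb2"
  shows "w1 \<in> Weq C \<longleftrightarrow> w2 \<in> Weq C"
proof -
  have s: "f \<in> hom c a" "g \<in> hom c b" "u \<in> hom a d" "v \<in> hom b d" using sq by (simp_all add: square_def)
  have r1: "f1 \<in> hom c1 a1" "g1 \<in> hom c1 b1" "cofibrant C c1" "f1 \<in> Cof C" "g1 \<in> Cof C"
    "wc1 \<in> hom c1 c" "wa1 \<in> hom a1 a" "wb1 \<in> hom b1 b" "wc1 \<in> Weq C" "wa1 \<in> Weq C" "wb1 \<in> Weq C"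
    and e1: "wa1 \<cdot> f1 = f \<cdot> wc1" "wb1 \<cdot> g1 = g \<cdot> wc1"
    using 1 by (simp_all add: resolution_def)
  have r2: "f2 \<in> hom c2 a2" "g2 \<in> hom c2 b2" "cofibrant C c2" "f2 \<in> Cof C" "g2 \<in> Cof C"
    "wc2 \<in> hom c2 c" "wa2 \<in> hom a2 a" "wb2 \<in> hom b2 b" "wc2 \<in> Weq C" "wa2 \<in> Weq C" "wb2 \<in> Weq C"
    and e2: "wa2 \<cdot> f2 = f \<cdot> wc2" "wb2 \<cdot> g2 = g \<cdot> wc2"
    using 2(1) by (simp_all add: resolution_def)
  note D1 = pushoutD[OF P1(1) r1(1,2)] and D2 = pushoutD[OF P2(1) r2(1,2)]
  obtain kc where kc: "kc \<in> hom c1 c2" "wc2 \<cdot> kc = wc1"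
    using cofibrant_lift[OF r1(3) 2(2) r2(9,6) r1(6)] .
  have "wa2 \<cdot> (f2 \<cdot> kc) = wa1 \<cdot> f1" "wb2 \<cdot> (g2 \<cdot> kc) = wb1 \<cdot> g1"
    using s(1,2) r2(1,2,6-8) kc(1) by (simp_all add: cs e1 e2(1,2)[THEN pre] kc(2))
  then obtain ka kb where ka: "ka \<in> hom a1 a2" "ka \<cdot> f1 = f2 \<cdot> kc" "wa2 \<cdot> ka = wa1"
    and kb: "kb \<in> hom b1 b2" "kb \<cdot> g1 = g2 \<cdot> kc" "wb2 \<cdot> kb = wb1"
    using lift[OF r1(4) 2(3) disjI2[OF r2(10)] r1(1) r2(7) comp_in[OF kc(1) r2(1)] r1(7)]
      lift[OF r1(5) 2(4) disjI2[OF r2(11)] r1(2) r2(8) comp_in[OF kc(1) r2(2)] r1(8)] by metis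
  have kw: "kc \<in> Weq C" "ka \<in> Weq C" "kb \<in> Weq C"
    using two_of_three(3)[OF kc(1) r2(6)] two_of_three(3)[OF ka(1) r2(7)] two_of_three(3)[OF kb(1) r2(8)]
      kc(2) ka(3) kb(3) r1 r2 by simp_all
  have "(p2 \<cdot> ka) \<cdot> f1 = (q2 \<cdot> kb) \<cdot> g1"
    using D2(2,3) ka(1) kb(1) kc(1) r1(1,2) r2(1,2) by (simp add: cs ka(2) kb(2) D2(4)[THEN pre])
  then obtain t where t: "t \<in> hom S1 S2" "t \<cdot> p1 = p2 \<cdot> ka" "t \<cdot> q1 = q2 \<cdot> kb"
    using pushout_univ[OF P1(1) r1(1,2) comp_in[OF ka(1) D2(2)] comp_in[OF kb(1) D2(3)]] by metis
  have tw: "t \<in> Weq C"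
    using gluing[OF P1(1) P2(1) r1(1,4,2,5,3) r2(1,4,2,5,3) kc(1) kw(1) ka(1) kw(2) kb(1) kw(3) ka(2) kb(2) t] .
  have "w2 \<cdot> t = w1"
  proof (rule pushout_eq[OF P1(1) comp_in[OF t(1) P2(2)] P1(2)])
    show "w2 \<cdot> t \<cdot> p1 = w1 \<cdot> p1"
      using t(1) P2(2) D1(2) D2(2) ka(1) s r2(7) by (simp add: cs t(2) P2(3)[THEN pre] P1(3) ka(3))
    show "w2 \<cdot> t \<cdot> q1 = w1 \<cdot> q1"
      using t(1) P2(2) D1(3) D2(3) kb(1) s r2(8) by (simp add: cs t(3) P2(4)[THEN pre] P1(4) kb(3))
  qed
  then show ?thesis using comp_weq_iff(1)[OF t(1) P2(2) tw] by simp
qed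

lemma resolution_map:
  assumes sq: "square C c a b d f g u v" and r: "resolution C c a b f g c' a' b' f' g' wc wa wb"
    and P: "pushout C f' g' S p q"
  obtains w where "w \<in> hom S d" "w \<cdot> p = u \<cdot> wa" "w \<cdot> q = v \<cdot> wb"
proof -
  have t: "f \<in> hom c a" "g \<in> hom c b" "u \<in> hom a d" "v \<in> hom b d" "f' \<in> hom c' a'" "g' \<in> hom c' b'"
    "wc \<in> hom c' c" "wa \<in> hom a' a" "wb \<in> hom b' b"
    and e: "wa \<cdot> f' = f \<cdot> wc" "wb \<cdot> g' = g \<cdot> wc" "u \<cdot> f = v \<cdot> g"
    using sq r by (simp_all add: square_def resolution_def)
  have "(u \<cdot> wa) \<cdot> f' = (v \<cdot> wb) \<cdot> g'" using t by (simp add: cs e(1,2) e(3)[THEN pre])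
  then show ?thesis
    using pushout_univ[OF P t(5,6) comp_in[OF t(8,3)] comp_in[OF t(9,4)]] that by metis
qed

lemma hpo_iff:
  assumes sq: "square C c a b d f g u v" and r: "resolution C c a b f g c' a' b' f' g' wc wa wb"
    and P: "pushout C f' g' S p q" "w \<in> hom S d" "w \<cdot> p = u \<cdot> wa" "w \<cdot> q = v \<cdot> wb"
  shows "hpo C f g u v \<longleftrightarrow> w \<in> Weq C"
proof
  assume "w \<in> Weq C" then show "hpo C f g u v" unfolding hpo_def using sq r P by blast
next
  assume "hpo C f g u v"
  then obtain c0 a0 b0 d0 c1 a1 b1 f1 g1 wc1 wa1 wb1 S1 p1 q1 w1 where
    sq1: "square C c0 a0 b0 d0 f g u v" and r1: "resolution C c0 a0 b0 f g c1 a1 b1 f1 g1 wc1 wa1 wb1" and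
    P1: "pushout C f1 g1 S1 p1 q1" "w1 \<in> hom S1 d0" "w1 \<cdot> p1 = u \<cdot> wa1" "w1 \<cdot> q1 = v \<cdot> wb1" "w1 \<in> Weq C"
    unfolding hpo_def by (elim exE conjE)
  have "c0 = c" "a0 = a" "b0 = b" "d0 = d" using sq sq1 by (simp_all add: square_def Hom_def)
  note r1 = r1[unfolded this] and P1 = P1[unfolded this]
  have fg: "f \<in> hom c a" "g \<in> hom c b" using sq by (simp_all add: square_def)
  obtain c2 a2 b2 f2 g2 wc2 wa2 wb2 where r2: "resolution C c a b f g c2 a2 b2 f2 g2 wc2 wa2 wb2"
    "wc2 \<in> Fib C" "wa2 \<in> Fib C" "wb2 \<in> Fib C"
    using resolution_exists[OF fg] .
  have "f2 \<in> hom c2 a2" "g2 \<in> hom c2 b2" using r2(1) by (simp_all add: resolution_def)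
  then obtain S2 p2 q2 where P2: "pushout C f2 g2 S2 p2 q2" using pushout_exists by metis
  obtain w2 where w2: "w2 \<in> hom S2 d" "w2 \<cdot> p2 = u \<cdot> wa2" "w2 \<cdot> q2 = v \<cdot> wb2"
    using resolution_map[OF sq r2(1) P2] .
  show "w \<in> Weq C"
    using resolution_compare[OF sq r r2 P P2 w2] resolution_compare[OF sq r1 r2 P1(1-4) P2 w2] P1(5) by blast
qed

lemma hpo_square:
  assumes "hpo C f g u v"
  obtains c a b d where "square C c a b d f g u v"
  using assms unfolding hpo_def by (elim exE conjE)

lemma hpoD:
  assumes "hpo C f g u v" "f \<in> hom c a" "g \<in> hom c b" "u \<in> hom a d"
  shows "square C c a b d f g u v" "v \<in> hom b d" "u \<cdot> f = v \<cdot> g"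
  using assms by (auto simp: square_def Hom_def elim!: hpo_square)

lemma resolve:
  assumes sq: "square C c a b d f g u v"
  obtains c' a' b' f' g' wc wa wb S p q w where
    "resolution C c a b f g c' a' b' f' g' wc wa wb" "pushout C f' g' S p q"
    "w \<in> hom S d" "w \<cdot> p = u \<cdot> wa" "w \<cdot> q = v \<cdot> wb" "hpo C f g u v \<longleftrightarrow> w \<in> Weq C"
proof -
  have fg: "f \<in> hom c a" "g \<in> hom c b" using sq by (simp_all add: square_def)
  obtain c2 a2 b2 f2 g2 wc2 wa2 wb2 where r2: "resolution C c a b f g c2 a2 b2 f2 g2 wc2 wa2 wb2"
    using resolution_exists[OF fg] .
  then have "f2 \<in> hom c2 a2" "g2 \<in> hom c2 b2" by (simp_all add: resolution_def)
  then obtain S2 p2 q2 where P2: "pushout C f2 g2 S2 p2 q2" using pushout_exists by metis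
  obtain w2 where w2: "w2 \<in> hom S2 d" "w2 \<cdot> p2 = u \<cdot> wa2" "w2 \<cdot> q2 = v \<cdot> wb2"
    using resolution_map[OF sq r2 P2] .
  show ?thesis using that[OF r2 P2 w2 hpo_iff[OF sq r2 P2 w2]] .
qed

lemma hpo_sym: "hpo C f g u v \<Longrightarrow> hpo C g f v u"
proof -
  assume h: "hpo C f g u v"
  then obtain c a b d where sq: "square C c a b d f g u v" by (rule hpo_square)
  obtain c' a' b' f' g' wc wa wb S p q w where r:
    "resolution C c a b f g c' a' b' f' g' wc wa wb" "pushout C f' g' S p q"
    "w \<in> hom S d" "w \<cdot> p = u \<cdot> wa" "w \<cdot> q = v \<cdot> wb" "hpo C f g u v \<longleftrightarrow> w \<in> Weq C"
    using resolve[OF sq] .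
  have "square C c b a d g f v u" using sq by (simp add: square_def)
  moreover have "resolution C c b a g f c' b' a' g' f' wc wb wa" using r(1) by (simp add: resolution_def)
  ultimately show ?thesis using hpo_iff[OF _ _ pushout_sym[OF r(2)] r(3,5,4)] r(6) h by blast
qed

text \<open>A resolution of a square is also a resolution of every square that receives a weak equivalence of
  spans from it. Invariance and comparison of homotopy pushouts both follow.\<close>

lemma square_resolution:
  assumes sq: "square C c a b d f g u v" and sq': "square C c1 a1 b1 d1 f1 g1 u1 v1"
    and wc: "wc \<in> hom c c1" "wc \<in> Weq C" and wa: "wa \<in> hom a a1" "wa \<in> Weq C"
    and wb: "wb \<in> hom b b1" "wb \<in> Weq C" and wd: "wd \<in> hom d d1"
    and e: "wa \<cdot> f = f1 \<cdot> wc" "wb \<cdot> g = g1 \<cdot> wc" "wd \<cdot> u = u1 \<cdot> wa" "wd \<cdot> v = v1 \<cdot> wb"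
    and r: "resolution C c a b f g c' a' b' f' g' xc xa xb" "pushout C f' g' S p q"
    "w \<in> hom S d" "w \<cdot> p = u \<cdot> xa" "w \<cdot> q = v \<cdot> xb"
  shows "hpo C f1 g1 u1 v1 \<longleftrightarrow> wd \<cdot> w \<in> Weq C"
proof -
  have s: "f \<in> hom c a" "g \<in> hom c b" "u \<in> hom a d" "v \<in> hom b d"
    "f1 \<in> hom c1 a1" "g1 \<in> hom c1 b1" "u1 \<in> hom a1 d1" "v1 \<in> hom b1 d1"
    using sq sq' by (simp_all add: square_def)
  have x: "f' \<in> hom c' a'" "g' \<in> hom c' b'" "xc \<in> hom c' c" "xa \<in> hom a' a" "xb \<in> hom b' b"
    "xc \<in> Weq C" "xa \<in> Weq C" "xb \<in> Weq C" and ee: "xa \<cdot> f' = f \<cdot> xc" "xb \<cdot> g' = g \<cdot> xc"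
    and y: "cofibrant C c'" "f' \<in> Cof C" "g' \<in> Cof C"
    using r(1) by (simp_all add: resolution_def)
  note D = pushoutD[OF r(2) x(1,2)]
  have ww: "wc \<cdot> xc \<in> Weq C" "wa \<cdot> xa \<in> Weq C" "wb \<cdot> xb \<in> Weq C"
    using two_of_three(1) x wc wa wb by blast+
  have "resolution C c1 a1 b1 f1 g1 c' a' b' f' g' (wc \<cdot> xc) (wa \<cdot> xa) (wb \<cdot> xb)"
    unfolding resolution_def using s(1,2,5,6) x(1-5) y ww wc(1) wa(1) wb(1)
    by (simp add: cs ee e(1,2)[THEN pre])
  moreover have "wd \<cdot> w \<cdot> p = u1 \<cdot> (wa \<cdot> xa)" "wd \<cdot> w \<cdot> q = v1 \<cdot> (wb \<cdot> xb)"
    using wd r(3) D(2,3) s x(4,5) wa wb by (simp_all add: cs r(4,5) e(3,4)[THEN pre])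
  ultimately show ?thesis using hpo_iff[OF sq' _ r(2) comp_in[OF r(3) wd]] by blast
qed

lemma hpo_invariant:
  assumes sq: "square C c a b d f g u v" and sq': "square C c1 a1 b1 d1 f1 g1 u1 v1"
    and wc: "wc \<in> hom c c1" "wc \<in> Weq C" and wa: "wa \<in> hom a a1" "wa \<in> Weq C"
    and wb: "wb \<in> hom b b1" "wb \<in> Weq C" and wd: "wd \<in> hom d d1" "wd \<in> Weq C"
    and e: "wa \<cdot> f = f1 \<cdot> wc" "wb \<cdot> g = g1 \<cdot> wc" "wd \<cdot> u = u1 \<cdot> wa" "wd \<cdot> v = v1 \<cdot> wb"
  shows "hpo C f g u v \<longleftrightarrow> hpo C f1 g1 u1 v1"
proof -
  obtain c' a' b' f' g' xc xa xb S p q w where r: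
    "resolution C c a b f g c' a' b' f' g' xc xa xb" "pushout C f' g' S p q"
    "w \<in> hom S d" "w \<cdot> p = u \<cdot> xa" "w \<cdot> q = v \<cdot> xb" "hpo C f g u v \<longleftrightarrow> w \<in> Weq C"
    using resolve[OF sq] .
  show ?thesis
    using square_resolution[OF sq sq' wc wa wb wd(1) e r(1-5)] r(6) comp_weq_iff(2)[OF r(3) wd] by blast
qed

lemma hpo_compare:
  assumes sq: "square C c a b d f g u v" and sq': "square C c1 a1 b1 d1 f1 g1 u1 v1"
    and wc: "wc \<in> hom c c1" "wc \<in> Weq C" and wa: "wa \<in> hom a a1" "wa \<in> Weq C"
    and wb: "wb \<in> hom b b1" "wb \<in> Weq C" and wd: "wd \<in> hom d d1"
    and e: "wa \<cdot> f = f1 \<cdot> wc" "wb \<cdot> g = g1 \<cdot> wc" "wd \<cdot> u = u1 \<cdot> wa" "wd \<cdot> v = v1 \<cdot> wb"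
    and h: "hpo C f g u v" "hpo C f1 g1 u1 v1"
  shows "wd \<in> Weq C"
proof -
  obtain c' a' b' f' g' xc xa xb S p q w where r:
    "resolution C c a b f g c' a' b' f' g' xc xa xb" "pushout C f' g' S p q"
    "w \<in> hom S d" "w \<cdot> p = u \<cdot> xa" "w \<cdot> q = v \<cdot> xb" "hpo C f g u v \<longleftrightarrow> w \<in> Weq C"
    using resolve[OF sq] .
  show ?thesis
    using square_resolution[OF sq sq' wc wa wb wd(1) e r(1-5)] r(6) h two_of_three(2)[OF r(3) wd] by blast
qed

lemma hpo_weq:
  assumes sq: "square C c a b d f g u v" and f: "f \<in> Weq C"
  shows "hpo C f g u v \<longleftrightarrow> v \<in> Weq C"
proof -
  obtain c' a' b' f' g' xc xa xb S p q w where r: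
    "resolution C c a b f g c' a' b' f' g' xc xa xb" "pushout C f' g' S p q"
    "w \<in> hom S d" "w \<cdot> p = u \<cdot> xa" "w \<cdot> q = v \<cdot> xb" "hpo C f g u v \<longleftrightarrow> w \<in> Weq C"
    using resolve[OF sq] .
  have s: "f \<in> hom c a" "v \<in> hom b d" using sq by (simp_all add: square_def)
  have x: "f' \<in> hom c' a'" "g' \<in> hom c' b'" "xc \<in> hom c' c" "xa \<in> hom a' a" "xb \<in> hom b' b"
    "xc \<in> Weq C" "xa \<in> Weq C" "xb \<in> Weq C" and ee: "xa \<cdot> f' = f \<cdot> xc"
    and y: "f' \<in> Cof C"
    using r(1) by (simp_all add: resolution_def)
  have "f' \<in> Weq C" using two_of_three(3)[OF x(1,4,7)] two_of_three(1)[OF x(3) s(1) x(6) f] ee by simp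
  then have "q \<in> Weq C" using pushout_acof[OF r(2) x(1,2) y] by blast
  then show ?thesis
    using r(5,6) comp_weq_iff(1)[OF pushoutD(3)[OF r(2) x(1,2)] r(3)] comp_weq_iff(1)[OF x(5) s(2) x(8)] by simp
qed

text \<open>Only one leg is a cofibration: replacing the other leg by a cofibration changes the pushout by
  \<open>glue_leg\<close>.\<close>

lemma hpo_pushout:
  assumes P: "pushout C f g S p q" and f: "f \<in> hom c a" "f \<in> Cof C" and g: "g \<in> hom c b"
    and co: "cofibrant C c" "cofibrant C b"
  shows "hpo C f g p q"
proof -
  note D = pushoutD[OF P f(1) g]
  have o: "c \<in> Obj C" "a \<in> Obj C" using f(1) by (simp_all add: Hom_iff)
  obtain b' g' wb where b: "g' \<in> hom c b'" "wb \<in> hom b' b" "g' \<in> Cof C" "wb \<in> Fib C" "wb \<in> Weq C" "wb \<cdot> g' = g"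
    using factor_afib[OF g] .
  obtain S' p' q' where P': "pushout C f g' S' p' q'" using pushout_exists[OF f(1) b(1)] .
  have sq: "square C c a b S f g p q" using D f g by (simp add: square_def)
  have r: "resolution C c a b f g c a b' f g' (Id C c) (Id C a) wb"
    unfolding resolution_def using f g b co o Id_weq by (simp add: cs)
  obtain w where w: "w \<in> hom S' S" "w \<cdot> p' = p \<cdot> Id C a" "w \<cdot> q' = q \<cdot> wb" using resolution_map[OF sq r P'] .
  have "w \<cdot> p' = p" using w(2) D(2) by (simp add: cs)
  then have "w \<in> Weq C"
    using glue_leg[OF P' _ f b(1,2,5) cofibrant_cof[OF co(1) b(1,3)] co(2) w(1) _ w(3)] P b(6) by simp
  then show ?thesis using hpo_iff[OF sq r P' w] by blast
qed

text \<open>A resolution of the first square extends to one of the rectangle, whose pushout is obtained from that of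
  the first square by pasting. This resolves the second square exactly when the first comparison map is a
  weak equivalence.\<close>

lemma hpo_paste:
  assumes h: "hpo C f g u v" and t: "f \<in> hom c a" "g \<in> hom c b" "u \<in> hom a d"
    and sq2: "square C b d e x v k r s"
  shows "hpo C f (k \<cdot> g) (r \<cdot> u) s \<longleftrightarrow> hpo C v k r s"
proof -
  have sq: "square C c a b d f g u v" using hpoD[OF h t] by blast
  have s: "f \<in> hom c a" "g \<in> hom c b" "u \<in> hom a d" "v \<in> hom b d" "k \<in> hom b e" "r \<in> hom d x" "s \<in> hom e x"
    and se: "u \<cdot> f = v \<cdot> g" "r \<cdot> v = s \<cdot> k"
    using sq sq2 by (simp_all add: square_def)
  obtain c' a' b' f' g' wc wa wb S p q w where R:
    "resolution C c a b f g c' a' b' f' g' wc wa wb" "pushout C f' g' S p q"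
    "w \<in> hom S d" "w \<cdot> p = u \<cdot> wa" "w \<cdot> q = v \<cdot> wb" "hpo C f g u v \<longleftrightarrow> w \<in> Weq C"
    using resolve[OF sq] .
  have y: "f' \<in> hom c' a'" "g' \<in> hom c' b'" "wc \<in> hom c' c" "wa \<in> hom a' a" "wb \<in> hom b' b"
    "wc \<in> Weq C" "wa \<in> Weq C" "wb \<in> Weq C" "cofibrant C c'" "f' \<in> Cof C" "g' \<in> Cof C"
    and ye: "wa \<cdot> f' = f \<cdot> wc" "wb \<cdot> g' = g \<cdot> wc"
    using R(1) by (simp_all add: resolution_def)
  have w: "w \<in> Weq C" using R(6) h by blast
  note D = pushoutD[OF R(2) y(1,2)]
  obtain e' k' we where k': "k' \<in> hom b' e'" "we \<in> hom e' e" "k' \<in> Cof C" "we \<in> Fib C" "we \<in> Weq C" "we \<cdot> k' = k \<cdot> wb"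
    using factor_afib[OF comp_in[OF y(5) s(5)]] .
  have qc: "q \<in> Cof C" using pushout_cof[OF R(2) y(1,2,10)] .
  have bc: "cofibrant C b'" using cofibrant_cof[OF y(9,2,11)] .
  obtain T r' s' where T: "pushout C q k' T r' s'" "r' \<in> hom S T" "s' \<in> hom e' T" "r' \<cdot> q = s' \<cdot> k'"
    using pushout_exists[OF D(3) k'(1)] .
  have r2: "resolution C b d e v k b' S e' q k' wb w we"
    unfolding resolution_def using s y k' D qc bc w R(3,5) by simp
  obtain w' where w': "w' \<in> hom T x" "w' \<cdot> r' = r \<cdot> w" "w' \<cdot> s' = s \<cdot> we"
    using resolution_map[OF sq2 r2 T(1)] .
  have 1: "hpo C v k r s \<longleftrightarrow> w' \<in> Weq C" using hpo_iff[OF sq2 r2 T(1) w'] .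
  have sq3: "square C c a e x f (k \<cdot> g) (r \<cdot> u) s"
    unfolding square_def using s by (simp add: cs se(1) se(2)[THEN pre])
  have r3: "resolution C c a e f (k \<cdot> g) c' a' e' f' (k' \<cdot> g') wc wa we"
    unfolding resolution_def using s y(1-11) k'(1-3,5) cof_comp[OF y(2,11) k'(1,3)]
    by (simp add: cs k'(6)[THEN pre] ye)
  have P3: "pushout C f' (k' \<cdot> g') T (r' \<cdot> p) s'" using pushout_paste[OF R(2) T(1) y(1,2) k'(1)] .
  have "w' \<cdot> (r' \<cdot> p) = r \<cdot> u \<cdot> wa"
    using w'(1) T(2) D(2) s(3,6) y(4) R(3) by (simp add: cs w'(2)[THEN pre] R(4))
  then have "hpo C f (k \<cdot> g) (r \<cdot> u) s \<longleftrightarrow> w' \<in> Weq C" using hpo_iff[OF sq3 r3 P3 w'(1) _ w'(3)] by blast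
  with 1 show ?thesis by blast
qed

end

section \<open>Homotopy pullbacks that commute strictly\<close>

lemma square_op [simp]: "square (op C) d a b c u v f g = square C c a b d f g u v"
  by (auto simp: square_def)

context model_category begin

lemma hpbD:
  assumes "hpb C f g u v" "f \<in> hom c a" "g \<in> hom c b" "u \<in> hom a d"
  shows "square C c a b d f g u v" "v \<in> hom b d" "u \<cdot> f = v \<cdot> g"
proof -
  obtain d' a' b' c' where s: "square C c' a' b' d' f g u v"
    using model_category.hpo_square[OF dual assms(1)] by (metis square_op)
  have "c' = c" "a' = a" "b' = b" "d' = d" using s assms(2-) by (simp_all add: square_def Hom_def)
  then show "square C c a b d f g u v" using s by simp
  then show "v \<in> hom b d" "u \<cdot> f = v \<cdot> g" by (simp_all add: square_def)
qed

lemma hpb_sym: "hpb C f g u v \<Longrightarrow> hpb C g f v u"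
  by (rule model_category.hpo_sym[OF dual])

lemma hpb_invariant:
  assumes sq: "square C c a b d f g u v" and sq': "square C c1 a1 b1 d1 f1 g1 u1 v1"
    and wc: "wc \<in> hom c c1" "wc \<in> Weq C" and wa: "wa \<in> hom a a1" "wa \<in> Weq C"
    and wb: "wb \<in> hom b b1" "wb \<in> Weq C" and wd: "wd \<in> hom d d1" "wd \<in> Weq C"
    and e: "wa \<cdot> f = f1 \<cdot> wc" "wb \<cdot> g = g1 \<cdot> wc" "wd \<cdot> u = u1 \<cdot> wa" "wd \<cdot> v = v1 \<cdot> wb"
  shows "hpb C f g u v \<longleftrightarrow> hpb C f1 g1 u1 v1"
  using model_category.hpo_invariant[OF dual, of d1 a1 b1 c1 u1 v1 f1 g1 d a b c u v f g wd wa wb wc]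
    assms by simp

lemma hpb_compare:
  assumes sq: "square C c a b d f g u v" and sq': "square C c1 a1 b1 d1 f1 g1 u1 v1"
    and wc: "wc \<in> hom c c1" and wa: "wa \<in> hom a a1" "wa \<in> Weq C"
    and wb: "wb \<in> hom b b1" "wb \<in> Weq C" and wd: "wd \<in> hom d d1" "wd \<in> Weq C"
    and e: "wa \<cdot> f = f1 \<cdot> wc" "wb \<cdot> g = g1 \<cdot> wc" "wd \<cdot> u = u1 \<cdot> wa" "wd \<cdot> v = v1 \<cdot> wb"
    and h: "hpb C f g u v" "hpb C f1 g1 u1 v1"
  shows "wc \<in> Weq C"
  using model_category.hpo_compare[OF dual, of d1 a1 b1 c1 u1 v1 f1 g1 d a b c u v f g wd wa wb wc]
    assms by simp

lemma hpb_weq: "square C c a b d f g u v \<Longrightarrow> u \<in> Weq C \<Longrightarrow> hpb C f g u v \<longleftrightarrow> g \<in> Weq C"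
  using model_category.hpo_weq[OF dual, of d a b c u v f g] by simp

lemma hpb_paste:
  assumes "hpb C u v f g" "u \<in> hom d a" "v \<in> hom d b" "f \<in> hom a c" "square C x d e b r s v k"
  shows "hpb C (u \<cdot> r) s f (g \<cdot> k) \<longleftrightarrow> hpb C r s v k"
  using model_category.hpo_paste[OF dual, of f g u v c a b d e x k r s] hpbD(2)[OF assms(1-4)] assms by simp

lemmas hpb_pullback = model_category.hpo_pushout[OF dual, unfolded dualize]

text \<open>A strict pullback along a fibration, made cofibrant. The universal property survives for cofibrant
  test objects, without uniqueness.\<close>

lemma hpb_exists:
  assumes f: "f \<in> hom a x" and m: "m \<in> hom b x" "m \<in> Fib C" and fi: "fibrant C a" "fibrant C x"
  obtains P pa pb where "bifibrant C P" "pa \<in> hom P a" "pa \<in> Fib C" "pb \<in> hom P b" "f \<cdot> pa = m \<cdot> pb"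
    "hpb C pa pb f m"
    "\<And>T t s. cofibrant C T \<Longrightarrow> t \<in> hom T a \<Longrightarrow> s \<in> hom T b \<Longrightarrow> f \<cdot> t = m \<cdot> s \<Longrightarrow>
      \<exists>l \<in> hom T P. pa \<cdot> l = t \<and> pb \<cdot> l = s"
proof -
  have o: "a \<in> Obj C" "x \<in> Obj C" "b \<in> Obj C" using f m by (simp_all add: Hom_iff)
  obtain W wb wa where W: "pushout (op C) m f W wb wa" "wb \<in> hom W b" "wa \<in> hom W a" "m \<cdot> wb = f \<cdot> wa"
    using pullback_exists[OF m(1) f] .
  have wf: "wa \<in> Fib C" using pullback_fib[OF W(1) m(1) f m(2)] .
  have h: "hpb C wa wb f m" using hpb_sym[OF hpb_pullback[OF W(1) m f fi(2,1)]] .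
  have oW: "W \<in> Obj C" using W(2) by (simp add: Hom_iff)
  obtain P r where r: "cofibrant C P" "r \<in> hom P W" "r \<in> Fib C" "r \<in> Weq C"
    using cofibrant_replacement[OF oW] .
  have t: "wa \<cdot> r \<in> hom P a" "wb \<cdot> r \<in> hom P b" using comp_in W r by blast+
  have pf: "wa \<cdot> r \<in> Fib C" using fib_comp[OF W(3) wf r(2,3)] .
  have bi: "bifibrant C P" unfolding bifibrant_def using r(1) fibrant_fib[OF fi(1) t(1) pf] by simp
  have sqW: "square C W a b x wa wb f m" using W f m by (simp add: square_def)
  have e: "f \<cdot> (wa \<cdot> r) = m \<cdot> (wb \<cdot> r)" using f m W(2,3) r(2) by (simp add: cs W(4)[THEN pre])
  then have sqP: "square C P a b x (wa \<cdot> r) (wb \<cdot> r) f m" using t f m by (simp add: square_def)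
  have hP: "hpb C (wa \<cdot> r) (wb \<cdot> r) f m"
    using hpb_invariant[OF sqP sqW r(2,4) Id_in_weq[OF o(1)] Id_in_weq[OF o(3)]
      Id_in_weq[OF o(2)]] h t f m by (simp add: cs)
  have l: "\<exists>l \<in> hom T P. (wa \<cdot> r) \<cdot> l = t \<and> (wb \<cdot> r) \<cdot> l = s"
    if T: "cofibrant C T" "t \<in> hom T a" "s \<in> hom T b" "f \<cdot> t = m \<cdot> s" for T t s
  proof -
    obtain y where y: "y \<in> hom T W" "wb \<cdot> y = s" "wa \<cdot> y = t"
      using pullback_univ[OF W(1) m(1) f T(3,2) T(4)[symmetric]] .
    obtain l where l: "l \<in> hom T P" "r \<cdot> l = y" using cofibrant_lift[OF T(1) r(3,4,2) y(1)] .
    then show ?thesis using W(2,3) r(2) y by (intro bexI[of _ l]) (simp_all add: cs)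
  qed
  show ?thesis by (rule that[OF bi t(1) pf t(2) e hP l])
qed

lemmas hpo_exists = model_category.hpb_exists[OF dual, unfolded dualize bifibrant_op]

end

section \<open>Mapping cylinders\<close>

context model_category begin

text \<open>Replacing \<open>g\<close> by its mapping cylinder turns a homotopy commutative square under \<open>f\<close> and \<open>g\<close> into a
  strictly commutative one. The last clause says that the front end of the cylinder and \<open>b\<close> are jointly
  included by a cofibration; it gives homotopy extension.\<close>

lemma mapping_cylinder:
  assumes I: "is_cylinder C c I" and g: "g \<in> hom c b" and co: "cofibrant C c" "cofibrant C b"
    and M: "pushout C (end1 I) g M p q"
  shows "p \<cdot> end0 I \<in> hom c M" "p \<cdot> end0 I \<in> Cof C" "cofibrant C M"
    and "\<exists>w \<in> hom M b. w \<in> Weq C \<and> w \<cdot> q = Id C b \<and> w \<cdot> p = g \<cdot> proj I \<and> w \<cdot> (p \<cdot> end0 I) = g"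
    and "\<And>k e d z0 q0 s. k \<in> hom e d \<Longrightarrow> k \<in> Fib C \<Longrightarrow> k \<in> Weq C \<Longrightarrow> z0 \<in> hom c e \<Longrightarrow> q0 \<in> hom b e \<Longrightarrow>
      s \<in> hom M d \<Longrightarrow> k \<cdot> z0 = s \<cdot> (p \<cdot> end0 I) \<Longrightarrow> k \<cdot> q0 = s \<cdot> q \<Longrightarrow>
      \<exists>l \<in> hom M e. l \<cdot> (p \<cdot> end0 I) = z0 \<and> l \<cdot> q = q0 \<and> k \<cdot> l = s"
proof -
  note Y = cylinderD[OF I] note D = pushoutD[OF M Y(2) g]
  have o: "c \<in> Obj C" "b \<in> Obj C" using g by (simp_all add: Hom_iff)
  show z: "p \<cdot> end0 I \<in> hom c M" using comp_in Y D by blast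
  have qc: "q \<in> Cof C" "q \<in> Weq C"
    using pushout_cof[OF M Y(2) g] pushout_acof[OF M Y(2) g] cylinder_ends[OF I] co by blast+
  show "cofibrant C M" using cofibrant_cof[OF co(2) D(3) qc(1)] .
  have "(g \<cdot> proj I) \<cdot> end1 I = Id C b \<cdot> g" using g Y o by (simp add: cs)
  then obtain w where w: "w \<in> hom M b" "w \<cdot> p = g \<cdot> proj I" "w \<cdot> q = Id C b"
    using pushout_univ[OF M Y(2) g comp_in[OF Y(3) g] Id_in[OF o(2)]] by metis
  have "w \<in> Weq C" using weq_section[OF D(3) w(1,3)] qc by blast
  moreover have "w \<cdot> (p \<cdot> end0 I) = g" using w(1) D(2) Y g by (simp add: cs w(2)[THEN pre])
  ultimately show "\<exists>w \<in> hom M b. w \<in> Weq C \<and> w \<cdot> q = Id C b \<and> w \<cdot> p = g \<cdot> proj I \<and> w \<cdot> (p \<cdot> end0 I) = g"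
    using w by blast
  show L: "\<exists>l \<in> hom M e. l \<cdot> (p \<cdot> end0 I) = z0 \<and> l \<cdot> q = q0 \<and> k \<cdot> l = s"
    if k: "k \<in> hom e d" "k \<in> Fib C" "k \<in> Weq C" "z0 \<in> hom c e" "q0 \<in> hom b e" "s \<in> hom M d"
      "k \<cdot> z0 = s \<cdot> (p \<cdot> end0 I)" "k \<cdot> q0 = s \<cdot> q" for k e d z0 q0 s
  proof -
    have "k \<cdot> z0 = (s \<cdot> p) \<cdot> end0 I" "k \<cdot> (q0 \<cdot> g) = (s \<cdot> p) \<cdot> end1 I"
      using k(1,4-6) D(2,3) Y(1,2) g by (simp_all add: cs k(7) k(8)[THEN pre] D(4))
    then obtain h where h: "h \<in> hom (cyl I) e" "h \<cdot> end0 I = z0" "h \<cdot> end1 I = q0 \<cdot> g" "k \<cdot> h = s \<cdot> p"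
      using cylinder_lift[OF I k(1-4) comp_in[OF g k(5)] comp_in[OF D(2) k(6)]] by metis
    obtain l where l: "l \<in> hom M e" "l \<cdot> p = h" "l \<cdot> q = q0"
      using pushout_univ[OF M Y(2) g h(1) k(5) h(3)] .
    have "k \<cdot> l = s"
      by (rule pushout_eq[OF M comp_in[OF l(1) k(1)] k(6)])
        (use l(1) k(1,6) D(2,3) in \<open>simp_all add: cs l(2,3) h(4) k(8)\<close>)
    moreover have "l \<cdot> (p \<cdot> end0 I) = z0" using l(1) D(2) Y(1) by (simp add: cs l(2)[THEN pre] h(2))
    ultimately show ?thesis using l by blast
  qed
  show "p \<cdot> end0 I \<in> Cof C"
  proof (rule cof_by_lifting[OF z])
    fix k e d t s
    assume k: "k \<in> hom e d" "k \<in> Fib C" "k \<in> Weq C" "t \<in> hom c e" "s \<in> hom M d" "k \<cdot> t = s \<cdot> (p \<cdot> end0 I)"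
    obtain q0 where "q0 \<in> hom b e" "k \<cdot> q0 = s \<cdot> q"
      using cofibrant_lift[OF co(2) k(2,3,1) comp_in[OF D(3) k(5)]] .
    then show "\<exists>l\<in>hom M e. l \<cdot> (p \<cdot> end0 I) = t \<and> k \<cdot> l = s" using L[OF k(1-4) _ k(5,6)] by blast
  qed
qed

text \<open>The double mapping cylinder is the strict pushout of \<open>f\<close> and the inclusion of \<open>c\<close> into the mapping
  cylinder of \<open>g\<close>.\<close>

lemma dmc_from_pushout:
  assumes I: "is_cylinder C c I" and f: "f \<in> hom c a" and g: "g \<in> hom c b"
    and M: "pushout C (end1 I) g M p q" and P: "pushout C f (p \<cdot> end0 I) D x m"
  shows "double_mapping_cylinder C f g I D x (m \<cdot> p) (m \<cdot> q)"
proof -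
  note Y = cylinderD[OF I] note E = pushoutD[OF M Y(2) g]
  have z: "p \<cdot> end0 I \<in> hom c M" using comp_in Y E by blast
  note F = pushoutD[OF P f z]
  have ab: "Cod C f = a" "Cod C g = b" using f g by (simp_all add: Hom_iff)
  show ?thesis
    unfolding double_mapping_cylinder_def
  proof (intro conjI allI impI)
    show "dmc_cocone C f g I D x (m \<cdot> p) (m \<cdot> q)"
      unfolding dmc_cocone_def ab using E F Y(1,2) g f comp_in[OF E(2) F(3)] comp_in[OF E(3) F(3)]
      by (simp add: cs)
    fix X u h v assume "dmc_cocone C f g I X u h v"
    then have c: "u \<in> hom a X" "h \<in> hom (cyl I) X" "v \<in> hom b X" "h \<cdot> end0 I = u \<cdot> f" "h \<cdot> end1 I = v \<cdot> g"
      by (simp_all add: dmc_cocone_def ab)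
    obtain y where y: "y \<in> hom M X" "y \<cdot> p = h" "y \<cdot> q = v" using pushout_univ[OF M Y(2) g c(2,3,5)] .
    have "u \<cdot> f = y \<cdot> (p \<cdot> end0 I)" using y(1) E(2) Y(1) by (simp add: cs y(2)[THEN pre] c(4))
    then obtain e where e: "e \<in> hom D X" "e \<cdot> x = u" "e \<cdot> m = y" using pushout_univ[OF P f z c(1) y(1)] by metis
    show "\<exists>!e. dmc_map C D x (m \<cdot> p) (m \<cdot> q) X u h v e"
    proof (rule ex1I[of _ e])
      show "dmc_map C D x (m \<cdot> p) (m \<cdot> q) X u h v e"
        unfolding dmc_map_def using e(1) F(3) E(2,3) by (simp add: cs e(2) e(3)[THEN pre] y)
      fix e' assume "dmc_map C D x (m \<cdot> p) (m \<cdot> q) X u h v e'"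
      then have e': "e' \<in> hom D X" "e' \<cdot> x = u" "e' \<cdot> (m \<cdot> p) = h" "e' \<cdot> (m \<cdot> q) = v"
        by (simp_all add: dmc_map_def)
      show "e' = e"
      proof (rule pushout_eq[OF P e'(1) e(1)])
        show "e' \<cdot> x = e \<cdot> x" using e e' by simp
        have "e' \<cdot> m = y"
          by (rule pushout_eq[OF M comp_in[OF F(3) e'(1)] y(1)])
            (use e'(1) F(3) E(2,3) in \<open>simp_all add: cs e'(3,4) y(2,3)\<close>)
        then show "e' \<cdot> m = e \<cdot> m" using e by simp
      qed
    qed
  qed
qed

lemma dmc_univ:
  assumes "double_mapping_cylinder C f g I D x t y" "dmc_cocone C f g I X u h v"
  obtains e where "dmc_map C D x t y X u h v e"
proof -
  have "\<exists>!e. dmc_map C D x t y X u h v e" using assms by (simp add: double_mapping_cylinder_def)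
  then show ?thesis using that by (elim ex1E)
qed

lemma dmc_cocone_eq:
  assumes "double_mapping_cylinder C f g I D x t y" "e \<in> hom D X" "e' \<in> hom D X"
    "e \<cdot> x = e' \<cdot> x" "e \<cdot> t = e' \<cdot> t" "e \<cdot> y = e' \<cdot> y" "is_cylinder C c I" "f \<in> hom c a" "g \<in> hom c b"
  shows "e = e'"
proof -
  have ab: "Cod C f = a" "Cod C g = b" using assms(8,9) by (simp_all add: Hom_iff)
  note Y = cylinderD[OF assms(7)]
  have c: "x \<in> hom a D" "t \<in> hom (cyl I) D" "y \<in> hom b D" "t \<cdot> end0 I = x \<cdot> f" "t \<cdot> end1 I = y \<cdot> g"
    using assms(1) by (simp_all add: double_mapping_cylinder_def dmc_cocone_def ab)
  have "dmc_cocone C f g I X (e \<cdot> x) (e \<cdot> t) (e \<cdot> y)"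
    unfolding dmc_cocone_def ab using assms(2,8,9) c(1-3) Y(1,2) by (simp add: cs c(4,5))
  then have "\<exists>!d. dmc_map C D x t y X (e \<cdot> x) (e \<cdot> t) (e \<cdot> y) d"
    using assms(1) by (simp add: double_mapping_cylinder_def)
  moreover have "dmc_map C D x t y X (e \<cdot> x) (e \<cdot> t) (e \<cdot> y) e" "dmc_map C D x t y X (e \<cdot> x) (e \<cdot> t) (e \<cdot> y) e'"
    using assms by (simp_all add: dmc_map_def)
  ultimately show ?thesis by (elim ex1E) metis
qed

lemma dmc_is_pushout:
  assumes I: "is_cylinder C c I" and f: "f \<in> hom c a" and g: "g \<in> hom c b"
    and M: "pushout C (end1 I) g M p q" and D: "double_mapping_cylinder C f g I D x t y"
  obtains m where "m \<in> hom M D" "m \<cdot> p = t" "m \<cdot> q = y" "pushout C f (p \<cdot> end0 I) D x m"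
proof -
  note Y = cylinderD[OF I] note E = pushoutD[OF M Y(2) g]
  have z: "p \<cdot> end0 I \<in> hom c M" using comp_in Y E by blast
  have ab: "Cod C f = a" "Cod C g = b" using f g by (simp_all add: Hom_iff)
  have c: "x \<in> hom a D" "t \<in> hom (cyl I) D" "y \<in> hom b D" "t \<cdot> end0 I = x \<cdot> f" "t \<cdot> end1 I = y \<cdot> g"
    using D by (simp_all add: double_mapping_cylinder_def dmc_cocone_def ab)
  obtain m where m: "m \<in> hom M D" "m \<cdot> p = t" "m \<cdot> q = y" using pushout_univ[OF M Y(2) g c(2,3,5)] .
  have "pushout C f (p \<cdot> end0 I) D x m"
  proof (rule pushoutI[OF f z c(1) m(1)])
    show "x \<cdot> f = m \<cdot> (p \<cdot> end0 I)" using m(1) E(2) Y(1) by (simp add: cs m(2)[THEN pre] c(4))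
  next
    fix X u k assume k: "u \<in> hom a X" "k \<in> hom M X" "u \<cdot> f = k \<cdot> (p \<cdot> end0 I)"
    have "dmc_cocone C f g I X u (k \<cdot> p) (k \<cdot> q)"
      unfolding dmc_cocone_def ab using k(1,2) E(2,3) Y(1,2) f g by (simp add: cs k(3) E(4))
    then obtain e where "dmc_map C D x t y X u (k \<cdot> p) (k \<cdot> q) e"
      using dmc_univ[OF D] by metis
    then have e: "e \<in> hom D X" "e \<cdot> x = u" "e \<cdot> t = k \<cdot> p" "e \<cdot> y = k \<cdot> q" by (simp_all add: dmc_map_def)
    have "e \<cdot> m = k"
      by (rule pushout_eq[OF M comp_in[OF m(1) e(1)] k(2)])
        (use e(1) m(1) E(2,3) in \<open>simp_all add: cs m(2,3) e(3,4)\<close>)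
    then show "\<exists>e\<in>hom D X. e \<cdot> x = u \<and> e \<cdot> m = k" using e by blast
  next
    fix X e e' assume e: "e \<in> hom D X" "e' \<in> hom D X" "e \<cdot> x = e' \<cdot> x" "e \<cdot> m = e' \<cdot> m"
    have "e \<cdot> t = e' \<cdot> t" "e \<cdot> y = e' \<cdot> y"
      unfolding m(2,3)[symmetric] using e(1,2) m(1) E(2,3) by (simp_all add: assoc[symmetric] Hom_iff e(4))
    then show "e = e'" using dmc_cocone_eq[OF D e(1-3) _ _ I f g] by blast
  qed
  then show ?thesis using that m by blast
qed

lemma hpo_pushout_iff:
  assumes P: "pushout C f z D x m" and f: "f \<in> hom c a" and z: "z \<in> hom c b" "z \<in> Cof C"
    and co: "cofibrant C c" "cofibrant C a" and e: "e \<in> hom D d"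
  shows "hpo C f z (e \<cdot> x) (e \<cdot> m) \<longleftrightarrow> e \<in> Weq C"
proof -
  note E = pushoutD[OF P f z(1)]
  have o: "c \<in> Obj C" "a \<in> Obj C" "b \<in> Obj C" using f z by (simp_all add: Hom_iff)
  have h: "hpo C f z x m" using hpo_sym[OF hpo_pushout[OF pushout_sym[OF P] z f co]] .
  have sq: "square C c a b D f z x m" using E f z by (simp add: square_def)
  have sq': "square C c a b d f z (e \<cdot> x) (e \<cdot> m)"
    unfolding square_def using E(2,3) f z(1) e by (simp add: cs E(4))
  have eq: "Id C a \<cdot> f = f \<cdot> Id C c" "Id C b \<cdot> z = z \<cdot> Id C c" "e \<cdot> x = (e \<cdot> x) \<cdot> Id C a" "e \<cdot> m = (e \<cdot> m) \<cdot> Id C b"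
    using f z(1) e E(2,3) by (simp_all add: cs)
  show ?thesis
    using hpo_compare[OF sq sq' Id_in_weq[OF o(1)] Id_in_weq[OF o(2)] Id_in_weq[OF o(3)] e eq h]
      hpo_invariant[OF sq sq' Id_in_weq[OF o(1)] Id_in_weq[OF o(2)] Id_in_weq[OF o(3)] e _ eq] h
    by blast
qed

text \<open>The bridge between homotopy commutative squares with a chosen homotopy and strictly commuting squares:
  the homotopy and \<open>v\<close> together form the map \<open>y\<close> out of the mapping cylinder.\<close>

lemma comparison_iff:
  assumes I: "is_cylinder C c H" and f: "f \<in> hom c a" and g: "g \<in> hom c b" and u: "u \<in> hom a d"
    and co: "cofibrant C c" "cofibrant C a" "cofibrant C b"
    and M: "pushout C (end1 H) g M p q" and y: "y \<in> hom M d" "y \<cdot> p = hmap H" "y \<cdot> q = v"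
    and e: "hmap H \<cdot> end0 H = u \<cdot> f"
  shows "dmc_comparison_weq C f g u v H \<longleftrightarrow> hpo C f (p \<cdot> end0 H) u y"
proof -
  note Y = cylinderD[OF I] note E = pushoutD[OF M Y(2) g] note MC = mapping_cylinder[OF I g co(1,3) M]
  have cu: "Cod C u = d" using u by (simp add: Hom_iff)
  have *: "\<exists>e \<in> hom D d. e \<cdot> x = u \<and> e \<cdot> m = y \<and> (e \<in> Weq C \<longleftrightarrow> hpo C f (p \<cdot> end0 H) u y)"
    if P: "pushout C f (p \<cdot> end0 H) D x m" for D x m
  proof -
    have "u \<cdot> f = y \<cdot> (p \<cdot> end0 H)" using y(1) E(2) Y(1) by (simp add: cs y(2)[THEN pre] e)
    then obtain k where k: "k \<in> hom D d" "k \<cdot> x = u" "k \<cdot> m = y"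
      using pushout_univ[OF P f MC(1) u y(1)] by metis
    show ?thesis using hpo_pushout_iff[OF P f MC(1,2) co(1,2) k(1)] k by metis
  qed
  show ?thesis
  proof
    assume "dmc_comparison_weq C f g u v H"
    then obtain D x t b' k where D: "double_mapping_cylinder C f g H D x t b'"
      and k: "dmc_map C D x t b' d u (hmap H) v k" "k \<in> Weq C"
      unfolding dmc_comparison_weq_def cu by blast
    obtain m where m: "m \<in> hom M D" "m \<cdot> p = t" "m \<cdot> q = b'" "pushout C f (p \<cdot> end0 H) D x m"
      using dmc_is_pushout[OF I f g M D] .
    obtain k' where k': "k' \<in> hom D d" "k' \<cdot> x = u" "k' \<cdot> m = y" "k' \<in> Weq C \<longleftrightarrow> hpo C f (p \<cdot> end0 H) u y"
      using *[OF m(4)] by blast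
    have kk: "k \<in> hom D d" "k \<cdot> x = u" "k \<cdot> t = hmap H" "k \<cdot> b' = v" using k(1) by (simp_all add: dmc_map_def)
    have "k' \<cdot> t = hmap H" "k' \<cdot> b' = v"
      unfolding m(2,3)[symmetric] using k'(1) m(1) E(2,3) by (simp_all add: k'(3)[THEN pre] y(2,3) cs)
    then have "k = k'" using dmc_cocone_eq[OF D kk(1) k'(1) _ _ _ I f g] kk k' by simp
    then show "hpo C f (p \<cdot> end0 H) u y" using k' k by simp
  next
    assume h: "hpo C f (p \<cdot> end0 H) u y"
    obtain D x m where P: "pushout C f (p \<cdot> end0 H) D x m" using pushout_exists[OF f MC(1)] .
    obtain k' where k': "k' \<in> hom D d" "k' \<cdot> x = u" "k' \<cdot> m = y" "k' \<in> Weq C \<longleftrightarrow> hpo C f (p \<cdot> end0 H) u y"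
      using *[OF P] by blast
    have "dmc_map C D x (m \<cdot> p) (m \<cdot> q) d u (hmap H) v k'"
      unfolding dmc_map_def using k'(1,2) pushoutD(3)[OF P f MC(1)] E(2,3)
      by (simp add: cs k'(3)[THEN pre] y(2,3))
    then show "dmc_comparison_weq C f g u v H"
      unfolding dmc_comparison_weq_def cu using dmc_from_pushout[OF I f g M P] k'(4) h by blast
  qed
qed

end

section \<open>Rectifying homotopy pushouts and homotopy pullbacks\<close>

context model_category begin

lemma bifibrantD: "bifibrant C a \<Longrightarrow> cofibrant C a" "bifibrant C a \<Longrightarrow> fibrant C a" "bifibrant C a \<Longrightarrow> a \<in> Obj C"
  using cofibrant_obj by (auto simp: bifibrant_def)

lemma hsquareD:
  assumes "hsquare C f g u v H" "f \<in> hom c a" "g \<in> hom c b" "u \<in> hom a d"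
  shows "v \<in> hom b d" "bifibrant C c" "bifibrant C a" "bifibrant C b" "bifibrant C d"
    "left_homotopy C H (u \<cdot> f) (v \<cdot> g)" "is_cylinder C c H" "hmap H \<in> hom (cyl H) d"
    "hmap H \<cdot> end0 H = u \<cdot> f" "hmap H \<cdot> end1 H = v \<cdot> g"
proof -
  obtain c' a' b' d' where o: "bifibrant C c'" "bifibrant C a'" "bifibrant C b'" "bifibrant C d'"
    "f \<in> hom c' a'" "g \<in> hom c' b'" "u \<in> hom a' d'" "v \<in> hom b' d'"
    and H: "left_homotopy C H (u \<cdot> f) (v \<cdot> g)"
    using assms(1) unfolding hsquare_def by blast
  have "c' = c" "a' = a" "b' = b" "d' = d" using o assms(2-) by (simp_all add: Hom_def)
  with o H show "v \<in> hom b d" "bifibrant C c" "bifibrant C a" "bifibrant C b" "bifibrant C d"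
    "left_homotopy C H (u \<cdot> f) (v \<cdot> g)" by simp_all
  show "is_cylinder C c H" "hmap H \<in> hom (cyl H) d"
    "hmap H \<cdot> end0 H = u \<cdot> f" "hmap H \<cdot> end1 H = v \<cdot> g"
    using left_homotopyD[OF H comp_in[OF assms(2,4)]] by simp_all
qed

lemma hsquareI:
  assumes "bifibrant C c" "bifibrant C a" "bifibrant C b" "bifibrant C d"
    "f \<in> hom c a" "g \<in> hom c b" "u \<in> hom a d" "v \<in> hom b d" "left_homotopy C H (u \<cdot> f) (v \<cdot> g)"
  shows "hsquare C f g u v H"
  using assms unfolding hsquare_def by blast

lemma hpushoutE:
  assumes h: "hpushout C f g u v H" and f: "f \<in> hom c a" and g: "g \<in> hom c b" and u: "u \<in> hom a d"
  obtains M z y w q where "cofibrant C M" "z \<in> hom c M" "z \<in> Cof C" "y \<in> hom M d" "w \<in> hom M b" "w \<in> Weq C"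
    "w \<cdot> z = g" "q \<in> hom b M" "w \<cdot> q = Id C b" "y \<cdot> q = v" "hpo C f z u y"
proof -
  have hs: "hsquare C f g u v H" and dw: "dmc_comparison_weq C f g u v H"
    using h by (simp_all add: hpushout_def)
  note S = hsquareD[OF hs f g u]
  note co = bifibrantD(1)[OF S(2)] bifibrantD(1)[OF S(3)] bifibrantD(1)[OF S(4)]
  note Y = cylinderD[OF S(7)]
  obtain M p q where M: "pushout C (end1 H) g M p q" "p \<in> hom (cyl H) M" "q \<in> hom b M"
    using pushout_exists[OF Y(2) g] by metis
  note MC = mapping_cylinder[OF S(7) g co(1,3) M(1)]
  obtain w where w: "w \<in> hom M b" "w \<in> Weq C" "w \<cdot> q = Id C b" "w \<cdot> (p \<cdot> end0 H) = g" using MC(4) by blast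
  obtain y where y: "y \<in> hom M d" "y \<cdot> p = hmap H" "y \<cdot> q = v"
    using pushout_univ[OF M(1) Y(2) g S(8,1,10)] .
  have "hpo C f (p \<cdot> end0 H) u y" using comparison_iff[OF S(7) f g u co M(1) y S(9)] dw by blast
  then show ?thesis using that[OF MC(3,1,2) y(1) w(1,2,4) M(3) w(3) y(3)] by blast
qed

lemma hpullback_op:
  assumes h: "hpullback C f g u v H" and f: "f \<in> hom c a" and g: "g \<in> hom c b" and u: "u \<in> hom a d"
  obtains K where "hpushout (op C) u v f g K" "corresponds C (u \<cdot> f) (v \<cdot> g) H K"
proof -
  have hs: "hsquare C f g u v H" using h by (simp add: hpullback_def)
  obtain K where K: "corresponds C (u \<cdot> f) (v \<cdot> g) H K" "dmc_comparison_weq (op C) u v f g K"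
    using h by (auto simp: hpullback_def)
  note S = hsquareD[OF hs f g u]
  have "hsquare (op C) u v f g K"
    using model_category.hsquareI[OF dual, of d a b c u v f g K] S f g u K(1) by (simp add: corresponds_def)
  then show ?thesis using that K by (simp add: hpushout_def)
qed

lemma hpullbackE:
  assumes h: "hpullback C f g u v H" and f: "f \<in> hom c a" and g: "g \<in> hom c b" and u: "u \<in> hom a d"
  obtains M z y w q where "fibrant C M" "z \<in> hom M d" "z \<in> Fib C" "y \<in> hom c M" "w \<in> hom b M" "w \<in> Weq C"
    "z \<cdot> w = v" "q \<in> hom M b" "q \<cdot> w = Id C b" "q \<cdot> y = g" "hpb C f y u z"
proof -
  obtain K where K: "hpushout (op C) u v f g K" using hpullback_op[OF assms] .
  have hs: "hsquare C f g u v H" using h by (simp add: hpullback_def)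
  note S = hsquareD[OF hs f g u]
  show ?thesis
    using model_category.hpushoutE[OF dual K, of d a b c] f u S(1) that by (simp add: dualize) metis
qed

end

definition const_htpy :: "('o, 'm) mcat \<Rightarrow> ('o, 'm) htpy \<Rightarrow> 'm \<Rightarrow> ('o, 'm) htpy" where
  "const_htpy C I m = I\<lparr>hmap := comp C m (proj I)\<rparr>"

lemma const_htpy_simps [simp]:
  "cyl (const_htpy C I m) = cyl I" "end0 (const_htpy C I m) = end0 I" "end1 (const_htpy C I m) = end1 I"
  "proj (const_htpy C I m) = proj I" "hmap (const_htpy C I m) = comp C m (proj I)"
  by (simp_all add: const_htpy_def)

context model_category begin

lemma const_cylinder [simp]: "is_cylinder C a (const_htpy C' I m) = is_cylinder C a I"
  by (simp add: const_htpy_def)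

lemma const_left_homotopy:
  assumes "m \<in> hom c x" "is_cylinder C c I"
  shows "left_homotopy C (const_htpy C I m) m m"
  by (rule left_homotopyI[of c _ x]) (use assms cylinderD[OF assms(2)] in \<open>simp_all add: cs\<close>)

lemma const_corresponds:
  assumes m: "m \<in> hom c x" and I: "is_cylinder C c I" and J: "is_cylinder (op C) x J"
  shows "corresponds C m m (const_htpy C I m) (const_htpy (op C) J m)"
proof -
  note Y = cylinderD[OF I] note P = pathD[OF J]
  have r: "right_homotopy C (const_htpy (op C) J m) m m"
    using model_category.const_left_homotopy[OF dual, of m x c J] m J by simp
  show ?thesis
    unfolding corresponds_def
    by (intro conjI const_left_homotopy[OF m I] r bexI[of _ "proj J \<cdot> (m \<cdot> proj I)"])
      (use m Y P in \<open>simp_all add: cs P(5,6)[THEN pre]\<close>)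
qed

text \<open>For a strictly commuting square the mapping cylinder can be collapsed again.\<close>

lemma hpushout_const_iff:
  assumes sq: "square C c a b d f g u v" and I: "is_cylinder C c I"
    and bi: "bifibrant C c" "bifibrant C a" "bifibrant C b" "bifibrant C d"
  shows "hpushout C f g u v (const_htpy C I (u \<cdot> f)) \<longleftrightarrow> hpo C f g u v"
proof -
  have s: "f \<in> hom c a" "g \<in> hom c b" "u \<in> hom a d" "v \<in> hom b d" "u \<cdot> f = v \<cdot> g"
    using sq by (simp_all add: square_def)
  note o = bifibrantD(3)[OF bi(1)] bifibrantD(3)[OF bi(2)] bifibrantD(3)[OF bi(4)]
  note Y = cylinderD[OF I] and co = bifibrantD(1)[OF bi(1)] bifibrantD(1)[OF bi(2)] bifibrantD(1)[OF bi(3)]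
  have hs: "hsquare C f g u v (const_htpy C I (u \<cdot> f))"
    using hsquareI[OF bi s(1-4)] const_left_homotopy[OF comp_in[OF s(1,3)] I] s(5) by simp
  have Y1: "end1 (const_htpy C I (u \<cdot> f)) \<in> hom c (cyl I)" using Y(2) by simp
  obtain M p q where M: "pushout C (end1 I) g M p q" "p \<in> hom (cyl I) M" "q \<in> hom b M"
    using pushout_exists[OF Y(2) s(2)] by metis
  note MC = mapping_cylinder[OF I s(2) co(1,3) M(1)]
  obtain w where w: "w \<in> hom M b" "w \<in> Weq C" "w \<cdot> q = Id C b" "w \<cdot> p = g \<cdot> proj I" "w \<cdot> (p \<cdot> end0 I) = g"
    using MC(4) by blast
  have y: "v \<cdot> w \<in> hom M d" "(v \<cdot> w) \<cdot> p = (u \<cdot> f) \<cdot> proj I" "(v \<cdot> w) \<cdot> q = v"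
    using comp_in[OF w(1) s(4)] s(1-4) w(1) M(2,3) Y by (simp_all add: cs w(3,4) s(5)[THEN pre])
  have sq': "square C c a M d f (p \<cdot> end0 I) u (v \<cdot> w)"
    unfolding square_def using s(1-4) MC(1) y(1) w(1) M(2) Y(1)
    by (simp add: cs w(5) s(5))
  have "dmc_comparison_weq C f g u v (const_htpy C I (u \<cdot> f)) \<longleftrightarrow> hpo C f (p \<cdot> end0 I) u (v \<cdot> w)"
    using comparison_iff[of c "const_htpy C I (u \<cdot> f)" f a g b u d M p q "v \<cdot> w" v] I s(1-3) co M(1) y Y
    by (simp add: cs)
  also have "\<dots> \<longleftrightarrow> hpo C f g u v"
    using hpo_invariant[OF sq' sq Id_in_weq[OF o(1)] Id_in_weq[OF o(2)] w(1,2) Id_in_weq[OF o(3)]]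
      s(1-4) w(1) M(2) Y(1) by (simp add: cs w(5))
  finally show ?thesis using hs by (simp add: hpushout_def)
qed

lemma hpullback_const:
  assumes sq: "square C c a b d f g u v" and I: "is_cylinder C c I"
    and bi: "bifibrant C c" "bifibrant C a" "bifibrant C b" "bifibrant C d" and h: "hpb C f g u v"
  shows "hpullback C f g u v (const_htpy C I (u \<cdot> f))"
proof -
  have s: "f \<in> hom c a" "g \<in> hom c b" "u \<in> hom a d" "v \<in> hom b d" "u \<cdot> f = v \<cdot> g"
    using sq by (simp_all add: square_def)
  have uf: "u \<cdot> f \<in> hom c d" using comp_in s by blast
  obtain J :: "('o,'m) htpy" where J: "is_cylinder (op C) d J" using path_exists bifibrantD(3)[OF bi(4)] by metis
  have "hpushout (op C) u v f g (const_htpy (op C) J (u \<cdot> f))"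
    using model_category.hpushout_const_iff[OF dual, of d a b c u v f g J] sq J bi h by simp
  moreover have "hsquare C f g u v (const_htpy C I (u \<cdot> f))"
    using hsquareI[OF bi s(1-4)] const_left_homotopy[OF uf I] s(5) by simp
  moreover have "corresponds C (u \<cdot> f) (v \<cdot> g) (const_htpy C I (u \<cdot> f)) (const_htpy (op C) J (u \<cdot> f))"
    using const_corresponds[OF uf I J] s(5) by simp
  ultimately show ?thesis by (auto simp: hpullback_def hpushout_def)
qed

section \<open>The Cube axiom for strictly commuting cubes\<close>

lemma const_postcomp:
  assumes "m \<in> hom c x" "w \<in> hom x y" "is_cylinder C c I"
  shows "postcomp C w (const_htpy C I m) = const_htpy C I (w \<cdot> m)"
  using assms cylinderD[OF assms(3)] by (simp add: postcomp_def const_htpy_def cs)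

lemma const_precomp:
  assumes m: "m \<in> hom b x" and w: "w \<in> hom c b" and I: "is_cylinder C b I" and I': "is_cylinder C c I'"
  shows "precomp C m m (const_htpy C I m) w (const_htpy C I' (m \<cdot> w))"
proof -
  have "x \<in> Obj C" using m by (simp add: Hom_iff)
  then obtain J :: "('o,'m) htpy" where J: "is_cylinder (op C) x J" using path_exists by metis
  have "(const_htpy (op C) J m)\<lparr>hmap := hmap (const_htpy (op C) J m) \<cdot> w\<rparr> = const_htpy (op C) J (m \<cdot> w)"
    using m w pathD(3)[OF J] by (simp add: const_htpy_def cs)
  then show ?thesis
    unfolding precomp_def
    using const_corresponds[OF m I J] const_corresponds[OF comp_in[OF w m] I' J] by metis
qed

lemma const_same_class:
  assumes m: "m \<in> hom c x" and "is_cylinder C c I" "is_cylinder C c I'"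
  shows "same_class C m m (const_htpy C I m) (const_htpy C I' m)"
proof -
  have "x \<in> Obj C" using m by (simp add: Hom_iff)
  then obtain J :: "('o,'m) htpy" where J: "is_cylinder (op C) x J" using path_exists by metis
  show ?thesis unfolding same_class_def using const_corresponds[OF m _ J] assms by blast
qed

text \<open>The glued cylinder is a cylinder because a lift can first be chosen on the middle copy of the cofibrant
  object \<open>c\<close>.\<close>

lemma const_concat:
  assumes m: "m \<in> hom c x" and c: "cofibrant C c" and I: "is_cylinder C c I" and I': "is_cylinder C c I'"
  obtains K where "is_cylinder C c K" "concat C (const_htpy C I m) (const_htpy C I' m) (const_htpy C K m)"
proof -
  note Y = cylinderD[OF I] and Y' = cylinderD[OF I']
  obtain S p q where S: "pushout C (end1 I) (end0 I') S p q" "p \<in> hom (cyl I) S" "q \<in> hom (cyl I') S"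
    "p \<cdot> end1 I = q \<cdot> end0 I'"
    using pushout_exists[OF Y(2) Y'(1)] .
  obtain r where r: "r \<in> hom S c" "r \<cdot> p = proj I" "r \<cdot> q = proj I'"
    using pushout_univ[OF S(1) Y(2) Y'(1) Y(3) Y'(3)] Y(6) Y'(5) by metis
  have qw: "q \<in> Weq C" using pushout_acof[OF S(1) Y(2) Y'(1)] cylinder_ends[OF I] c by blast
  have rw: "r \<in> Weq C" using two_of_three(2)[OF S(3) r(1) qw] r(3) Y'(4) by simp
  let ?K = "\<lparr>cyl = S, end0 = p \<cdot> end0 I, end1 = q \<cdot> end1 I', proj = r, hmap = r\<rparr>"
  have K: "is_cylinder C c ?K"
  proof (rule cylinder_by_lifting)
    show "end0 ?K \<in> hom c (cyl ?K)" "end1 ?K \<in> hom c (cyl ?K)" "proj ?K \<in> hom (cyl ?K) c" "proj ?K \<in> Weq C"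
      using comp_in[OF Y(1) S(2)] comp_in[OF Y'(2) S(3)] r rw by simp_all
    show "proj ?K \<cdot> end0 ?K = Id C c" "proj ?K \<cdot> end1 ?K = Id C c"
      using r(1) S(2,3) Y Y' by (simp_all add: r(2,3)[THEN pre])
        (simp_all add: cs r(2,3)[THEN pre])
    fix k e d f0 f1 g
    assume k: "k \<in> hom e d" "k \<in> Fib C" "k \<in> Weq C" "f0 \<in> hom c e" "f1 \<in> hom c e" "g \<in> hom (cyl ?K) d"
      "k \<cdot> f0 = g \<cdot> end0 ?K" "k \<cdot> f1 = g \<cdot> end1 ?K"
    have g: "g \<in> hom S d" using k(6) by simp
    have gp: "g \<cdot> p \<in> hom (cyl I) d" "g \<cdot> q \<in> hom (cyl I') d" using comp_in S g by blast+
    obtain fm where fm: "fm \<in> hom c e" "k \<cdot> fm = (g \<cdot> p) \<cdot> end1 I"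
      using cofibrant_lift[OF c k(2,3,1) comp_in[OF Y(2) gp(1)]] .
    have fm': "k \<cdot> fm = (g \<cdot> q) \<cdot> end0 I'" unfolding fm(2) using g S(2,3) Y(2) Y'(1) by (simp add: cs S(4))
    have "k \<cdot> f0 = (g \<cdot> p) \<cdot> end0 I" "k \<cdot> f1 = (g \<cdot> q) \<cdot> end1 I'"
      unfolding k(7,8) using g S(2,3) Y(1) Y'(2) by (simp_all add: cs)
    then obtain l l' where l: "l \<in> hom (cyl I) e" "l \<cdot> end0 I = f0" "l \<cdot> end1 I = fm" "k \<cdot> l = g \<cdot> p"
      and l': "l' \<in> hom (cyl I') e" "l' \<cdot> end0 I' = fm" "l' \<cdot> end1 I' = f1" "k \<cdot> l' = g \<cdot> q"
      using cylinder_lift[OF I k(1-4) fm(1) gp(1) _ fm(2)] cylinder_lift[OF I' k(1-3) fm(1) k(5) gp(2) fm'] by metis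
    obtain L where L: "L \<in> hom S e" "L \<cdot> p = l" "L \<cdot> q = l'"
      using pushout_univ[OF S(1) Y(2) Y'(1) l(1) l'(1)] l(3) l'(2) by metis
    have "k \<cdot> L = g"
      by (rule pushout_eq[OF S(1) comp_in[OF L(1) k(1)] g])
        (use k(1) L(1) S(2,3) g in \<open>simp_all add: cs L(2,3) l(4) l'(4)\<close>)
    moreover have "L \<cdot> (p \<cdot> end0 I) = f0" "L \<cdot> (q \<cdot> end1 I') = f1"
      using L(1) S(2,3) Y(1) Y'(2) by (simp_all add: L(2,3)[THEN pre] l(2) l'(3) cs)
    ultimately show "\<exists>l\<in>hom (cyl ?K) e. l \<cdot> end0 ?K = f0 \<and> l \<cdot> end1 ?K = f1 \<and> k \<cdot> l = g" using L by auto
  qed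
  have "concat C (const_htpy C I m) (const_htpy C I' m) (const_htpy C ?K m)"
    unfolding concat_def
    by (intro exI[of _ p] exI[of _ q])
      (use S(1-3) m r(1) Y(1-3) Y'(1-3) in \<open>simp add: cs r(2,3)\<close>)
  then show ?thesis using that K by blast
qed

text \<open>With constant homotopies on all six faces, both ways of pasting them are constant at the same map.\<close>

lemma strict_cube:
  assumes cube: "cube_axiom C"
    and bi: "bifibrant C c" "bifibrant C a" "bifibrant C b" "bifibrant C d"
      "bifibrant C c'" "bifibrant C a'" "bifibrant C b'" "bifibrant C d'"
    and top: "square C c a b d f g u v"
    and bot: "hpo C f' g' u' v'" "f' \<in> hom c' a'" "g' \<in> hom c' b'" "u' \<in> hom a' d'"
    and ca: "hpb C f pc pa f'" and cb: "hpb C g pc pb g'" and ad: "hpb C u pa pd u'" and bd: "hpb C v pb pd v'"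
    and p: "pc \<in> hom c c'" "pa \<in> hom a a'" "pb \<in> hom b b'" "pd \<in> hom d d'"
  shows "hpo C f g u v"
proof -
  have s: "f \<in> hom c a" "g \<in> hom c b" "u \<in> hom a d" "v \<in> hom b d" "u \<cdot> f = v \<cdot> g"
    using top by (simp_all add: square_def)
  note Bot = hpoD[OF bot]
  note Sca = hpbD[OF ca s(1) p(1,2)] and Scb = hpbD[OF cb s(2) p(1,3)]
    and Sad = hpbD[OF ad s(3) p(2,4)] and Sbd = hpbD[OF bd s(4) p(3,4)]
  note ob = bi[THEN bifibrantD(3)] and cc = bifibrantD(1)[OF bi(1)]
  obtain Ic Ia Ib Ic' :: "('o,'m) htpy" where I: "is_cylinder C c Ic" "is_cylinder C a Ia" "is_cylinder C b Ib" "is_cylinder C c' Ic'"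
    using cylinder_exists ob(1,2,3,5) by metis
  define m where "m = pd \<cdot> (u \<cdot> f)"
  have m: "m \<in> hom c d'" unfolding m_def using comp_in s p by blast
  have e: "(pd \<cdot> u) \<cdot> f = m" "(pd \<cdot> v) \<cdot> g = m" "(u' \<cdot> f') \<cdot> pc = m" "v' \<cdot> (pb \<cdot> g) = m" "u' \<cdot> (pa \<cdot> f) = m"
    "v' \<cdot> (g' \<cdot> pc) = m" "v' \<cdot> pb = pd \<cdot> v" "u' \<cdot> pa = pd \<cdot> u" "v' \<cdot> g' = u' \<cdot> f'" "(v' \<cdot> g') \<cdot> pc = m"
    unfolding m_def using s(1-4) p bot(2-4) Bot(2)
    by (simp_all add: cs Sad(3)[symmetric] Sbd(3)[symmetric] Sca(3)[symmetric] Scb(3)[symmetric] Bot(3)[symmetric]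
        Sad(3)[symmetric, THEN pre] Sbd(3)[symmetric, THEN pre] Bot(3)[symmetric, THEN pre] s(5))
  obtain K where K: "is_cylinder C c K" "concat C (const_htpy C Ic m) (const_htpy C Ic m) (const_htpy C K m)"
    using const_concat[OF m cc I(1,1)] .
  then obtain L where L: "is_cylinder C c L" "concat C (const_htpy C K m) (const_htpy C Ic m) (const_htpy C L m)"
    using const_concat[OF m cc _ I(1)] by metis
  have post: "postcomp C pd (const_htpy C Ic (u \<cdot> f)) = const_htpy C Ic m"
    "postcomp C v' (const_htpy C Ic (pb \<cdot> g)) = const_htpy C Ic m"
    "postcomp C u' (const_htpy C Ic (pa \<cdot> f)) = const_htpy C Ic m"
    using const_postcomp[OF comp_in[OF s(1,3)] p(4) I(1)] const_postcomp[OF comp_in[OF s(2) p(3)] Bot(2) I(1)]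
      const_postcomp[OF comp_in[OF s(1) p(2)] bot(4) I(1)] e m_def by simp_all
  have pv: "pd \<cdot> v \<in> hom b d'" "pd \<cdot> u \<in> hom a d'" "u' \<cdot> f' \<in> hom c' d'" using comp_in s p bot by blast+
  have prec: "precomp C (pd \<cdot> v) (v' \<cdot> pb) (const_htpy C Ib (pd \<cdot> v)) g (const_htpy C Ic m)"
    "precomp C (pd \<cdot> u) (u' \<cdot> pa) (const_htpy C Ia (pd \<cdot> u)) f (const_htpy C Ic m)"
    "precomp C (u' \<cdot> f') (v' \<cdot> g') (const_htpy C Ic' (u' \<cdot> f')) pc (const_htpy C Ic m)"
    using const_precomp[OF pv(1) s(2) I(3,1)] const_precomp[OF pv(2) s(1) I(2,1)] const_precomp[OF pv(3) p(1) I(4,1)]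
    by (simp_all add: e)
  have hs: "hsquare C f g u v (const_htpy C Ic (u \<cdot> f))" "hsquare C f' g' u' v' (const_htpy C Ic' (u' \<cdot> f'))"
    "hsquare C f pc pa f' (const_htpy C Ic (pa \<cdot> f))" "hsquare C g pc pb g' (const_htpy C Ic (pb \<cdot> g))"
    "hsquare C u pa pd u' (const_htpy C Ia (pd \<cdot> u))" "hsquare C v pb pd v' (const_htpy C Ib (pd \<cdot> v))"
    and hp: "hpushout C f' g' u' v' (const_htpy C Ic' (u' \<cdot> f'))"
    "hpullback C f pc pa f' (const_htpy C Ic (pa \<cdot> f))" "hpullback C g pc pb g' (const_htpy C Ic (pb \<cdot> g))"
    "hpullback C u pa pd u' (const_htpy C Ia (pd \<cdot> u))" "hpullback C v pb pd v' (const_htpy C Ib (pd \<cdot> v))"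
  proof -
    show "hsquare C f g u v (const_htpy C Ic (u \<cdot> f))"
      using hsquareI[OF bi(1-4) s(1-4)] const_left_homotopy[OF comp_in[OF s(1,3)] I(1)] s(5) by simp
    show p1: "hpushout C f' g' u' v' (const_htpy C Ic' (u' \<cdot> f'))"
      using hpushout_const_iff[OF Bot(1) I(4) bi(5-8)] bot by simp
    show p2: "hpullback C f pc pa f' (const_htpy C Ic (pa \<cdot> f))" using hpullback_const[OF Sca(1) I(1) bi(1,2,5,6) ca] .
    show p3: "hpullback C g pc pb g' (const_htpy C Ic (pb \<cdot> g))" using hpullback_const[OF Scb(1) I(1) bi(1,3,5,7) cb] .
    show p4: "hpullback C u pa pd u' (const_htpy C Ia (pd \<cdot> u))"
      using hpullback_const[OF Sad(1) I(2) bi(2,4,6,8) ad] .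
    show p5: "hpullback C v pb pd v' (const_htpy C Ib (pd \<cdot> v))"
      using hpullback_const[OF Sbd(1) I(3) bi(3,4,7,8) bd] .
    show "hsquare C f' g' u' v' (const_htpy C Ic' (u' \<cdot> f'))" using p1 by (simp add: hpushout_def)
    show "hsquare C f pc pa f' (const_htpy C Ic (pa \<cdot> f))" "hsquare C g pc pb g' (const_htpy C Ic (pb \<cdot> g))"
      "hsquare C u pa pd u' (const_htpy C Ia (pd \<cdot> u))" "hsquare C v pb pd v' (const_htpy C Ib (pd \<cdot> v))"
      using p2 p3 p4 p5 by (simp_all add: hpullback_def)
  qed
  have sc: "same_class C (pd \<cdot> (u \<cdot> f)) (v' \<cdot> (g' \<cdot> pc)) (const_htpy C L m) (const_htpy C L m)"
    unfolding e m_def[symmetric] using const_same_class[OF m L(1,1)] .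
  have "hcube C f g u v f' g' u' v' pc pa pb pd (const_htpy C Ic (u \<cdot> f)) (const_htpy C Ic' (u' \<cdot> f'))
     (const_htpy C Ic (pa \<cdot> f)) (const_htpy C Ic (pb \<cdot> g)) (const_htpy C Ia (pd \<cdot> u)) (const_htpy C Ib (pd \<cdot> v))"
    unfolding hcube_def post using hs prec K(2) L(2) sc by blast
  then have "hpushout C f g u v (const_htpy C Ic (u \<cdot> f))"
    using cube[unfolded cube_axiom_def] hp by blast
  then show ?thesis using hpushout_const_iff[OF top I(1) bi(1-4)] by blast
qed

end

section \<open>Maps built by attaching\<close>

text \<open>The objects are bifibrant and the diagrams commute strictly. Closure under weak equivalences is part of
  the definition, in both directions, so that each construction may choose convenient models; in particular it
  makes the notion invariant under homotopy.\<close>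

inductive built :: "('o, 'm) mcat \<Rightarrow> nat \<Rightarrow> 'm \<Rightarrow> bool" for C where
  built_0: "bifibrant C a \<Longrightarrow> bifibrant C x \<Longrightarrow> f \<in> Hom C a x \<Longrightarrow> f \<in> Weq C \<Longrightarrow> built C 0 f"
| built_attach: "built C n (comp C \<tau> \<sigma>) \<Longrightarrow> bifibrant C a \<Longrightarrow> bifibrant C x \<Longrightarrow> bifibrant C z \<Longrightarrow> bifibrant C y \<Longrightarrow>
    \<rho> \<in> Hom C z a \<Longrightarrow> \<tau> \<in> Hom C z x \<Longrightarrow> \<iota> \<in> Hom C a y \<Longrightarrow> \<chi> \<in> Hom C x y \<Longrightarrow> \<sigma> \<in> Hom C a z \<Longrightarrow>
    comp C \<rho> \<sigma> = Id C a \<Longrightarrow> hpo C \<rho> \<tau> \<iota> \<chi> \<Longrightarrow> built C (Suc n) \<iota>"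
| built_forward: "built C n f \<Longrightarrow> bifibrant C a \<Longrightarrow> bifibrant C x \<Longrightarrow> bifibrant C a' \<Longrightarrow> bifibrant C x' \<Longrightarrow>
    f \<in> Hom C a x \<Longrightarrow> g \<in> Hom C a' x' \<Longrightarrow> \<alpha> \<in> Hom C a a' \<Longrightarrow> \<xi> \<in> Hom C x x' \<Longrightarrow> \<alpha> \<in> Weq C \<Longrightarrow> \<xi> \<in> Weq C \<Longrightarrow>
    comp C \<xi> f = comp C g \<alpha> \<Longrightarrow> built C n g"
| built_backward: "built C n g \<Longrightarrow> bifibrant C a \<Longrightarrow> bifibrant C x \<Longrightarrow> bifibrant C a' \<Longrightarrow> bifibrant C x' \<Longrightarrow>
    f \<in> Hom C a x \<Longrightarrow> g \<in> Hom C a' x' \<Longrightarrow> \<alpha> \<in> Hom C a a' \<Longrightarrow> \<xi> \<in> Hom C x x' \<Longrightarrow> \<alpha> \<in> Weq C \<Longrightarrow> \<xi> \<in> Weq C \<Longrightarrow>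
    comp C \<xi> f = comp C g \<alpha> \<Longrightarrow> built C n f"

text \<open>The closure clauses of \<open>built\<close>, for an arbitrary property of maps. The condition is self-dual.\<close>

definition weq_closed :: "('o, 'm) mcat \<Rightarrow> ('m \<Rightarrow> bool) \<Rightarrow> bool" where
  "weq_closed C S \<longleftrightarrow>
     (\<forall>f g a x a' x' \<alpha> \<xi>. bifibrant C a \<longrightarrow> bifibrant C x \<longrightarrow> bifibrant C a' \<longrightarrow> bifibrant C x' \<longrightarrow>
        f \<in> Hom C a x \<longrightarrow> g \<in> Hom C a' x' \<longrightarrow> \<alpha> \<in> Hom C a a' \<longrightarrow> \<xi> \<in> Hom C x x' \<longrightarrow>
        \<alpha> \<in> Weq C \<longrightarrow> \<xi> \<in> Weq C \<longrightarrow> comp C \<xi> f = comp C g \<alpha> \<longrightarrow> (S f \<longleftrightarrow> S g))"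

text \<open>Only base changes along fibrations are tested. In the opposite category this says that the cobase changes
  along cofibrations lie in \<open>S\<close>.\<close>

definition base_changes_in :: "('o, 'm) mcat \<Rightarrow> ('m \<Rightarrow> bool) \<Rightarrow> 'm \<Rightarrow> bool" where
  "base_changes_in C S f \<longleftrightarrow>
     (\<forall>a x M \<phi> P \<pi> f'. f \<in> Hom C a x \<longrightarrow> bifibrant C M \<longrightarrow> bifibrant C P \<longrightarrow> \<phi> \<in> Hom C M x \<longrightarrow> \<phi> \<in> Fib C \<longrightarrow>
        \<pi> \<in> Hom C P a \<longrightarrow> f' \<in> Hom C P M \<longrightarrow> hpb C \<pi> f' f \<phi> \<longrightarrow> S f')"

lemma weq_closed_built: "weq_closed C (built C n)"
  unfolding weq_closed_def
proof (intro allI impI)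
  fix f g a x a' x' \<alpha> \<xi>
  assume *: "bifibrant C a" "bifibrant C x" "bifibrant C a'" "bifibrant C x'" "f \<in> Hom C a x" "g \<in> Hom C a' x'"
    "\<alpha> \<in> Hom C a a'" "\<xi> \<in> Hom C x x'" "\<alpha> \<in> Weq C" "\<xi> \<in> Weq C" "comp C \<xi> f = comp C g \<alpha>"
  show "built C n f \<longleftrightarrow> built C n g" using built_forward[OF _ *] built_backward[OF _ *] by (rule iffI)
qed

context model_category begin

lemma weq_closedD:
  assumes "weq_closed C S" "bifibrant C a" "bifibrant C x" "bifibrant C a'" "bifibrant C x'"
    "f \<in> hom a x" "g \<in> hom a' x'" "\<alpha> \<in> hom a a'" "\<xi> \<in> hom x x'" "\<alpha> \<in> Weq C" "\<xi> \<in> Weq C" "\<xi> \<cdot> f = g \<cdot> \<alpha>"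
  shows "S f \<longleftrightarrow> S g"
  using assms(1)[unfolded weq_closed_def, rule_format, OF assms(2-12)] .

lemma base_changes_inD:
  assumes "base_changes_in C S f" "f \<in> hom a x" "bifibrant C M" "bifibrant C P" "\<phi> \<in> hom M x" "\<phi> \<in> Fib C"
    "\<pi> \<in> hom P a" "f' \<in> hom P M" "hpb C \<pi> f' f \<phi>"
  shows "S f'"
  using assms(1)[unfolded base_changes_in_def, rule_format, OF assms(2-9)] .

text \<open>This settles the closure clauses in inductions over \<open>built\<close>, for base change and, dually, for cobase change. If the
  property is known for the target \<open>g\<close> of a weak equivalence, a base change of \<open>f\<close> is compared with a base change of \<open>g\<close>
  along a fibration that replaces \<open>\<xi> \<cdot> \<phi>\<close>. If it is known for the source \<open>f\<close>, the fibration is first pulled back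
  along \<open>\<xi>\<close>.\<close>

lemma weq_closed_base_changes:
  assumes S: "weq_closed C S" shows "weq_closed C (base_changes_in C S)"
  unfolding weq_closed_def
proof (intro allI impI iffI)
  fix f g a x a' x' \<alpha> \<xi>
  assume bi: "bifibrant C a" "bifibrant C x" "bifibrant C a'" "bifibrant C x'"
    and t: "f \<in> hom a x" "g \<in> hom a' x'" "\<alpha> \<in> hom a a'" "\<xi> \<in> hom x x'" "\<alpha> \<in> Weq C" "\<xi> \<in> Weq C" "\<xi> \<cdot> f = g \<cdot> \<alpha>"
  note o = bi[THEN bifibrantD(3)] and fi = bi[THEN bifibrantD(2)]
  {
    assume F: "base_changes_in C S f"
    show "base_changes_in C S g"
      unfolding base_changes_in_def
    proof (intro allI impI)
      fix b y M \<phi> P \<pi> k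
      assume "g \<in> hom b y" and M: "bifibrant C M" "bifibrant C P" "\<phi> \<in> hom M y" "\<phi> \<in> Fib C" "\<pi> \<in> hom P b" "k \<in> hom P M"
        "hpb C \<pi> k g \<phi>"
      then have "b = a'" "y = x'" using t(2) by (simp_all add: Hom_iff)
      note M = M[unfolded this]
      note oM = bifibrantD(3)[OF M(1)] bifibrantD(3)[OF M(2)]
      obtain M' pa pm where M': "bifibrant C M'" "pa \<in> hom M' x" "pa \<in> Fib C" "pm \<in> hom M' M" "\<xi> \<cdot> pa = \<phi> \<cdot> pm"
        "hpb C pa pm \<xi> \<phi>"
        using hpb_exists[OF t(4) M(3,4) fi(2,4)] by metis
      have pmw: "pm \<in> Weq C"
        using hpb_weq[OF hpbD(1)[OF M'(6,2,4) t(4)] t(6)] M'(6) by blast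
      obtain P' qa qm where P': "bifibrant C P'" "qa \<in> hom P' a" "qm \<in> hom P' M'" "f \<cdot> qa = pa \<cdot> qm" "hpb C qa qm f pa"
        using hpb_exists[OF t(1) M'(2,3) fi(1,2)] by metis
      note oP' = bifibrantD(3)[OF P'(1)]
      have Sq: "S qm" using base_changes_inD[OF F t(1) M'(1) P'(1) M'(2,3) P'(2,3,5)] .
      have sq1: "square C P' a M' x qa qm f pa" using P' t M' by (simp add: square_def)
      have aq: "\<alpha> \<cdot> qa \<in> hom P' a'" "pm \<cdot> qm \<in> hom P' M" using comp_in P' t M' by blast+
      have sq2: "square C P' a' M x' (\<alpha> \<cdot> qa) (pm \<cdot> qm) g \<phi>"
        unfolding square_def using aq t(1-4) M(3) P'(2,3) M'(2,4)
        by (simp add: cs t(7)[symmetric, THEN pre] P'(4) M'(5)[THEN pre])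
      have h2: "hpb C (\<alpha> \<cdot> qa) (pm \<cdot> qm) g \<phi>"
        using hpb_invariant[OF sq1 sq2 Id_in[OF oP'] Id_weq[OF oP'] t(3,5) M'(4) pmw t(4,6)] aq t(7) M'(5) P'(5)
        by (simp add: cs)
      obtain Q ra rm where Q: "bifibrant C Q" "ra \<in> hom Q a'" "rm \<in> hom Q M" "g \<cdot> ra = \<phi> \<cdot> rm" "hpb C ra rm g \<phi>"
        and lift: "\<And>T t s. cofibrant C T \<Longrightarrow> t \<in> hom T a' \<Longrightarrow> s \<in> hom T M \<Longrightarrow> g \<cdot> t = \<phi> \<cdot> s \<Longrightarrow>
          \<exists>l \<in> hom T Q. ra \<cdot> l = t \<and> rm \<cdot> l = s"
        using hpb_exists[OF t(2) M(3,4) fi(3,4)] by (metis (no_types, lifting))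
      have sqQ: "square C Q a' M x' ra rm g \<phi>" using Q t M by (simp add: square_def)
      note sqP = hpbD[OF M(7,5,6) t(2)]
      obtain l where l: "l \<in> hom P Q" "ra \<cdot> l = \<pi>" "rm \<cdot> l = k"
        using lift[OF bifibrantD(1)[OF M(2)] M(5,6) sqP(3)] by blast
      obtain l' where l': "l' \<in> hom P' Q" "ra \<cdot> l' = \<alpha> \<cdot> qa" "rm \<cdot> l' = pm \<cdot> qm"
        using lift[OF bifibrantD(1)[OF P'(1)] aq] sq2 by (auto simp: square_def)
      have lw: "l \<in> Weq C" "l' \<in> Weq C"
        using hpb_compare[OF sqP(1) sqQ l(1) Id_in_weq[OF o(3)] Id_in_weq[OF oM(1)] Id_in_weq[OF o(4)]]
          hpb_compare[OF sq2 sqQ l'(1) Id_in_weq[OF o(3)] Id_in_weq[OF oM(1)] Id_in_weq[OF o(4)]]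
          l(2,3) l'(2,3) aq M(3,5,6,7) t(2) h2 Q(5) by (simp_all add: cs)
      have "S rm"
        using weq_closedD[OF S P'(1) M'(1) Q(1) M(1) P'(3) Q(3) l'(1) M'(4) lw(2) pmw l'(3)[symmetric]] Sq by blast
      moreover have "Id C M \<cdot> k = rm \<cdot> l" using l(3) M(6) by (simp add: cs)
      ultimately show "S k"
        using weq_closedD[OF S M(2,1) Q(1) M(1) M(6) Q(3) l(1) Id_in[OF oM(1)] lw(1) Id_weq[OF oM(1)]] by blast
    qed
  next
    assume F: "base_changes_in C S g"
    show "base_changes_in C S f"
      unfolding base_changes_in_def
    proof (intro allI impI)
      fix b y M \<phi> P \<pi> k
      assume "f \<in> hom b y" and M: "bifibrant C M" "bifibrant C P" "\<phi> \<in> hom M y" "\<phi> \<in> Fib C" "\<pi> \<in> hom P b" "k \<in> hom P M"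
        "hpb C \<pi> k f \<phi>"
      then have "b = a" "y = x" using t(1) by (simp_all add: Hom_iff)
      note M = M[unfolded this]
      note oM = bifibrantD(3)[OF M(1)] bifibrantD(3)[OF M(2)]
      obtain N m \<psi> where N: "m \<in> hom M N" "\<psi> \<in> hom N x'" "m \<in> Cof C" "m \<in> Weq C" "\<psi> \<in> Fib C" "\<psi> \<cdot> m = \<xi> \<cdot> \<phi>"
        using factor_acof[OF comp_in[OF M(3) t(4)]] .
      have bN: "bifibrant C N"
        using cofibrant_cof[OF bifibrantD(1)[OF M(1)] N(1,3)] fibrant_fib[OF fi(4) N(2,5)] by (simp add: bifibrant_def)
      note sqP = hpbD[OF M(7,5,6) t(1)]
      have aq: "\<alpha> \<cdot> \<pi> \<in> hom P a'" "m \<cdot> k \<in> hom P N" using comp_in M t N by blast+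
      have sq2: "square C P a' N x' (\<alpha> \<cdot> \<pi>) (m \<cdot> k) g \<psi>"
        unfolding square_def using aq t(1-4) M(3,5,6) N(1,2)
        by (simp add: cs t(7)[symmetric, THEN pre] sqP(3) N(6)[THEN pre])
      have "hpb C (\<alpha> \<cdot> \<pi>) (m \<cdot> k) g \<psi>"
        using hpb_invariant[OF sqP(1) sq2 Id_in_weq[OF oM(2)] t(3,5) N(1,4) t(4,6)] aq t(7) N(6) M(7)
        by (simp add: cs)
      then have "S (m \<cdot> k)" using base_changes_inD[OF F t(2) bN M(2) N(2,5) aq] by blast
      moreover have "m \<cdot> k = (m \<cdot> k) \<cdot> Id C P" using aq by (simp add: cs)
      ultimately show "S k"
        using weq_closedD[OF S M(2,1,2) bN M(6) aq(2) Id_in[OF oM(2)] N(1) Id_weq[OF oM(2)] N(4)] by blast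
    qed
  }
qed

lemma weq_closed_op: "weq_closed C S \<Longrightarrow> weq_closed (op C) S"
  unfolding weq_closed_def dualize bifibrant_op
proof (intro allI impI)
  fix f g a x a' x' \<alpha> \<xi>
  assume S: "\<forall>f g a x a' x' \<alpha> \<xi>. bifibrant C a \<longrightarrow> bifibrant C x \<longrightarrow> bifibrant C a' \<longrightarrow> bifibrant C x' \<longrightarrow>
        f \<in> Hom C a x \<longrightarrow> g \<in> Hom C a' x' \<longrightarrow> \<alpha> \<in> Hom C a a' \<longrightarrow> \<xi> \<in> Hom C x x' \<longrightarrow>
        \<alpha> \<in> Weq C \<longrightarrow> \<xi> \<in> Weq C \<longrightarrow> comp C \<xi> f = comp C g \<alpha> \<longrightarrow> (S f \<longleftrightarrow> S g)"
    and *: "bifibrant C a" "bifibrant C x" "bifibrant C a'" "bifibrant C x'" "f \<in> hom x a" "g \<in> hom x' a'"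
    "\<alpha> \<in> hom a' a" "\<xi> \<in> hom x' x" "\<alpha> \<in> Weq C" "\<xi> \<in> Weq C" "f \<cdot> \<xi> = \<alpha> \<cdot> g"
  show "S f \<longleftrightarrow> S g"
    using S[rule_format, OF *(4,3,2,1,6,5,8,7,10,9) *(11)[symmetric]] by blast
qed

text \<open>For an attachment with pushout \<open>y\<close>, all of \<open>a\<close>, \<open>x\<close> and \<open>z\<close> are pulled back along \<open>\<phi> : M \<rightarrow> y\<close>. Weak pullbacks are
  chosen such that the cube commutes strictly, and \<open>Z1\<close> is a pullback of \<open>z\<close> along \<open>P1 \<rightarrow> a\<close>, so that the section of
  \<open>\<rho>\<close> lifts to a strict section of \<open>r1\<close>.\<close>

lemma built_base_change_fib:
  assumes cube: "cube_axiom C"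
  shows "built C n f \<Longrightarrow> base_changes_in C (built C n) f"
proof (induction rule: built.induct)
  case (built_0 a x f)
  show ?case
    unfolding base_changes_in_def
  proof (intro allI impI)
    fix b y M \<phi> P \<pi> k
    assume *: "f \<in> hom b y" "bifibrant C M" "bifibrant C P" "\<phi> \<in> hom M y" "\<phi> \<in> Fib C" "\<pi> \<in> hom P b" "k \<in> hom P M"
        "hpb C \<pi> k f \<phi>"
    have "k \<in> Weq C" using hpb_weq[OF hpbD(1)[OF *(8,6,7,1)] built_0(4)] *(8) by blast
    then show "built C 0 k" by (rule built.built_0[OF *(3,2,7)])
  qed
next
  case (built_attach n \<tau> \<sigma> a x z y \<rho> \<iota> \<chi>)
  note bi = built_attach(2-5) and t = built_attach(6-10) and rs = built_attach(11) and h = built_attach(12)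
  note fi = bi[THEN bifibrantD(2)] and o = bi[THEN bifibrantD(3)]
  note H = hpoD[OF h t(1,2,3)]
  show ?case
    unfolding base_changes_in_def
  proof (intro allI impI)
    fix b w M \<phi> P \<pi> k
    assume "\<iota> \<in> hom b w" and M: "bifibrant C M" "bifibrant C P" "\<phi> \<in> hom M w" "\<phi> \<in> Fib C" "\<pi> \<in> hom P b" "k \<in> hom P M"
        "hpb C \<pi> k \<iota> \<phi>"
    then have "b = a" "w = y" using t(3) by (simp_all add: Hom_iff)
    note M = M[unfolded this]
    note oM = bifibrantD(3)[OF M(1)] bifibrantD(3)[OF M(2)]
    obtain P1 pA pM where P1: "bifibrant C P1" "pA \<in> hom P1 a" "pA \<in> Fib C" "pM \<in> hom P1 M" "\<iota> \<cdot> pA = \<phi> \<cdot> pM"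
      "hpb C pA pM \<iota> \<phi>"
      and liftP: "\<And>T t s. cofibrant C T \<Longrightarrow> t \<in> hom T a \<Longrightarrow> s \<in> hom T M \<Longrightarrow> \<iota> \<cdot> t = \<phi> \<cdot> s \<Longrightarrow>
          \<exists>l \<in> hom T P1. pA \<cdot> l = t \<and> pM \<cdot> l = s"
      using hpb_exists[OF t(3) M(3,4) fi(1,4)] by (metis (no_types, lifting))
    obtain X1 qX qM where X1: "bifibrant C X1" "qX \<in> hom X1 x" "qX \<in> Fib C" "qM \<in> hom X1 M" "\<chi> \<cdot> qX = \<phi> \<cdot> qM"
      "hpb C qX qM \<chi> \<phi>"
      and liftX: "\<And>T t s. cofibrant C T \<Longrightarrow> t \<in> hom T x \<Longrightarrow> s \<in> hom T M \<Longrightarrow> \<chi> \<cdot> t = \<phi> \<cdot> s \<Longrightarrow>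
          \<exists>l \<in> hom T X1. qX \<cdot> l = t \<and> qM \<cdot> l = s"
      using hpb_exists[OF t(4) M(3,4) fi(2,4)] by (metis (no_types, lifting))
    obtain Z1 rZ r1 where Z1: "bifibrant C Z1" "rZ \<in> hom Z1 z" "rZ \<in> Fib C" "r1 \<in> hom Z1 P1" "\<rho> \<cdot> rZ = pA \<cdot> r1"
      "hpb C rZ r1 \<rho> pA"
      and liftZ: "\<And>T t s. cofibrant C T \<Longrightarrow> t \<in> hom T z \<Longrightarrow> s \<in> hom T P1 \<Longrightarrow> \<rho> \<cdot> t = pA \<cdot> s \<Longrightarrow>
          \<exists>l \<in> hom T Z1. rZ \<cdot> l = t \<and> r1 \<cdot> l = s"
      using hpb_exists[OF t(1) P1(2,3) fi(3,1)] by (metis (no_types, lifting))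
    note oP1 = bifibrantD(3)[OF P1(1)]
    have "\<chi> \<cdot> (\<tau> \<cdot> rZ) = \<phi> \<cdot> (pM \<cdot> r1)"
      using t(1-4) Z1(2,4) P1(2,4) M(3) by (simp add: H(3)[symmetric, THEN pre] Z1(5) P1(5)[THEN pre] cs)
    then obtain t1 where t1: "t1 \<in> hom Z1 X1" "qX \<cdot> t1 = \<tau> \<cdot> rZ" "qM \<cdot> t1 = pM \<cdot> r1"
      using liftX[OF bifibrantD(1)[OF Z1(1)] comp_in[OF Z1(2) t(2)] comp_in[OF Z1(4) P1(4)]] by blast
    have "\<rho> \<cdot> (\<sigma> \<cdot> pA) = pA \<cdot> Id C P1" using t P1(2) oP1 o by (simp add: rs[THEN pre] cs)
    then obtain s1 where s1: "s1 \<in> hom P1 Z1" "rZ \<cdot> s1 = \<sigma> \<cdot> pA" "r1 \<cdot> s1 = Id C P1"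
      using liftZ[OF bifibrantD(1)[OF P1(1)] comp_in[OF P1(2) t(5)] Id_in[OF oP1]] by blast
    note sqP = hpbD[OF M(7,5,6) t(3)] and sqP1 = hpbD[OF P1(6,2,4) t(3)]
    obtain l where l: "l \<in> hom P P1" "pA \<cdot> l = \<pi>" "pM \<cdot> l = k"
      using liftP[OF bifibrantD(1)[OF M(2)] M(5,6) sqP(3)] by blast
    have lw: "l \<in> Weq C"
      using hpb_compare[OF sqP(1) sqP1(1) l(1) Id_in_weq[OF o(1)] Id_in_weq[OF oM(1)] Id_in_weq[OF o(4)]]
         l(2,3) M(3,5,6,7) t(3) P1(6) by (simp add: cs)
    have F1: "hpb C pM pA \<phi> \<iota>" and F2: "hpb C qM qX \<phi> \<chi>" and F3: "hpb C r1 rZ pA \<rho>"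
      using hpb_sym P1(6) X1(6) Z1(6) by blast+
    \<comment> \<open>The fourth vertical face, by cancelling the face over \<open>\<chi>\<close>.\<close>
    have "hpb C (qM \<cdot> t1) rZ \<phi> (\<chi> \<cdot> \<tau>)"
      unfolding t1(3) H(3)[symmetric]
      using hpb_paste[OF F1 P1(4,2) M(3) hpbD(1)[OF F3 Z1(4,2) P1(2)]] F3 by blast
    moreover have "square C Z1 X1 z x t1 rZ qX \<tau>" using t1 Z1 X1 t by (simp add: square_def)
    ultimately have F4: "hpb C t1 rZ qX \<tau>"
      using hpb_paste[OF F2 X1(4,2) M(3)] by blast
    have "square C Z1 P1 X1 M r1 t1 pM qM" using Z1 t1 P1 X1 by (simp add: square_def)
    then have top: "hpo C r1 t1 pM qM"
      using strict_cube[OF cube Z1(1) P1(1) X1(1) M(1) bi(3,1,2,4) _ h t(1,2,3) F3 F4 F1 F2 Z1(2) P1(2) X1(2) M(3)] by blast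
    have ts: "t1 \<cdot> s1 \<in> hom P1 X1" "\<tau> \<cdot> \<sigma> \<in> hom a x" using comp_in t1 s1 t by blast+
    have "qM \<cdot> (t1 \<cdot> s1) = pM" using t1(1) s1(1) X1(4) P1(4) Z1(4) by (simp add: t1(3)[THEN pre] s1(3) cs)
    moreover have "\<chi> \<cdot> (\<tau> \<cdot> \<sigma>) = \<iota>" using t by (simp add: H(3)[symmetric, THEN pre] rs cs)
    moreover have "square C P1 X1 a x (t1 \<cdot> s1) pA qX (\<tau> \<cdot> \<sigma>)"
      unfolding square_def using ts P1(2) X1(2) t1(1) s1(1) Z1(2) t(2,5) by (simp add: t1(2)[THEN pre] s1(2) cs)
    ultimately have "hpb C pA (t1 \<cdot> s1) (\<tau> \<cdot> \<sigma>) qX"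
      using hpb_paste[OF F2 X1(4,2) M(3), of P1 a "t1 \<cdot> s1" pA "\<tau> \<cdot> \<sigma>"] F1 hpb_sym by simp
    then have "built C n (t1 \<cdot> s1)"
      using base_changes_inD[OF built_attach.IH ts(2) X1(1) P1(1) X1(2,3) P1(2) ts(1)] by blast
    from built.built_attach[OF this P1(1) X1(1) Z1(1) M(1) Z1(4) t1(1) P1(4) X1(4) s1(1,3) top]
    have "built C (Suc n) pM" .
    moreover have "Id C M \<cdot> k = pM \<cdot> l" using l(3) M(6) by (simp add: cs)
    ultimately show "built C (Suc n) k"
      using built_backward[OF _ M(2,1) P1(1) M(1) M(6) P1(4) l(1) Id_in[OF oM(1)] lw Id_weq[OF oM(1)]] by blast
  qed
next
  case (built_forward n f a x a' x' g \<alpha> \<xi>)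
  show ?case
    using weq_closedD[OF weq_closed_base_changes[OF weq_closed_built] built_forward(2-12)] built_forward.IH by blast
next
  case (built_backward n g a x a' x' f \<alpha> \<xi>)
  show ?case
    using weq_closedD[OF weq_closed_base_changes[OF weq_closed_built] built_backward(2-12)] built_backward.IH by blast
qed

text \<open>For an attachment to \<open>x\<close>, the map \<open>\<pi>\<close> is pushed out along the section \<open>\<sigma>\<close> to \<open>Z1\<close>, and then along \<open>\<tau>\<close> to
  \<open>X1\<close>. As the composite \<open>\<rho> \<cdot> \<sigma>\<close> is the identity, \<open>Z1\<close> maps back to \<open>A\<close> over \<open>\<pi> \<cdot> \<rho>\<close>, and cancelling homotopy
  pushouts shows that \<open>M1\<close> is the homotopy pushout of \<open>A \<leftarrow> Z1 \<rightarrow> X1\<close>.\<close>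

lemma built_cobase_change_cof: "built C n f \<Longrightarrow> base_changes_in (op C) (built C n) f"
proof (induction rule: built.induct)
  case (built_0 a x f)
  show ?case
    unfolding base_changes_in_def dualize bifibrant_op
  proof (intro allI impI)
    fix y b M \<phi> P \<pi> k
    assume *: "f \<in> hom b y" "bifibrant C M" "bifibrant C P" "\<phi> \<in> hom b M" "\<phi> \<in> Cof C" "\<pi> \<in> hom y P" "k \<in> hom M P"
        "hpo C f \<phi> \<pi> k"
    have "k \<in> Weq C" using hpo_weq[OF hpoD(1)[OF *(8,1,4,6)] built_0(4)] *(8) by blast
    then show "built C 0 k" by (rule built.built_0[OF *(2,3,7)])
  qed
next
  case (built_attach n \<tau> \<sigma> p x z m \<rho> \<iota> \<chi>)
  note bi = built_attach(2-5) and t = built_attach(6-10) and rs = built_attach(11) and h = built_attach(12)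
  note co = bi[THEN bifibrantD(1)] and o = bi[THEN bifibrantD(3)]
  note H = hpoD[OF h t(1,2,3)]
  show ?case
    unfolding base_changes_in_def dualize bifibrant_op
  proof (intro allI impI)
    fix y b A \<pi> N \<mu> k
    assume "\<iota> \<in> hom b y" and A: "bifibrant C A" "bifibrant C N" "\<pi> \<in> hom b A" "\<pi> \<in> Cof C" "\<mu> \<in> hom y N" "k \<in> hom A N"
        "hpo C \<iota> \<pi> \<mu> k"
    then have "b = p" "y = m" using t(3) by (simp_all add: Hom_iff)
    note A = A[unfolded this]
    note oA = bifibrantD(3)[OF A(1)] bifibrantD(3)[OF A(2)]
    obtain Z1 sZ s1 where Z1: "bifibrant C Z1" "sZ \<in> hom z Z1" "sZ \<in> Cof C" "s1 \<in> hom A Z1" "sZ \<cdot> \<sigma> = s1 \<cdot> \<pi>"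
      "hpo C \<sigma> \<pi> sZ s1"
      and liftZ: "\<And>T t s. fibrant C T \<Longrightarrow> t \<in> hom z T \<Longrightarrow> s \<in> hom A T \<Longrightarrow> t \<cdot> \<sigma> = s \<cdot> \<pi> \<Longrightarrow>
          \<exists>l \<in> hom Z1 T. l \<cdot> sZ = t \<and> l \<cdot> s1 = s"
      using hpo_exists[OF t(5) A(3,4) co(3,1)] by (metis (no_types, lifting))
    obtain X1 xX t1 where X1: "bifibrant C X1" "xX \<in> hom x X1" "xX \<in> Cof C" "t1 \<in> hom Z1 X1" "xX \<cdot> \<tau> = t1 \<cdot> sZ"
      "hpo C \<tau> sZ xX t1"
      and liftX: "\<And>T t s. fibrant C T \<Longrightarrow> t \<in> hom x T \<Longrightarrow> s \<in> hom Z1 T \<Longrightarrow> t \<cdot> \<tau> = s \<cdot> sZ \<Longrightarrow>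
          \<exists>l \<in> hom X1 T. l \<cdot> xX = t \<and> l \<cdot> t1 = s"
      using hpo_exists[OF t(2) Z1(2,3) co(2,3)] by (metis (no_types, lifting))
    obtain M1 mM aM where M1: "bifibrant C M1" "mM \<in> hom m M1" "mM \<in> Cof C" "aM \<in> hom A M1" "mM \<cdot> \<iota> = aM \<cdot> \<pi>"
      "hpo C \<iota> \<pi> mM aM"
      and liftM: "\<And>T t s. fibrant C T \<Longrightarrow> t \<in> hom m T \<Longrightarrow> s \<in> hom A T \<Longrightarrow> t \<cdot> \<iota> = s \<cdot> \<pi> \<Longrightarrow>
          \<exists>l \<in> hom M1 T. l \<cdot> mM = t \<and> l \<cdot> aM = s"
      using hpo_exists[OF t(3) A(3,4) co(4,1)] by (metis (no_types, lifting))
    have "(\<pi> \<cdot> \<rho>) \<cdot> \<sigma> = Id C A \<cdot> \<pi>" using t A(3) oA by (simp add: cs rs)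
    then obtain r1 where r1: "r1 \<in> hom Z1 A" "r1 \<cdot> sZ = \<pi> \<cdot> \<rho>" "r1 \<cdot> s1 = Id C A"
      using liftZ[OF bifibrantD(2)[OF A(1)] comp_in[OF t(1) A(3)] Id_in[OF oA(1)]] by blast
    have "(mM \<cdot> \<chi>) \<cdot> \<tau> = (aM \<cdot> r1) \<cdot> sZ"
      using M1(2,4) t r1(1) Z1(2) A(3) by (simp add: cs H(3)[symmetric] r1(2) M1(5)[THEN pre])
    then obtain c1 where c1: "c1 \<in> hom X1 M1" "c1 \<cdot> xX = mM \<cdot> \<chi>" "c1 \<cdot> t1 = aM \<cdot> r1"
      using liftX[OF bifibrantD(2)[OF M1(1)] comp_in[OF t(4) M1(2)] comp_in[OF r1(1) M1(4)]] by blast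
    note sqN = hpoD[OF A(7) t(3) A(3,5)] and sqM1 = hpoD[OF M1(6) t(3) A(3) M1(2)]
    obtain l where l: "l \<in> hom M1 N" "l \<cdot> mM = \<mu>" "l \<cdot> aM = k"
      using liftM[OF bifibrantD(2)[OF A(2)] A(5,6) sqN(3)] by blast
    have lw: "l \<in> Weq C"
      using hpo_compare[OF sqM1(1) sqN(1) Id_in_weq[OF o(1)] Id_in_weq[OF o(4)] Id_in_weq[OF oA(1)] l(1)]
        l(2,3) A(3,5,6,7) t(3) M1(6) by (simp add: cs)
    have ts: "t1 \<cdot> s1 \<in> hom A X1" "\<tau> \<cdot> \<sigma> \<in> hom p x" using comp_in X1 Z1 t by blast+
    have G1: "hpo C \<pi> \<sigma> s1 sZ" and G2: "hpo C sZ \<tau> t1 xX" and G3: "hpo C \<tau> \<rho> \<chi> \<iota>"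
      using hpo_sym Z1(6) X1(6) h by blast+
    have "hpo C \<pi> (\<tau> \<cdot> \<sigma>) (t1 \<cdot> s1) xX"
      using hpo_paste[OF G1 A(3) t(5) Z1(4) hpoD(1)[OF G2 Z1(2) t(2) X1(4)]] G2 by blast
    then have bt: "built C n (t1 \<cdot> s1)"
      using model_category.base_changes_inD[OF dual built_attach.IH, of x p A X1 \<pi> xX "t1 \<cdot> s1"]
        ts A X1 hpo_sym by simp
    \<comment> \<open>The rectangle from \<open>z\<close> to \<open>M1\<close> is a pasting in two ways, through \<open>p\<close> and \<open>Z1\<close>.\<close>
    have "hpo C \<tau> (r1 \<cdot> sZ) (c1 \<cdot> xX) aM"
      unfolding r1(2) c1(2) using hpo_paste[OF G3 t(2,1,4) sqM1(1)] M1(6) by blast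
    moreover have "square C Z1 X1 A M1 t1 r1 c1 aM" using X1 r1 c1 M1 by (simp add: square_def)
    ultimately have top: "hpo C r1 t1 aM c1"
      using hpo_paste[OF X1(6) t(2) Z1(2) X1(2)] hpo_sym by blast
    have "built C (Suc n) aM"
      using built.built_attach[OF bt A(1) X1(1) Z1(1) M1(1) r1(1) X1(4) M1(4) c1(1) Z1(4) r1(3) top] .
    moreover have "l \<cdot> aM = k \<cdot> Id C A" using l(3) A(6) by (simp add: cs)
    ultimately show "built C (Suc n) k"
      using built_forward[OF _ A(1) M1(1) A(1,2) M1(4) A(6) Id_in[OF oA(1)] l(1) Id_weq[OF oA(1)] lw] by blast
  qed
next
  case (built_forward n f a x a' x' g \<alpha> \<xi>)
  show ?case
    using model_category.weq_closedD[OF dual model_category.weq_closed_base_changes[OF dual weq_closed_op[OF weq_closed_built]],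
        of x' a' x a g f \<xi> \<alpha>] built_forward by (simp add: dualize)
next
  case (built_backward n g a x a' x' f \<alpha> \<xi>)
  show ?case
    using model_category.weq_closedD[OF dual model_category.weq_closed_base_changes[OF dual weq_closed_op[OF weq_closed_built]],
        of x' a' x a g f \<xi> \<alpha>] built_backward by (simp add: dualize)
qed

text \<open>The fibration hypothesis is removed by factoring the map along which the base change is made.\<close>

lemma built_base_change:
  assumes cube: "cube_axiom C" and b: "built C n f" and h: "hpb C \<pi> k f \<phi>"
    and t: "f \<in> hom a x" "\<phi> \<in> hom M x" "\<pi> \<in> hom P a" "k \<in> hom P M"
    and bi: "bifibrant C M" "bifibrant C P" "bifibrant C a" "bifibrant C x"
  shows "built C n k"
proof -
  note o = bi[THEN bifibrantD(3)]
  obtain N m \<psi> where N: "m \<in> hom M N" "\<psi> \<in> hom N x" "m \<in> Cof C" "m \<in> Weq C" "\<psi> \<in> Fib C" "\<psi> \<cdot> m = \<phi>"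
    using factor_acof[OF t(2)] .
  have bN: "bifibrant C N"
    using cofibrant_cof[OF bifibrantD(1)[OF bi(1)] N(1,3)] fibrant_fib[OF bifibrantD(2)[OF bi(4)] N(2,5)]
    by (simp add: bifibrant_def)
  note sq = hpbD[OF h t(3,4,1)]
  have mk: "m \<cdot> k \<in> hom P N" using comp_in t N by blast
  have sq2: "square C P a N x \<pi> (m \<cdot> k) f \<psi>"
    unfolding square_def using mk t N(1,2) by (simp add: N(6)[THEN pre] sq(3))
      (simp add: cs N(6)[THEN pre] sq(3))
  have "hpb C \<pi> (m \<cdot> k) f \<psi>"
    using hpb_invariant[OF sq(1) sq2 Id_in_weq[OF o(2)] Id_in_weq[OF o(3)] N(1,4) Id_in_weq[OF o(4)]]
      h mk t N(6) by (simp add: cs)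
  then have "built C n (m \<cdot> k)"
    using base_changes_inD[OF built_base_change_fib[OF cube b] t(1) bN bi(2) N(2,5) t(3) mk] by blast
  moreover have "m \<cdot> k = (m \<cdot> k) \<cdot> Id C P" using mk by (simp add: cs)
  ultimately show ?thesis
    using built_backward[OF _ bi(2,1,2) bN t(4) mk Id_in[OF o(2)] N(1) Id_weq[OF o(2)] N(4)] by blast
qed

text \<open>Here \<open>\<pi>\<close> is replaced by a cofibration followed by an acyclic fibration.\<close>

lemma built_cobase_change:
  assumes b: "built C n f" and h: "hpo C \<pi> f k \<mu>"
    and t: "f \<in> hom p x" "\<pi> \<in> hom p A" "k \<in> hom A N" "\<mu> \<in> hom x N"
    and bi: "bifibrant C p" "bifibrant C x" "bifibrant C A" "bifibrant C N"
  shows "built C n k"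
proof -
  note o = bi[THEN bifibrantD(3)]
  obtain B m q where B: "m \<in> hom p B" "q \<in> hom B A" "m \<in> Cof C" "q \<in> Fib C" "q \<in> Weq C" "q \<cdot> m = \<pi>"
    using factor_afib[OF t(2)] .
  have bB: "bifibrant C B"
    using cofibrant_cof[OF bifibrantD(1)[OF bi(1)] B(1,3)] fibrant_fib[OF bifibrantD(2)[OF bi(3)] B(2,4)]
    by (simp add: bifibrant_def)
  note sq = hpoD[OF h t(2,1,3)]
  have kq: "k \<cdot> q \<in> hom B N" using comp_in t B by blast
  have sq2: "square C p B x N m f (k \<cdot> q) \<mu>"
    unfolding square_def using kq t B(1,2) by (simp add: cs B(6) sq(3))
  have "hpo C m f (k \<cdot> q) \<mu>"
    using hpo_invariant[OF sq2 sq(1) Id_in_weq[OF o(1)] B(2,5) Id_in_weq[OF o(2)] Id_in_weq[OF o(4)]]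
      h kq t B(6) by (simp add: cs)
  then have "built C n (k \<cdot> q)"
    using model_category.base_changes_inD[OF dual built_cobase_change_cof[OF b], of x p B N m \<mu> "k \<cdot> q"]
      t bB bi B kq hpo_sym by simp
  moreover have "Id C N \<cdot> (k \<cdot> q) = k \<cdot> q" using kq by (simp add: cs)
  ultimately show ?thesis
    using built_forward[OF _ bB bi(4,3,4) kq t(3) B(2) Id_in[OF o(4)] B(5) Id_weq[OF o(4)]] by blast
qed

end

section \<open>Strong relative category counts attachments\<close>

context model_category begin

lemma has_homotopy_inverse_iff:
  assumes f: "f \<in> hom a x" and bi: "bifibrant C a" "bifibrant C x"
  shows "has_homotopy_inverse C f \<longleftrightarrow> f \<in> Weq C"
proof -
  have d: "Dom C f = a" "Cod C f = x" using f by (simp_all add: Hom_iff)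
  show ?thesis
    unfolding has_homotopy_inverse_def d
    using homotopy_inverse[OF f _ bi] homotopy_equivalence_weq[OF f _ bi] by metis
qed

text \<open>Both ends of a homotopy are weakly equivalent, as maps, to the homotopy itself.\<close>

lemma built_homotopic:
  assumes b: "built C n f" and h: "homotopic C f g" and f: "f \<in> hom a x" and bi: "bifibrant C a" "bifibrant C x"
  shows "built C n g"
proof -
  note co = bifibrantD(1)[OF bi(1)] bifibrantD(2)[OF bi(2)] and o = bi[THEN bifibrantD(3)]
  obtain I :: "('o,'m) htpy" where I: "is_cylinder C a I" "proj I \<in> Fib C" using cylinder_exists[OF o(1)] .
  note Y = cylinderD[OF I(1)] and E = cylinder_ends[OF I(1)]
  have bI: "bifibrant C (cyl I)"
    using cofibrant_cof[OF co(1) Y(1) E(3)[OF co(1)]] fibrant_fib[OF bifibrantD(2)[OF bi(1)] Y(3) I(2)]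
    by (simp add: bifibrant_def)
  obtain k where k: "left_homotopy C (I\<lparr>hmap := k\<rparr>) f g"
    using left_of_right[OF right_homotopic[OF h f co(1)] f co(2) I(1)] .
  note D = left_homotopyD[OF k f, simplified]
  have "Id C x \<cdot> f = k \<cdot> end0 I" using D f by (simp add: cs)
  then have 1: "built C n k"
    using built_forward[OF b bi bI bi(2) f D(3) Y(1) Id_in[OF o(2)] E(1) Id_weq[OF o(2)]] by blast
  have "Id C x \<cdot> g = k \<cdot> end1 I" using D by (simp add: cs)
  then show ?thesis
    using built_backward[OF 1 bi bI bi(2) D(1,3) Y(2) Id_in[OF o(2)] E(2) Id_weq[OF o(2)]] by blast
qed

text \<open>An attachment given up to homotopy is rectified. The mapping cylinder of \<open>\<tau>\<close> makes the square commute, a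
  factorization of \<open>\<rho>\<close> makes the section strict by homotopy lifting, and pushing out along the acyclic
  cofibration \<open>z \<rightarrow> z'\<close> followed by fibrant replacement restores the map out of \<open>z'\<close>.\<close>

lemma built_attach_homotopy:
  assumes b: "built C n f" and h: "hpushout C \<rho> \<tau> \<iota> \<chi> H"
    and t: "f \<in> hom a x" "\<rho> \<in> hom z a" "\<tau> \<in> hom z x" "\<iota> \<in> hom a y" "\<sigma> \<in> hom a z"
    and hs: "homotopic C (\<rho> \<cdot> \<sigma>) (Id C a)" "homotopic C (\<tau> \<cdot> \<sigma>) f"
  shows "built C (Suc n) \<iota>"
proof -
  have hsq: "hsquare C \<rho> \<tau> \<iota> \<chi> H" using h by (simp add: hpushout_def)
  note S = hsquareD[OF hsq t(2,3,4)]
  note bz = S(2) and ba = S(3) and bx = S(4) and by' = S(5)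
  note o = bifibrantD(3)[OF ba] bifibrantD(3)[OF by'] bifibrantD(3)[OF bx]
  obtain M p v w q where M: "cofibrant C M" "p \<in> hom z M" "p \<in> Cof C" "v \<in> hom M y" "w \<in> hom M x" "w \<in> Weq C"
    "w \<cdot> p = \<tau>" "hpo C \<rho> p \<iota> v"
    using hpushoutE[OF h t(2,3,4)] by metis
  obtain z' j r where j: "j \<in> hom z z'" "r \<in> hom z' a" "j \<in> Cof C" "j \<in> Weq C" "r \<in> Fib C" "r \<cdot> j = \<rho>"
    using factor_acof[OF t(2)] .
  have bz': "bifibrant C z'"
    using cofibrant_cof[OF bifibrantD(1)[OF bz] j(1,3)] fibrant_fib[OF bifibrantD(2)[OF ba] j(2,5)]
    by (simp add: bifibrant_def)
  obtain M' p' jM where M': "pushout C j p M' p' jM" "p' \<in> hom z' M'" "jM \<in> hom M M'" "p' \<cdot> j = jM \<cdot> p"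
    using pushout_exists[OF j(1) M(2)] .
  have jM: "jM \<in> Cof C" "jM \<in> Weq C" using pushout_cof[OF M'(1) j(1) M(2) j(3)] pushout_acof[OF M'(1) j(1) M(2) j(3,4)] .
  have "M' \<in> Obj C" using M'(2) by (simp add: Hom_iff)
  then obtain N i where N: "fibrant C N" "i \<in> hom M' N" "i \<in> Cof C" "i \<in> Weq C" using fibrant_replacement by metis
  have bN: "bifibrant C N"
    using N(1) cofibrant_cof[OF cofibrant_cof[OF M(1) M'(3) jM(1)] N(2,3)] by (simp add: bifibrant_def)
  note sq = hpoD[OF M(8) t(2) M(2) t(4)]
  have "(\<iota> \<cdot> r) \<cdot> j = v \<cdot> p" using t(4) j(1,2) by (simp add: cs j(6) sq(3))
  then obtain v' where v': "v' \<in> hom M' y" "v' \<cdot> p' = \<iota> \<cdot> r" "v' \<cdot> jM = v"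
    using pushout_univ[OF M'(1) j(1) M(2) comp_in[OF j(2) t(4)] M(4)] by metis
  obtain v'' where v'': "v'' \<in> hom N y" "v'' \<cdot> i = v'"
    using fibrant_extend[OF bifibrantD(2)[OF by'] N(3,4,2) v'(1)] .
  obtain \<tau>' where \<tau>': "\<tau>' \<in> hom z' x" "\<tau>' \<cdot> j = \<tau>"
    using fibrant_extend[OF bifibrantD(2)[OF bx] j(3,4,1) t(3)] .
  have "\<tau>' \<cdot> j = w \<cdot> p" using \<tau>' M by simp
  then obtain w' where w': "w' \<in> hom M' x" "w' \<cdot> p' = \<tau>'" "w' \<cdot> jM = w"
    using pushout_univ[OF M'(1) j(1) M(2) \<tau>'(1) M(5)] by metis
  obtain w'' where w'': "w'' \<in> hom N x" "w'' \<cdot> i = w'"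
    using fibrant_extend[OF bifibrantD(2)[OF bx] N(3,4,2) w'(1)] .
  have ij: "i \<cdot> jM \<in> hom M N" "i \<cdot> jM \<in> Weq C"
    using comp_in[OF M'(3) N(2)] two_of_three(1)[OF M'(3) N(2) jM(2) N(4)] .
  have "w'' \<cdot> (i \<cdot> jM) = w" using w''(1) N(2) M'(3) w'(1) by (simp add: w''(2)[THEN pre] w'(3) cs)
  then have ww: "w'' \<in> Weq C" using two_of_three(2)[OF ij(1) w''(1) ij(2)] M(6) by simp
  have ip: "i \<cdot> p' \<in> hom z' N" using comp_in M' N by blast
  have vv: "v'' \<cdot> (i \<cdot> jM) = v" using v''(1) N(2) M'(3) v'(1) by (simp add: v''(2)[THEN pre] v'(3) cs)
  have sq2: "square C z' a N y r (i \<cdot> p') \<iota> v''"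
    unfolding square_def using j(2) ip t(4) v''(1) N(2) M'(2) by (simp add: v''(2)[THEN pre] v'(2) cs)
  have top: "hpo C r (i \<cdot> p') \<iota> v''"
    using hpo_invariant[OF sq(1) sq2 j(1,4) Id_in_weq[OF o(1)] ij Id_in_weq[OF o(2)]]
      M(8,2,4) t(2,4) j(1,2,6) M'(2,3,4) N(2) vv by (simp add: cs)
  have js: "j \<cdot> \<sigma> \<in> hom a z'" using comp_in t j by blast
  have "homotopic C (r \<cdot> (j \<cdot> \<sigma>)) (Id C a)" using hs(1) j t(5) by (simp add: j(6)[THEN pre] cs)
  then obtain s where s: "s \<in> hom a z'" "homotopic C (j \<cdot> \<sigma>) s" "r \<cdot> s = Id C a"
    using homotopy_lifting[OF j(2,5) js bifibrantD(1)[OF ba]] by metis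
  have "homotopic C (\<tau>' \<cdot> (j \<cdot> \<sigma>)) (\<tau>' \<cdot> s)" using homotopic_post[OF s(2) js \<tau>'(1)] .
  moreover have "\<tau>' \<cdot> (j \<cdot> \<sigma>) = \<tau> \<cdot> \<sigma>" using \<tau>' j(1) t(5) by (simp add: \<tau>'(2)[THEN pre] cs)
  moreover have wip: "w'' \<cdot> (i \<cdot> p') = \<tau>'" using w''(1) N(2) M'(2) w'(1) by (simp add: w''(2)[THEN pre] w'(2) cs)
  then have ws: "w'' \<cdot> ((i \<cdot> p') \<cdot> s) = \<tau>' \<cdot> s" using w''(1) ip s(1) assoc_hom[OF s(1) ip w''(1)] by simp
  ultimately have "homotopic C f (w'' \<cdot> ((i \<cdot> p') \<cdot> s))"
    using homotopic_trans[OF homotopic_sym[OF hs(2)] _ t(1) bifibrantD(1)[OF ba] bifibrantD(2)[OF bx]] by simp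
  then have "built C n (w'' \<cdot> ((i \<cdot> p') \<cdot> s))" using built_homotopic[OF b _ t(1) ba bx] by blast
  moreover have ips: "(i \<cdot> p') \<cdot> s \<in> hom a N" using comp_in ip s by blast
  moreover have "w'' \<cdot> ((i \<cdot> p') \<cdot> s) = (w'' \<cdot> ((i \<cdot> p') \<cdot> s)) \<cdot> Id C a" using comp_in[OF ips w''(1)] by (simp add: cs)
  ultimately have "built C n ((i \<cdot> p') \<cdot> s)"
    using built_backward[OF _ ba bN ba bx ips comp_in[OF ips w''(1)] Id_in[OF o(1)] w''(1) Id_weq[OF o(1)] ww] by blast
  then show ?thesis
    using built_attach[OF _ ba bN bz' by' j(2) ip t(4) v''(1) s(1,3) top] by blast
qed

lemma strong_relcat_le_0:
  assumes t: "\<iota> \<in> hom a x" and bi: "bifibrant C a" "bifibrant C x"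
  shows "strong_relcat_le C \<iota> 0 \<longleftrightarrow> \<iota> \<in> Weq C"
proof -
  have d: "Dom C \<iota> = a" "Cod C \<iota> = x" using t by (simp_all add: Hom_iff)
  show ?thesis
  proof
    assume "strong_relcat_le C \<iota> 0"
    then obtain i where i: "i \<in> hom a x" "has_homotopy_inverse C i" "homotopic C i \<iota>"
      unfolding strong_relcat_le_def d by auto
    then show "\<iota> \<in> Weq C" using has_homotopy_inverse_iff[OF i(1) bi] homotopic_weq[OF i(3,1)] by blast
  next
    assume "\<iota> \<in> Weq C"
    then have "has_homotopy_inverse C \<iota>" using has_homotopy_inverse_iff[OF t bi] by blast
    then show "strong_relcat_le C \<iota> 0"
      unfolding strong_relcat_le_def d using t bi homotopic_refl[OF t]
      by (intro exI[of _ "\<lambda>_. x"] exI[of _ "\<lambda>_. \<iota>"]) simp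
  qed
qed

lemma strong_relcat_le_SucE:
  assumes "strong_relcat_le C \<iota> (Suc n)" and t: "\<iota> \<in> hom a x"
  obtains x0 f z \<rho> \<tau> \<chi> H \<sigma> j where "strong_relcat_le C f n" "f \<in> hom a x0" "bifibrant C x0" "j \<in> hom a x"
    "\<rho> \<in> hom z a" "\<tau> \<in> hom z x0" "\<chi> \<in> hom x0 x" "hpushout C \<rho> \<tau> j \<chi> H" "\<sigma> \<in> hom a z"
    "homotopic C (\<rho> \<cdot> \<sigma>) (Id C a)" "homotopic C (\<tau> \<cdot> \<sigma>) f" "homotopic C j \<iota>"
proof -
  have d: "Dom C \<iota> = a" "Cod C \<iota> = x" using t by (simp_all add: Hom_iff)
  obtain X i where X: "X (Suc n) = x" "\<And>k. k \<le> Suc n \<Longrightarrow> bifibrant C (X k) \<and> i k \<in> hom a (X k)"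
    "has_homotopy_inverse C (i 0)"
    and s: "\<And>k. k < Suc n \<Longrightarrow> \<exists>Z \<rho> \<tau> \<chi> H \<sigma>.
           \<rho> \<in> Hom C Z a \<and> \<tau> \<in> Hom C Z (X k) \<and> \<chi> \<in> Hom C (X k) (X (Suc k)) \<and>
           hpushout C \<rho> \<tau> (i (Suc k)) \<chi> H \<and> \<sigma> \<in> Hom C a Z \<and>
           homotopic C (\<rho> \<cdot> \<sigma>) (Id C a) \<and> homotopic C (\<tau> \<cdot> \<sigma>) (i k)"
    and e: "homotopic C (i (Suc n)) \<iota>"
    using assms(1) unfolding strong_relcat_le_def d by blast
  have i: "i n \<in> hom a (X n)" "bifibrant C (X n)" "i (Suc n) \<in> hom a x" using X(1) X(2)[of n] X(2)[of "Suc n"] by auto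
  have d': "Dom C (i n) = a" "Cod C (i n) = X n" using i(1) by (simp_all add: Hom_iff)
  have "strong_relcat_le C (i n) n"
    unfolding strong_relcat_le_def d'
    by (intro exI[of _ X] exI[of _ i] conjI allI impI)
      (use X(2) X(3) s homotopic_refl[OF i(1)] in \<open>simp_all\<close>)
  moreover obtain Z \<rho> \<tau> \<chi> H \<sigma> where
    "\<rho> \<in> Hom C Z a \<and> \<tau> \<in> Hom C Z (X n) \<and> \<chi> \<in> Hom C (X n) (X (Suc n)) \<and>
           hpushout C \<rho> \<tau> (i (Suc n)) \<chi> H \<and> \<sigma> \<in> Hom C a Z \<and>
           homotopic C (\<rho> \<cdot> \<sigma>) (Id C a) \<and> homotopic C (\<tau> \<cdot> \<sigma>) (i n)" using s[of n] by auto
  ultimately show ?thesis using that[of "i n" "X n" "i (Suc n)" \<rho> Z \<tau> \<chi> H \<sigma>] i e X(1) by blast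
qed

lemma strong_relcat_le_SucI:
  assumes f: "strong_relcat_le C f n" "f \<in> hom a x0" and bi: "bifibrant C a" "bifibrant C x0" "bifibrant C x"
    and t: "\<iota> \<in> hom a x" "j \<in> hom a x" "\<rho> \<in> hom z a" "\<tau> \<in> hom z x0" "\<chi> \<in> hom x0 x" "\<sigma> \<in> hom a z"
    and h: "hpushout C \<rho> \<tau> j \<chi> H" "homotopic C (\<rho> \<cdot> \<sigma>) (Id C a)" "homotopic C (\<tau> \<cdot> \<sigma>) f" "homotopic C j \<iota>"
  shows "strong_relcat_le C \<iota> (Suc n)"
proof -
  have d: "Dom C \<iota> = a" "Cod C \<iota> = x" "Dom C f = a" "Cod C f = x0" using t f by (simp_all add: Hom_iff)
  obtain X i where X: "X n = x0" "\<And>k. k \<le> n \<Longrightarrow> bifibrant C (X k) \<and> i k \<in> hom a (X k)"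
    "has_homotopy_inverse C (i 0)"
    and s: "\<And>k. k < n \<Longrightarrow> \<exists>Z \<rho> \<tau> \<chi> H \<sigma>.
           \<rho> \<in> Hom C Z a \<and> \<tau> \<in> Hom C Z (X k) \<and> \<chi> \<in> Hom C (X k) (X (Suc k)) \<and>
           hpushout C \<rho> \<tau> (i (Suc k)) \<chi> H \<and> \<sigma> \<in> Hom C a Z \<and>
           homotopic C (\<rho> \<cdot> \<sigma>) (Id C a) \<and> homotopic C (\<tau> \<cdot> \<sigma>) (i k)"
    and e: "homotopic C (i n) f"
    using f(1) unfolding strong_relcat_le_def d by blast
  let ?X = "X(Suc n := x)" and ?i = "i(Suc n := j)"
  have "homotopic C (\<tau> \<cdot> \<sigma>) (i n)"
    using homotopic_trans[OF h(3) homotopic_sym[OF e] comp_in[OF t(6,4)]] bi by (simp add: bifibrant_def)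
  then have last: "\<rho> \<in> Hom C z a \<and> \<tau> \<in> Hom C z (?X n) \<and> \<chi> \<in> Hom C (?X n) (?X (Suc n)) \<and>
           hpushout C \<rho> \<tau> (?i (Suc n)) \<chi> H \<and> \<sigma> \<in> Hom C a z \<and>
           homotopic C (\<rho> \<cdot> \<sigma>) (Id C a) \<and> homotopic C (\<tau> \<cdot> \<sigma>) (?i n)" using t h X(1) by simp
  show ?thesis
    unfolding strong_relcat_le_def d
  proof (intro exI[of _ ?X] exI[of _ ?i] conjI allI impI)
    show "?X (Suc n) = x" "has_homotopy_inverse C (?i 0)" "homotopic C (?i (Suc n)) \<iota>" using X h by simp_all
    show "bifibrant C (?X k)" "?i k \<in> hom a (?X k)" if "k \<le> Suc n" for k
      using that X(2)[of k] bi t by (auto simp: le_Suc_eq)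
    fix k assume "k < Suc n"
    then consider "k < n" | "k = n" by linarith
    then show "\<exists>Z \<rho> \<tau> \<chi> H \<sigma>.
           \<rho> \<in> Hom C Z a \<and> \<tau> \<in> Hom C Z (?X k) \<and> \<chi> \<in> Hom C (?X k) (?X (Suc k)) \<and>
           hpushout C \<rho> \<tau> (?i (Suc k)) \<chi> H \<and> \<sigma> \<in> Hom C a Z \<and>
           homotopic C (\<rho> \<cdot> \<sigma>) (Id C a) \<and> homotopic C (\<tau> \<cdot> \<sigma>) (?i k)"
    proof cases
      case 1 then show ?thesis using s[of k] by simp
    next
      case 2 show ?thesis unfolding 2 using last by blast
    qed
  qed
qed

lemma built_of_strong_relcat:
  assumes "strong_relcat_le C \<iota> n" "\<iota> \<in> hom a x" "bifibrant C a" "bifibrant C x"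
  shows "built C n \<iota>"
  using assms
proof (induction n arbitrary: \<iota> x)
  case 0
  have "\<iota> \<in> Weq C" using strong_relcat_le_0[OF 0(2,3,4)] 0(1) by simp
  then show ?case by (rule built_0[OF 0(3,4,2)])
next
  case (Suc n)
  obtain x0 f z \<rho> \<tau> \<chi> H \<sigma> j where *: "strong_relcat_le C f n" "f \<in> hom a x0" "bifibrant C x0" "j \<in> hom a x"
    "\<rho> \<in> hom z a" "\<tau> \<in> hom z x0" "\<chi> \<in> hom x0 x" "hpushout C \<rho> \<tau> j \<chi> H" "\<sigma> \<in> hom a z"
    "homotopic C (\<rho> \<cdot> \<sigma>) (Id C a)" "homotopic C (\<tau> \<cdot> \<sigma>) f" "homotopic C j \<iota>"
    using strong_relcat_le_SucE[OF Suc.prems(1,2)] .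
  have "built C n f" using Suc.IH[OF *(1,2) Suc.prems(3) *(3)] .
  then have "built C (Suc n) j" using built_attach_homotopy[OF _ *(8,2,5,6,4,9,10,11)] by blast
  then show ?case using built_homotopic[OF _ *(12,4) Suc.prems(3,4)] by blast
qed

text \<open>A homotopy pushout along \<open>\<rho>\<close> is transported along weak equivalences of the target of \<open>\<rho>\<close> and of the
  pushout object, by comparing double mapping cylinders.\<close>

lemma hpushout_transport:
  assumes h: "hpushout C \<rho> \<tau> j \<chi> H" and t: "\<rho> \<in> hom z a" "\<tau> \<in> hom z x" "j \<in> hom a y"
    and w: "\<alpha> \<in> hom a a'" "\<alpha> \<in> Weq C" "\<xi> \<in> hom y y'" "\<xi> \<in> Weq C" and bi: "bifibrant C a'" "bifibrant C y'"
  obtains u v H' where "hpushout C (\<alpha> \<cdot> \<rho>) \<tau> u v H'" "u \<in> hom a' y'" "v \<in> hom x y'" "homotopic C (u \<cdot> \<alpha>) (\<xi> \<cdot> j)"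
proof -
  have hs: "hsquare C \<rho> \<tau> j \<chi> H" and dw: "dmc_comparison_weq C \<rho> \<tau> j \<chi> H"
    using h by (simp_all add: hpushout_def)
  note S = hsquareD[OF hs t]
  note co = bifibrantD(1)[OF S(2)] bifibrantD(1)[OF S(3)] bifibrantD(1)[OF S(4)]
  note Y = cylinderD[OF S(7)]
  obtain M p q where M: "pushout C (end1 H) \<tau> M p q" "p \<in> hom (cyl H) M" "q \<in> hom x M" "p \<cdot> end1 H = q \<cdot> \<tau>"
    using pushout_exists[OF Y(2) t(2)] .
  note MC = mapping_cylinder[OF S(7) t(2) co(1,3) M(1)]
  define k where "k = p \<cdot> end0 H"
  have k: "k \<in> hom z M" "k \<in> Cof C" unfolding k_def using MC(1,2) .
  obtain y0 where y0: "y0 \<in> hom M y" "y0 \<cdot> p = hmap H" "y0 \<cdot> q = \<chi>"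
    using pushout_univ[OF M(1) Y(2) t(2) S(8,1,10)] .
  have hp: "hpo C \<rho> k j y0" unfolding k_def using comparison_iff[OF S(7) t co M(1) y0 S(9)] dw by blast
  note sq = hpoD[OF hp t(1) k(1) t(3)]
  have ar: "\<alpha> \<cdot> \<rho> \<in> hom z a'" using comp_in t w by blast
  obtain D d m where D: "pushout C \<rho> k D d m" "d \<in> hom a D" "m \<in> hom M D" "d \<cdot> \<rho> = m \<cdot> k"
    using pushout_exists[OF t(1) k(1)] .
  obtain D' d' m' where D': "pushout C (\<alpha> \<cdot> \<rho>) k D' d' m'" "d' \<in> hom a' D'" "m' \<in> hom M D'" "d' \<cdot> (\<alpha> \<cdot> \<rho>) = m' \<cdot> k"
    using pushout_exists[OF ar k(1)] .
  have "(d' \<cdot> \<alpha>) \<cdot> \<rho> = m' \<cdot> k" using D'(2,4) w t by (simp add: cs)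
  then obtain \<delta> where \<delta>: "\<delta> \<in> hom D D'" "\<delta> \<cdot> d = d' \<cdot> \<alpha>" "\<delta> \<cdot> m = m'"
    using pushout_univ[OF D(1) t(1) k(1) comp_in[OF w(1) D'(2)] D'(3)] by metis
  have \<delta>w: "\<delta> \<in> Weq C"
    using glue_leg[OF pushout_sym[OF D(1)] pushout_sym[OF D'(1)] k t(1) w(1,2) co(2) bifibrantD(1)[OF bi(1)] \<delta>(1,3,2)] .
  have cD: "cofibrant C D" "cofibrant C D'"
    using cofibrant_cof[OF co(2) D(2) pushout_cof[OF pushout_sym[OF D(1)] k(1) t(1) k(2)]]
      cofibrant_cof[OF bifibrantD(1)[OF bi(1)] D'(2) pushout_cof[OF pushout_sym[OF D'(1)] k(1) ar k(2)]] .
  obtain e where e: "e \<in> hom D y" "e \<cdot> d = j" "e \<cdot> m = y0" using pushout_univ[OF D(1) t(1) k(1) t(3) y0(1) sq(3)] .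
  have ew: "e \<in> Weq C" using hpo_pushout_iff[OF D(1) t(1) k co(1,2) e(1)] hp e by simp
  have xe: "\<xi> \<cdot> e \<in> hom D y'" "\<xi> \<cdot> e \<in> Weq C" using comp_in[OF e(1) w(3)] two_of_three(1)[OF e(1) w(3) ew w(4)] .
  obtain e' where e': "e' \<in> hom D' y'" "homotopic C (e' \<cdot> \<delta>) (\<xi> \<cdot> e)"
    using weq_extend[OF \<delta>(1) \<delta>w cD xe(1) bifibrantD(2)[OF bi(2)]] .
  have "e' \<cdot> \<delta> \<in> Weq C" using homotopic_weq[OF homotopic_sym[OF e'(2)] xe] .
  then have ew': "e' \<in> Weq C" using two_of_three(2)[OF \<delta>(1) e'(1) \<delta>w] by blast
  let ?H = "H\<lparr>hmap := e' \<cdot> m' \<cdot> p\<rparr>"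
  have em: "e' \<cdot> d' \<in> hom a' y'" "e' \<cdot> m' \<in> hom M y'" "e' \<cdot> m' \<cdot> p \<in> hom (cyl H) y'" "e' \<cdot> m' \<cdot> q \<in> hom x y'"
    using comp_in e' D' M(2,3) by blast+
  have e0: "e' \<cdot> m' \<cdot> p \<cdot> end0 H = e' \<cdot> d' \<cdot> (\<alpha> \<cdot> \<rho>)"
    using e'(1) D'(2,3) M(2) Y(1) w(1) t(1) by (simp add: D'(4) cs k_def[symmetric])
  have e1: "e' \<cdot> m' \<cdot> p \<cdot> end1 H = e' \<cdot> m' \<cdot> q \<cdot> \<tau>"
    using e'(1) D'(3) M(2,3) Y(2) t(2) by (simp add: M(4) cs)
  have "left_homotopy C ?H (e' \<cdot> d' \<cdot> (\<alpha> \<cdot> \<rho>)) (e' \<cdot> m' \<cdot> q \<cdot> \<tau>)"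
    using S(7) em(3) e0 e1 by (intro left_homotopyI[of z _ y']) simp_all
  then have hs': "hsquare C (\<alpha> \<cdot> \<rho>) \<tau> (e' \<cdot> d') (e' \<cdot> m' \<cdot> q) ?H"
    using hsquareI[OF S(2) bi(1) S(4) bi(2) ar t(2) em(1,4)] by blast
  have "hpo C (\<alpha> \<cdot> \<rho>) k (e' \<cdot> d') (e' \<cdot> m')"
    using hpo_pushout_iff[OF D'(1) ar k co(1) bifibrantD(1)[OF bi(1)] e'(1)] ew' by blast
  then have "dmc_comparison_weq C (\<alpha> \<cdot> \<rho>) \<tau> (e' \<cdot> d') (e' \<cdot> m' \<cdot> q) ?H"
    using comparison_iff[of z ?H "\<alpha> \<cdot> \<rho>" a' \<tau> x "e' \<cdot> d'" y' M p q "e' \<cdot> m'" "e' \<cdot> m' \<cdot> q"]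
      S(7) ar t(2) em co bifibrantD(1)[OF bi(1)] M(1) e0 by (simp add: k_def)
  then have hpu: "hpushout C (\<alpha> \<cdot> \<rho>) \<tau> (e' \<cdot> d') (e' \<cdot> m' \<cdot> q) ?H" using hs' by (simp add: hpushout_def)
  have "homotopic C ((e' \<cdot> \<delta>) \<cdot> d) ((\<xi> \<cdot> e) \<cdot> d)"
    using homotopic_pre[OF e'(2) comp_in[OF \<delta>(1) e'(1)] D(2) cD(1) co(2) bifibrantD(2)[OF bi(2)]] .
  moreover have "(e' \<cdot> \<delta>) \<cdot> d = (e' \<cdot> d') \<cdot> \<alpha>" "(\<xi> \<cdot> e) \<cdot> d = \<xi> \<cdot> j"
    using e'(1) \<delta>(1) D(2) D'(2) w(1,3) e(1) by (simp_all add: cs \<delta>(2) e(2))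
  ultimately show ?thesis using that[OF hpu em(1,4)] by simp
qed

text \<open>All stages but the last keep their objects; only the source of the structure maps is changed, by composition with
  a homotopy inverse of \<open>\<alpha>\<close>.\<close>

lemma strong_relcat_transport:
  assumes "strong_relcat_le C f n" "f \<in> hom a x" "g \<in> hom a' x'" "\<alpha> \<in> hom a a'" "\<alpha> \<in> Weq C" "\<xi> \<in> hom x x'" "\<xi> \<in> Weq C"
    "bifibrant C a" "bifibrant C x" "bifibrant C a'" "bifibrant C x'" "homotopic C (\<xi> \<cdot> f) (g \<cdot> \<alpha>)"
  shows "strong_relcat_le C g n"
  using assms
proof (induction n arbitrary: f g x x' \<xi>)
  case 0
  have "f \<in> Weq C" using strong_relcat_le_0[OF 0(2,8,9)] 0(1) by blast
  then have "\<xi> \<cdot> f \<in> Weq C" using two_of_three(1)[OF 0(2,6)] 0(7) by blast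
  then have "g \<cdot> \<alpha> \<in> Weq C" using homotopic_weq[OF 0(12) comp_in[OF 0(2,6)]] by blast
  then have "g \<in> Weq C" using two_of_three(2)[OF 0(4,3,5)] by blast
  then show ?case using strong_relcat_le_0[OF 0(3,10,11)] by blast
next
  case (Suc n)
  note t = Suc.prems(2,3,4,6) and w = Suc.prems(5,7) and bi = Suc.prems(8-11)
  note co = bi[THEN bifibrantD(1)] and fi = bi[THEN bifibrantD(2)] and o = bi[THEN bifibrantD(3)]
  obtain x0 f0 z \<rho> \<tau> \<chi> H \<sigma> j where *: "strong_relcat_le C f0 n" "f0 \<in> hom a x0" "bifibrant C x0" "j \<in> hom a x"
    "\<rho> \<in> hom z a" "\<tau> \<in> hom z x0" "\<chi> \<in> hom x0 x" "hpushout C \<rho> \<tau> j \<chi> H" "\<sigma> \<in> hom a z"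
    "homotopic C (\<rho> \<cdot> \<sigma>) (Id C a)" "homotopic C (\<tau> \<cdot> \<sigma>) f0" "homotopic C j f"
    using strong_relcat_le_SucE[OF Suc.prems(1) t(1)] .
  note fi0 = bifibrantD(2)[OF *(3)] and o0 = bifibrantD(3)[OF *(3)]
  obtain u v H' where H': "hpushout C (\<alpha> \<cdot> \<rho>) \<tau> u v H'" "u \<in> hom a' x'" "v \<in> hom x0 x'" "homotopic C (u \<cdot> \<alpha>) (\<xi> \<cdot> j)"
    using hpushout_transport[OF *(8,5,6,4) t(3) w(1) t(4) w(2) bi(3,4)] .
  obtain \<beta> where \<beta>: "\<beta> \<in> hom a' a" "homotopic C (\<beta> \<cdot> \<alpha>) (Id C a)" "homotopic C (\<alpha> \<cdot> \<beta>) (Id C a')"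
    using homotopy_inverse[OF t(3) w(1) bi(1,3)] .
  have g0: "f0 \<cdot> \<beta> \<in> hom a' x0" using comp_in * \<beta> by blast
  have "homotopic C (f0 \<cdot> (\<beta> \<cdot> \<alpha>)) (f0 \<cdot> Id C a)" using homotopic_post[OF \<beta>(2) comp_in[OF t(3) \<beta>(1)] *(2)] .
  then have "homotopic C (Id C x0 \<cdot> f0) ((f0 \<cdot> \<beta>) \<cdot> \<alpha>)"
    using homotopic_sym *(2) \<beta>(1) t(3) by (simp add: cs)
  then have b: "strong_relcat_le C (f0 \<cdot> \<beta>) n"
    using Suc.IH[OF *(1,2) g0 t(3) w(1) Id_in[OF o0] Id_weq[OF o0] bi(1) *(3) bi(3) *(3)] by blast
  have rs: "\<rho> \<cdot> \<sigma> \<in> hom a a" "\<tau> \<cdot> \<sigma> \<in> hom a x0" using comp_in * by blast+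
  have "homotopic C ((\<alpha> \<cdot> (\<rho> \<cdot> \<sigma>)) \<cdot> \<beta>) ((\<alpha> \<cdot> Id C a) \<cdot> \<beta>)"
    using homotopic_pre[OF homotopic_post[OF *(10) rs(1) t(3)] comp_in[OF rs(1) t(3)] \<beta>(1) co(1,3) fi(3)] .
  moreover have "(\<alpha> \<cdot> (\<rho> \<cdot> \<sigma>)) \<cdot> \<beta> = (\<alpha> \<cdot> \<rho>) \<cdot> (\<sigma> \<cdot> \<beta>)" "(\<alpha> \<cdot> Id C a) \<cdot> \<beta> = \<alpha> \<cdot> \<beta>"
    using t(3) *(5,9) \<beta>(1) o by (simp_all add: cs)
  moreover have asb: "(\<alpha> \<cdot> \<rho>) \<cdot> (\<sigma> \<cdot> \<beta>) \<in> hom a' a'" using comp_in t(3) * \<beta>(1) by blast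
  ultimately have h1: "homotopic C ((\<alpha> \<cdot> \<rho>) \<cdot> (\<sigma> \<cdot> \<beta>)) (Id C a')"
    using homotopic_trans[OF _ \<beta>(3) asb co(3) fi(3)] by simp
  have "homotopic C ((\<tau> \<cdot> \<sigma>) \<cdot> \<beta>) (f0 \<cdot> \<beta>)"
    using homotopic_pre[OF *(11) rs(2) \<beta>(1) co(1,3) fi0] .
  then have h2: "homotopic C (\<tau> \<cdot> (\<sigma> \<cdot> \<beta>)) (f0 \<cdot> \<beta>)" using *(6,9) \<beta>(1) by (simp add: cs)
  have "homotopic C (\<xi> \<cdot> j) (g \<cdot> \<alpha>)"
    using homotopic_trans[OF homotopic_post[OF *(12,4) t(4)] Suc.prems(12) comp_in[OF *(4) t(4)] co(1) fi(4)] .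
  then have "homotopic C (u \<cdot> \<alpha>) (g \<cdot> \<alpha>)"
    using homotopic_trans[OF H'(4) _ comp_in[OF t(3) H'(2)] co(1) fi(4)] by blast
  then have ug: "homotopic C u g" using weq_cancel[OF t(3) w(1) co(1,3) H'(2) t(2) fi(4)] by blast
  show ?case
    using strong_relcat_le_SucI[OF b g0 bi(3) *(3) bi(4) t(2) H'(2) comp_in[OF *(5) t(3)] *(6) H'(3) comp_in[OF \<beta>(1) *(9)]
        H'(1) h1 h2 ug] .
qed

lemma strong_relcat_of_built: "built C n f \<Longrightarrow> strong_relcat_le C f n"
proof (induction rule: built.induct)
  case (built_0 a x f)
  then show ?case using strong_relcat_le_0[OF built_0(3,1,2)] by simp
next
  case (built_attach n \<tau> \<sigma> a x z y \<rho> \<iota> \<chi>)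
  note bi = built_attach(2-5) and t = built_attach(6-10)
  obtain I :: "('o,'m) htpy" where I: "is_cylinder C z I" using cylinder_exists[OF bifibrantD(3)[OF bi(3)]] .
  have "hpushout C \<rho> \<tau> \<iota> \<chi> (const_htpy C I (\<iota> \<cdot> \<rho>))"
    using hpushout_const_iff[OF hpoD(1)[OF built_attach(12) t(1,2,3)] I bi(3,1,2,4)] built_attach(12) by blast
  moreover have "homotopic C (\<rho> \<cdot> \<sigma>) (Id C a)" using built_attach(11) homotopic_refl comp_in[OF t(5,1)] by metis
  ultimately show ?case
    using strong_relcat_le_SucI[OF built_attach.IH comp_in[OF t(5,2)] bi(1,2,4) t(3,3,1,2,4,5)]
      homotopic_refl[OF comp_in[OF t(5,2)]] homotopic_refl[OF t(3)] by blast
next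
  case (built_forward n f a x a' x' g \<alpha> \<xi>)
  note bi = built_forward(2-5) and t = built_forward(6-9) and w = built_forward(10,11)
  show ?case
    using strong_relcat_transport[OF built_forward.IH t(1,2,3) w(1) t(4) w(2) bi]
      homotopic_refl[OF comp_in[OF t(1,4)]] built_forward(12) by simp
next
  case (built_backward n g a x a' x' f \<alpha> \<xi>)
  note bi = built_backward(2-5) and t = built_backward(6-9) and w = built_backward(10,11)
  note co = bi[THEN bifibrantD(1)] and fi = bi[THEN bifibrantD(2)] and o = bi[THEN bifibrantD(3)]
  obtain \<beta> where \<beta>: "\<beta> \<in> hom a' a" "homotopic C (\<alpha> \<cdot> \<beta>) (Id C a')" "\<beta> \<in> Weq C"
    using homotopy_inverse[OF t(3) w(1) bi(1,3)] by metis
  obtain \<zeta> where \<zeta>: "\<zeta> \<in> hom x' x" "homotopic C (\<zeta> \<cdot> \<xi>) (Id C x)" "\<zeta> \<in> Weq C"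
    using homotopy_inverse[OF t(4) w(2) bi(2,4)] by metis
  have ab: "\<alpha> \<cdot> \<beta> \<in> hom a' a'" and zg: "\<zeta> \<cdot> g \<in> hom a' x" and fb: "f \<cdot> \<beta> \<in> hom a' x" and zx: "\<zeta> \<cdot> \<xi> \<in> hom x x"
    using comp_in t \<beta> \<zeta> by blast+
  have "homotopic C ((\<zeta> \<cdot> g) \<cdot> (\<alpha> \<cdot> \<beta>)) ((\<zeta> \<cdot> g) \<cdot> Id C a')" using homotopic_post[OF \<beta>(2) ab zg] .
  moreover have "(\<zeta> \<cdot> g) \<cdot> (\<alpha> \<cdot> \<beta>) = (\<zeta> \<cdot> \<xi>) \<cdot> (f \<cdot> \<beta>)"
    using \<zeta>(1) t \<beta>(1) built_backward(12)[symmetric, THEN pre] by (simp add: cs)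
  ultimately have "homotopic C (\<zeta> \<cdot> g) ((\<zeta> \<cdot> \<xi>) \<cdot> (f \<cdot> \<beta>))"
    using homotopic_sym zg by (simp add: cs)
  moreover have "homotopic C ((\<zeta> \<cdot> \<xi>) \<cdot> (f \<cdot> \<beta>)) (Id C x \<cdot> (f \<cdot> \<beta>))"
    using homotopic_pre[OF \<zeta>(2) zx fb co(2,3) fi(2)] .
  ultimately have "homotopic C (\<zeta> \<cdot> g) (f \<cdot> \<beta>)"
    using homotopic_trans[OF _ _ zg co(3) fi(2)] fb by (simp add: cs)
  then show ?case
    using strong_relcat_transport[OF built_backward.IH t(2,1) \<beta>(1,3) \<zeta>(1,3) bi(3,4,1,2)] by blast
qed

lemma strong_relcat_iff_built:
  "\<iota> \<in> hom a x \<Longrightarrow> bifibrant C a \<Longrightarrow> bifibrant C x \<Longrightarrow> strong_relcat_le C \<iota> n \<longleftrightarrow> built C n \<iota>"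
  using built_of_strong_relcat strong_relcat_of_built by blast

end

section \<open>Relative category and retracts of built maps\<close>

text \<open>This will be seen to say that the relative category of \<open>\<iota>\<close> is at most \<open>n\<close>.\<close>

definition retract_built :: "('o, 'm) mcat \<Rightarrow> nat \<Rightarrow> 'm \<Rightarrow> bool" where
  "retract_built C n \<iota> \<longleftrightarrow>
     (\<exists>x K r s. Cod C \<iota> = x \<and> bifibrant C K \<and> r \<in> Hom C K x \<and> s \<in> Hom C x K \<and>
        homotopic C (comp C r s) (Id C x) \<and> built C n (comp C s \<iota>))"

context model_category begin

lemma retract_builtI:
  assumes "\<iota> \<in> hom a x" "bifibrant C K" "r \<in> hom K x" "s \<in> hom x K" "homotopic C (r \<cdot> s) (Id C x)" "built C n (s \<cdot> \<iota>)"
  shows "retract_built C n \<iota>"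
proof -
  have "Cod C \<iota> = x" using assms(1) by (simp add: Hom_iff)
  with assms show ?thesis unfolding retract_built_def by blast
qed

lemma retract_builtE:
  assumes "retract_built C n \<iota>" "\<iota> \<in> hom a x"
  obtains K r s where "bifibrant C K" "r \<in> hom K x" "s \<in> hom x K" "homotopic C (r \<cdot> s) (Id C x)" "built C n (s \<cdot> \<iota>)"
proof -
  have "Cod C \<iota> = x" using assms(2) by (simp add: Hom_iff)
  with assms(1) show ?thesis using that unfolding retract_built_def by blast
qed

text \<open>After replacing \<open>r\<close> by a fibration, \<open>s\<close> is deformed into a strict section, which preserves the class of
  \<open>s \<cdot> \<iota>\<close> up to homotopy.\<close>

lemma retract_built_strict:
  assumes "retract_built C n \<iota>" "\<iota> \<in> hom a x" and bi: "bifibrant C a" "bifibrant C x"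
  obtains K r s where "bifibrant C K" "r \<in> hom K x" "s \<in> hom x K" "r \<cdot> s = Id C x" "built C n (s \<cdot> \<iota>)"
proof -
  note t = assms(2) and o = bi[THEN bifibrantD(3)]
  obtain K r s where K: "bifibrant C K" "r \<in> hom K x" "s \<in> hom x K" "homotopic C (r \<cdot> s) (Id C x)" "built C n (s \<cdot> \<iota>)"
    using retract_builtE[OF assms(1,2)] .
  obtain E j p where E: "j \<in> hom K E" "p \<in> hom E x" "j \<in> Cof C" "j \<in> Weq C" "p \<in> Fib C" "p \<cdot> j = r"
    using factor_acof[OF K(2)] .
  have bE: "bifibrant C E"
    using cofibrant_cof[OF bifibrantD(1)[OF K(1)] E(1,3)] fibrant_fib[OF bifibrantD(2)[OF bi(2)] E(2,5)]
    by (simp add: bifibrant_def)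
  have js: "j \<cdot> s \<in> hom x E" "s \<cdot> \<iota> \<in> hom a K" "j \<cdot> s \<cdot> \<iota> \<in> hom a E" using comp_in E K t by blast+
  have "homotopic C (p \<cdot> (j \<cdot> s)) (Id C x)" using K(4,3) E(1,2) by (simp add: E(6)[THEN pre] cs)
  then obtain s' where s': "s' \<in> hom x E" "homotopic C (j \<cdot> s) s'" "p \<cdot> s' = Id C x"
    using homotopy_lifting[OF E(2,5) js(1) bifibrantD(1)[OF bi(2)]] by metis
  have "j \<cdot> (s \<cdot> \<iota>) = (j \<cdot> s \<cdot> \<iota>) \<cdot> Id C a" using E(1) K(3) t o by (simp add: cs)
  then have "built C n (j \<cdot> s \<cdot> \<iota>)"
    using built_forward[OF K(5) bi(1) K(1) bi(1) bE js(2,3) Id_in[OF o(1)] E(1) Id_weq[OF o(1)] E(4)] by blast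
  moreover have "homotopic C (j \<cdot> s \<cdot> \<iota>) (s' \<cdot> \<iota>)"
    using homotopic_pre[OF s'(2) js(1) t bifibrantD(1)[OF bi(2)] bifibrantD(1)[OF bi(1)] bifibrantD(2)[OF bE]] .
  ultimately have "built C n (s' \<cdot> \<iota>)" using built_homotopic[OF _ _ js(3) bi(1) bE] by blast
  then show ?thesis using that[OF bE E(2) s'(1,3)] by blast
qed

lemma retract_built_target:
  assumes t: "\<iota> \<in> hom a x" "w \<in> hom x x'" "w \<in> Weq C" and bi: "bifibrant C a" "bifibrant C x" "bifibrant C x'"
  shows "retract_built C n \<iota> \<longleftrightarrow> retract_built C n (w \<cdot> \<iota>)"
proof -
  note co = bi[THEN bifibrantD(1)] and fi = bi[THEN bifibrantD(2)] and o = bi[THEN bifibrantD(3)]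
  obtain v where v: "v \<in> hom x' x" "homotopic C (v \<cdot> w) (Id C x)" "homotopic C (w \<cdot> v) (Id C x')"
    using homotopy_inverse[OF t(2,3) bi(2,3)] .
  have wi: "w \<cdot> \<iota> \<in> hom a x'" using comp_in t by blast
  show ?thesis
  proof
    assume "retract_built C n \<iota>"
    then obtain K r s where K: "bifibrant C K" "r \<in> hom K x" "s \<in> hom x K" "homotopic C (r \<cdot> s) (Id C x)" "built C n (s \<cdot> \<iota>)"
      using retract_builtE[OF _ t(1)] by blast
    have si: "s \<cdot> \<iota> \<in> hom a K" "s \<cdot> v \<in> hom x' K" "w \<cdot> r \<in> hom K x'" "r \<cdot> s \<in> hom x x" using comp_in K t v by blast+
    have "homotopic C (w \<cdot> (r \<cdot> s) \<cdot> v) (w \<cdot> Id C x \<cdot> v)"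
      using homotopic_pre[OF homotopic_post[OF K(4) si(4) t(2)] comp_in[OF si(4) t(2)] v(1) co(2,3) fi(3)] .
    then have "homotopic C ((w \<cdot> r) \<cdot> (s \<cdot> v)) (w \<cdot> v)" using t(2) K(2,3) v(1) o by (simp add: cs)
    then have 1: "homotopic C ((w \<cdot> r) \<cdot> (s \<cdot> v)) (Id C x')"
      using homotopic_trans[OF _ v(3) comp_in[OF si(2,3)] co(3) fi(3)] by blast
    have "homotopic C ((v \<cdot> w) \<cdot> \<iota>) (Id C x \<cdot> \<iota>)"
      using homotopic_pre[OF v(2) comp_in[OF t(2) v(1)] t(1) co(2,1) fi(2)] .
    from homotopic_post[OF this comp_in[OF t(1) comp_in[OF t(2) v(1)]] K(3)]
    have "homotopic C ((s \<cdot> v) \<cdot> (w \<cdot> \<iota>)) (s \<cdot> \<iota>)" using K(3) t v(1) by (simp add: cs)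
    then have "homotopic C (s \<cdot> \<iota>) ((s \<cdot> v) \<cdot> (w \<cdot> \<iota>))" by (rule homotopic_sym)
    then have "built C n ((s \<cdot> v) \<cdot> (w \<cdot> \<iota>))" using built_homotopic[OF K(5) _ si(1) bi(1) K(1)] by blast
    then show "retract_built C n (w \<cdot> \<iota>)" using retract_builtI[OF wi K(1) si(3,2) 1] by blast
  next
    assume "retract_built C n (w \<cdot> \<iota>)"
    then obtain K r s where K: "bifibrant C K" "r \<in> hom K x'" "s \<in> hom x' K" "homotopic C (r \<cdot> s) (Id C x')" "built C n (s \<cdot> (w \<cdot> \<iota>))"
      using retract_builtE[OF _ wi] by blast
    have si: "s \<cdot> w \<in> hom x K" "v \<cdot> r \<in> hom K x" "r \<cdot> s \<in> hom x' x'" using comp_in K t v by blast+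
    have "homotopic C (v \<cdot> (r \<cdot> s) \<cdot> w) (v \<cdot> Id C x' \<cdot> w)"
      using homotopic_pre[OF homotopic_post[OF K(4) si(3) v(1)] comp_in[OF si(3) v(1)] t(2) co(3,2) fi(2)] .
    then have "homotopic C ((v \<cdot> r) \<cdot> (s \<cdot> w)) (v \<cdot> w)" using t(2) K(2,3) v(1) o by (simp add: cs)
    then have 1: "homotopic C ((v \<cdot> r) \<cdot> (s \<cdot> w)) (Id C x)"
      using homotopic_trans[OF _ v(2) comp_in[OF si(1,2)] co(2) fi(2)] by blast
    have "(s \<cdot> w) \<cdot> \<iota> = s \<cdot> (w \<cdot> \<iota>)" using K(3) t by (simp add: cs)
    then show "retract_built C n \<iota>" using retract_builtI[OF t(1) K(1) si(2,1) 1] K(5) by simp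
  qed
qed

text \<open>A strict section pulls back to a strict section, and \<open>s' \<cdot> k\<close> is a base change of \<open>s \<cdot> \<iota>\<close> by pasting homotopy
  pullbacks.\<close>

lemma retract_built_base_change:
  assumes cube: "cube_axiom C" and b: "retract_built C n \<iota>" and h: "hpb C \<pi> k \<iota> \<phi>"
    and t: "\<iota> \<in> hom a y" "\<phi> \<in> hom M y" "\<phi> \<in> Fib C" "\<pi> \<in> hom P a" "k \<in> hom P M"
    and bi: "bifibrant C M" "bifibrant C P" "bifibrant C a" "bifibrant C y"
  shows "retract_built C n k"
proof -
  note o = bi[THEN bifibrantD(3)]
  obtain K r s where K: "bifibrant C K" "r \<in> hom K y" "s \<in> hom y K" "r \<cdot> s = Id C y" "built C n (s \<cdot> \<iota>)"
    using retract_built_strict[OF b t(1) bi(3,4)] .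
  obtain K' pa pm where K': "bifibrant C K'" "pa \<in> hom K' K" "pa \<in> Fib C" "pm \<in> hom K' M" "r \<cdot> pa = \<phi> \<cdot> pm"
    "hpb C pa pm r \<phi>"
    and lift: "\<And>T t s. cofibrant C T \<Longrightarrow> t \<in> hom T K \<Longrightarrow> s \<in> hom T M \<Longrightarrow> r \<cdot> t = \<phi> \<cdot> s \<Longrightarrow>
      \<exists>l \<in> hom T K'. pa \<cdot> l = t \<and> pm \<cdot> l = s"
    using hpb_exists[OF K(2) t(2,3) bifibrantD(2)[OF K(1)] bifibrantD(2)[OF bi(4)]] by (metis (no_types, lifting))
  have "r \<cdot> (s \<cdot> \<phi>) = \<phi> \<cdot> Id C M" using K(2,3) t(2) o by (simp add: K(4)[THEN pre] cs)
  then obtain s' where s': "s' \<in> hom M K'" "pa \<cdot> s' = s \<cdot> \<phi>" "pm \<cdot> s' = Id C M"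
    using lift[OF bifibrantD(1)[OF bi(1)] comp_in[OF t(2) K(3)] Id_in[OF o(1)]] by blast
  note sq = hpbD[OF h t(4,5,1)]
  have sk: "s' \<cdot> k \<in> hom P K'" "s \<cdot> \<iota> \<in> hom a K" using comp_in s' t K by blast+
  have sq2: "square C P K' a K (s' \<cdot> k) \<pi> pa (s \<cdot> \<iota>)"
    unfolding square_def using sk t K'(2) s'(1) K(3) by (simp add: s'(2)[THEN pre] sq(3) cs)
  have "pm \<cdot> (s' \<cdot> k) = k" "r \<cdot> (s \<cdot> \<iota>) = \<iota>"
    using K'(4) s'(1) t K(2,3) by (simp_all add: s'(3)[THEN pre] K(4)[THEN pre] cs)
  then have "hpb C (s' \<cdot> k) \<pi> pa (s \<cdot> \<iota>)"
    using hpb_paste[OF hpb_sym[OF K'(6)] K'(4,2) t(2) sq2] hpb_sym[OF h] by simp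
  then have "built C n (s' \<cdot> k)"
    using built_base_change[OF cube K(5) hpb_sym sk(2) K'(2) t(4) sk(1) K'(1) bi(2,3) K(1)] by blast
  moreover have "homotopic C (pm \<cdot> s') (Id C M)" using s'(3) homotopic_refl[OF Id_in[OF o(1)]] by simp
  ultimately show ?thesis using retract_builtI[OF t(5) K'(1,4) s'(1)] by blast
qed

text \<open>A strict section that is a cofibration is pushed out along \<open>\<mu>\<close>; its retraction extends because \<open>N\<close> is fibrant.\<close>

lemma retract_built_cobase_change:
  assumes b: "retract_built C n z" and h: "hpo C \<pi> z k \<mu>"
    and t: "z \<in> hom p x" "\<pi> \<in> hom p A" "k \<in> hom A N" "\<mu> \<in> hom x N"
    and bi: "bifibrant C p" "bifibrant C x" "bifibrant C A" "bifibrant C N"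
  shows "retract_built C n k"
proof -
  note o = bi[THEN bifibrantD(3)]
  obtain K r s where K: "bifibrant C K" "r \<in> hom K x" "s \<in> hom x K" "r \<cdot> s = Id C x" "built C n (s \<cdot> z)"
    using retract_built_strict[OF b t(1) bi(1,2)] .
  obtain K1 s1 c where K1: "s1 \<in> hom x K1" "c \<in> hom K1 K" "s1 \<in> Cof C" "c \<in> Fib C" "c \<in> Weq C" "c \<cdot> s1 = s"
    using factor_afib[OF K(3)] .
  have b1: "bifibrant C K1"
    using cofibrant_cof[OF bifibrantD(1)[OF bi(2)] K1(1,3)] fibrant_fib[OF bifibrantD(2)[OF K(1)] K1(2,4)]
    by (simp add: bifibrant_def)
  have sz: "s1 \<cdot> z \<in> hom p K1" "s \<cdot> z \<in> hom p K" "r \<cdot> c \<in> hom K1 x" using comp_in t K K1 by blast+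
  have rs: "(r \<cdot> c) \<cdot> s1 = Id C x" using K(2) K1(1,2) by (simp add: K1(6) K(4) cs)
  have "c \<cdot> (s1 \<cdot> z) = (s \<cdot> z) \<cdot> Id C p" using K1(1,2) t(1) K(3) o by (simp add: K1(6)[THEN pre] cs)
  then have bs: "built C n (s1 \<cdot> z)"
    using built_backward[OF K(5) bi(1) b1 bi(1) K(1) sz(1,2) Id_in[OF o(1)] K1(2) Id_weq[OF o(1)] K1(5)] by blast
  obtain W pN kW where W: "bifibrant C W" "pN \<in> hom N W" "pN \<in> Cof C" "kW \<in> hom K1 W" "pN \<cdot> \<mu> = kW \<cdot> s1"
    "hpo C \<mu> s1 pN kW"
    and lift: "\<And>T t s. fibrant C T \<Longrightarrow> t \<in> hom N T \<Longrightarrow> s \<in> hom K1 T \<Longrightarrow> t \<cdot> \<mu> = s \<cdot> s1 \<Longrightarrow>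
      \<exists>l \<in> hom W T. l \<cdot> pN = t \<and> l \<cdot> kW = s"
    using hpo_exists[OF t(4) K1(1,3) bifibrantD(1)[OF bi(4)] bifibrantD(1)[OF bi(2)]] by (metis (no_types, lifting))
  have "Id C N \<cdot> \<mu> = (\<mu> \<cdot> (r \<cdot> c)) \<cdot> s1" using t(4) K1(1) o assoc_hom[OF K1(1) sz(3) t(4)] by (simp add: rs Id_left Id_right Hom_iff)
  then obtain r' where r': "r' \<in> hom W N" "r' \<cdot> pN = Id C N"
    using lift[OF bifibrantD(2)[OF bi(4)] Id_in[OF o(4)] comp_in[OF sz(3) t(4)]] by blast
  have "hpo C \<pi> (s1 \<cdot> z) (pN \<cdot> k) kW"
    using hpo_paste[OF h t(2,1,3) hpoD(1)[OF W(6) t(4) K1(1) W(2)]] W(6) by blast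
  then have "built C n (pN \<cdot> k)"
    using built_cobase_change[OF bs _ sz(1) t(2) comp_in[OF t(3) W(2)] W(4) bi(1) b1 bi(3) W(1)] by blast
  moreover have "homotopic C (r' \<cdot> pN) (Id C N)" using r'(2) homotopic_refl[OF Id_in[OF o(4)]] by simp
  ultimately show ?thesis using retract_builtI[OF t(3) W(1) r'(1) W(2)] by blast
qed

section \<open>The Ganea construction\<close>

lemma dmc_cofibrant:
  assumes I: "is_cylinder C c I" and f: "f \<in> hom c a" and g: "g \<in> hom c b"
    and co: "cofibrant C c" "cofibrant C a" "cofibrant C b" and D: "double_mapping_cylinder C f g I D x t y"
  shows "cofibrant C D" "x \<in> hom a D" "t \<in> hom (cyl I) D" "y \<in> hom b D"
proof -
  obtain M p q where M: "pushout C (end1 I) g M p q"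
    using pushout_exists[OF cylinderD(2)[OF I] g] by metis
  note MC = mapping_cylinder[OF I g co(1,3) M]
  obtain m where m: "pushout C f (p \<cdot> end0 I) D x m" using dmc_is_pushout[OF I f g M D] by metis
  show "x \<in> hom a D" using pushoutD[OF m f MC(1)] by blast
  moreover have "x \<in> Cof C" using pushout_cof[OF pushout_sym[OF m] MC(1) f MC(2)] .
  ultimately show "cofibrant C D" using cofibrant_cof[OF co(2)] by blast
  have "Cod C f = a" "Cod C g = b" using f g by (simp_all add: Hom_iff)
  then show "t \<in> hom (cyl I) D" "y \<in> hom b D"
    using D by (simp_all add: double_mapping_cylinder_def dmc_cocone_def)
qed

text \<open>Weak universal property: the cone is rectified into the strict pullback by homotopy lifting, and then moved to
  \<open>F\<close> by a homotopy inverse.\<close>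

lemma hpullback_lift:
  assumes h: "hpullback C \<eta> \<beta> \<iota> g H" and t: "\<eta> \<in> hom F a" "\<beta> \<in> hom F G" "\<iota> \<in> hom a x"
    and c: "s \<in> hom T a" "u \<in> hom T G" "cofibrant C T" "homotopic C (\<iota> \<cdot> s) (g \<cdot> u)"
  obtains l where "l \<in> hom T F" "homotopic C (\<eta> \<cdot> l) s" "homotopic C (\<beta> \<cdot> l) u"
proof -
  have hs: "hsquare C \<eta> \<beta> \<iota> g H" using h by (simp add: hpullback_def)
  note S = hsquareD[OF hs t]
  note fi = S(3,5)[THEN bifibrantD(2)] and o = S(3,5)[THEN bifibrantD(3)]
  obtain M z y w q where M: "fibrant C M" "z \<in> hom M x" "z \<in> Fib C" "y \<in> hom F M" "w \<in> hom G M" "w \<in> Weq C"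
    "z \<cdot> w = g" "q \<in> hom M G" "q \<cdot> w = Id C G" "q \<cdot> y = \<beta>" "hpb C \<eta> y \<iota> z"
    using hpullbackE[OF h t] .
  note oM = fibrant_obj[OF M(1)]
  have wu: "w \<cdot> u \<in> hom T M" using comp_in c M by blast
  have "homotopic C (z \<cdot> (w \<cdot> u)) (\<iota> \<cdot> s)" using homotopic_sym[OF c(4)] M(2,5) c(2) by (simp add: M(7)[THEN pre] cs)
  then obtain v where v: "v \<in> hom T M" "homotopic C (w \<cdot> u) v" "z \<cdot> v = \<iota> \<cdot> s"
    using homotopy_lifting[OF M(2,3) wu c(3)] by metis
  obtain P pa pm where P: "bifibrant C P" "pa \<in> hom P a" "pm \<in> hom P M" "\<iota> \<cdot> pa = z \<cdot> pm" "hpb C pa pm \<iota> z"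
    and lift: "\<And>T t s. cofibrant C T \<Longrightarrow> t \<in> hom T a \<Longrightarrow> s \<in> hom T M \<Longrightarrow> \<iota> \<cdot> t = z \<cdot> s \<Longrightarrow>
      \<exists>l \<in> hom T P. pa \<cdot> l = t \<and> pm \<cdot> l = s"
    using hpb_exists[OF t(3) M(2,3) fi] by (metis (no_types, lifting))
  note sqF = hpbD[OF M(11) t(1) M(4) t(3)] and sqP = hpbD[OF P(5,2,3) t(3)]
  obtain k where k: "k \<in> hom F P" "pa \<cdot> k = \<eta>" "pm \<cdot> k = y"
    using lift[OF bifibrantD(1)[OF S(2)] t(1) M(4) sqF(3)] by blast
  have kw: "k \<in> Weq C"
    using hpb_compare[OF sqF(1) sqP(1) k(1) Id_in_weq[OF o(1)] Id_in_weq[OF oM] Id_in_weq[OF o(2)]]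
      k(2,3) t(1,3) M(2,4,11) P(5) by (simp add: cs)
  obtain l where l: "l \<in> hom T P" "pa \<cdot> l = s" "pm \<cdot> l = v"
    using lift[OF c(3,1) v(1) v(3)[symmetric]] by blast
  obtain k' where k': "k' \<in> hom P F" "homotopic C (k \<cdot> k') (Id C P)"
    using homotopy_inverse[OF k(1) kw S(2) P(1)] by metis
  have kkl: "homotopic C ((k \<cdot> k') \<cdot> l) (Id C P \<cdot> l)"
    using homotopic_pre[OF k'(2) comp_in[OF k'(1) k(1)] l(1) bifibrantD(1)[OF P(1)] c(3) bifibrantD(2)[OF P(1)]] .
  have kk: "(k \<cdot> k') \<cdot> l \<in> hom T P" using comp_in k k' l by blast
  have "homotopic C (pa \<cdot> ((k \<cdot> k') \<cdot> l)) (pa \<cdot> (Id C P \<cdot> l))" using homotopic_post[OF kkl kk P(2)] .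
  then have 1: "homotopic C (\<eta> \<cdot> (k' \<cdot> l)) s" using P(2) k(1) k'(1) l by (simp add: k(2)[THEN pre] cs)
  have "homotopic C (q \<cdot> (pm \<cdot> ((k \<cdot> k') \<cdot> l))) (q \<cdot> (pm \<cdot> (Id C P \<cdot> l)))"
    using homotopic_post[OF homotopic_post[OF kkl kk P(3)] comp_in[OF kk P(3)] M(8)] .
  then have "homotopic C (\<beta> \<cdot> (k' \<cdot> l)) (q \<cdot> v)"
    using P(3) k(1) k'(1) l M(4,8) by (simp add: k(3)[THEN pre] M(10)[THEN pre] cs)
  moreover have "homotopic C (q \<cdot> v) u"
    using homotopic_sym[OF homotopic_post[OF v(2) wu M(8)]] M(5,8) c(2) by (simp add: M(9)[THEN pre] cs)
  moreover have bl: "\<beta> \<cdot> (k' \<cdot> l) \<in> hom T G" using comp_in t k' l by blast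
  ultimately have "homotopic C (\<beta> \<cdot> (k' \<cdot> l)) u"
    using homotopic_trans[OF _ _ bl c(3) bifibrantD(2)[OF S(4)]] by blast
  then show ?thesis using that[OF comp_in[OF l(1) k'(1)] 1] by blast
qed

text \<open>The cone given by the identity of \<open>A\<close> and \<open>\<alpha>\<close> lifts to the homotopy pullback, which yields the section required
  of an attachment.\<close>

lemma ganea_built:
  assumes "ganea C \<iota> n g \<alpha>" and i: "\<iota> \<in> hom a x" and bi: "bifibrant C a" "bifibrant C x"
  shows "\<exists>G. bifibrant C G \<and> g \<in> hom G x \<and> \<alpha> \<in> hom a G \<and> homotopic C (g \<cdot> \<alpha>) \<iota> \<and> built C n \<alpha>"
  using assms(1)
proof (induction rule: ganea.induct)
  case 1
  have d: "Dom C \<iota> = a" and o: "a \<in> Obj C" using i by (simp_all add: Hom_iff)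
  have "built C 0 (Id C a)" by (rule built_0[OF bi(1,1) Id_in_weq[OF o]])
  then show ?case unfolding d using i bi Id_in[OF o] homotopic_refl[OF i]
    by (intro exI[of _ a]) (simp add: cs)
next
  case (2 n g \<alpha> \<eta> \<beta> H \<alpha>' \<gamma> h g')
  obtain G where G: "bifibrant C G" "g \<in> hom G x" "\<alpha> \<in> hom a G" "homotopic C (g \<cdot> \<alpha>) \<iota>" "built C n \<alpha>"
    using 2(5) by blast
  obtain F a0 G0 x0 where "\<eta> \<in> hom F a0" "\<beta> \<in> hom F G0" "\<iota> \<in> hom a0 x0" "g \<in> hom G0 x0"
    using 2(2) unfolding hpullback_def hsquare_def by blast
  moreover from this have "a0 = a" "x0 = x" "G0 = G" using i G(2) by (simp_all add: Hom_iff)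
  ultimately have t: "\<eta> \<in> hom F a" "\<beta> \<in> hom F G" by simp_all
  obtain F1 a1 G1 G' where "\<eta> \<in> hom F1 a1" "\<beta> \<in> hom F1 G1" "\<alpha>' \<in> hom a1 G'" "\<gamma> \<in> hom G1 G'"
    using 2(3) unfolding hpushout_def hsquare_def by blast
  moreover from this have "F1 = F" "a1 = a" "G1 = G" using t by (simp_all add: Hom_iff)
  ultimately have t': "\<alpha>' \<in> hom a G'" "\<gamma> \<in> hom G G'" by simp_all
  have hs: "hsquare C \<eta> \<beta> \<alpha>' \<gamma> (H\<lparr>hmap := h\<rparr>)" using 2(3) by (simp add: hpushout_def)
  note S = hsquareD[OF hs t t'(1)]
  have d: "Cod C \<alpha>' = G'" "Cod C \<iota> = x" using t' i by (simp_all add: Hom_iff)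
  obtain D xa tt y e d where D: "double_mapping_cylinder C \<eta> \<beta> (H\<lparr>hmap := h\<rparr>) D xa tt y"
    and e: "dmc_map C D xa tt y G' \<alpha>' (hmap (H\<lparr>hmap := h\<rparr>)) \<gamma> e"
    and d: "dmc_map C D xa tt y x \<iota> (hmap H) g d" and g': "g' \<in> hom G' x" "homotopic C (g' \<cdot> e) d"
    using 2(4) unfolding whisker_def d by blast
  note co = S(2,3,4)[THEN bifibrantD(1)]
  note DC = dmc_cofibrant[OF S(7) t co D]
  have ee: "e \<in> hom D G'" "e \<cdot> xa = \<alpha>'" "d \<cdot> xa = \<iota>" using e d by (simp_all add: dmc_map_def)
  have "homotopic C ((g' \<cdot> e) \<cdot> xa) (d \<cdot> xa)"
    using homotopic_pre[OF g'(2) comp_in[OF ee(1) g'(1)] DC(2,1) co(2) bifibrantD(2)[OF bi(2)]] .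
  then have ga: "homotopic C (g' \<cdot> \<alpha>') \<iota>" using g'(1) ee(1) DC(2) by (simp add: ee(2,3) cs)
  have o: "a \<in> Obj C" using i by (simp add: Hom_iff)
  have "homotopic C (\<iota> \<cdot> Id C a) (g \<cdot> \<alpha>)" using homotopic_sym[OF G(4)] i by (simp add: cs)
  then obtain \<sigma> where \<sigma>: "\<sigma> \<in> hom a F" "homotopic C (\<eta> \<cdot> \<sigma>) (Id C a)" "homotopic C (\<beta> \<cdot> \<sigma>) \<alpha>"
    using hpullback_lift[OF 2(2) t i Id_in[OF o] G(3) co(2)] by metis
  have "built C (Suc n) \<alpha>'" using built_attach_homotopy[OF G(5) 2(3) G(3) t t'(1) \<sigma>] .
  then show ?case using S(5) g'(1) t'(1) ga by blast
qed


lemma dmc_more [simp]: "double_mapping_cylinder C f g (I\<lparr>hmap := h\<rparr>) D a t b = double_mapping_cylinder C f g I D a t b"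
  by (simp add: double_mapping_cylinder_def dmc_cocone_def)

text \<open>The homotopy pullback is a cofibrant replacement \<open>F\<close> of the double mapping path object, with a special cylinder. The object \<open>V\<close>
  consists of the points of \<open>F\<close> together with a path in \<open>x\<close> ending at their image. The cylinder is chosen as an acyclic
  fibration over \<open>V\<close>. Therefore the left homotopy on it, and not only its class, is universal: every left homotopy
  between composites with \<open>\<iota>\<close> and \<open>g\<close> is obtained strictly from it by lifting.\<close>

lemma homotopy_pullback_model:
  assumes t: "\<iota> \<in> hom a x" "g \<in> hom G x" and bi: "bifibrant C a" "bifibrant C G" "bifibrant C x"
    and J: "is_cylinder (op C) x (J :: ('o,'m) htpy)"
  obtains F \<eta> \<beta> H V vJ vF v where "bifibrant C F" "\<eta> \<in> hom F a" "\<beta> \<in> hom F G" "hpullback C \<eta> \<beta> \<iota> g H"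
    "v \<in> hom (cyl H) V" "v \<in> Fib C" "v \<in> Weq C"
    "pushout (op C) (end1 J) (g \<cdot> \<beta>) V vJ vF" "vF \<cdot> v = proj H" "end0 J \<cdot> (vJ \<cdot> v) = hmap H"
    "\<And>T r s k. cofibrant C T \<Longrightarrow> r \<in> hom T a \<Longrightarrow> s \<in> hom T G \<Longrightarrow> k \<in> hom T (cyl J) \<Longrightarrow>
      end0 J \<cdot> k = \<iota> \<cdot> r \<Longrightarrow> end1 J \<cdot> k = g \<cdot> s \<Longrightarrow>
      \<exists>l \<in> hom T F. \<eta> \<cdot> l = r \<and> \<beta> \<cdot> l = s \<and> vJ \<cdot> (v \<cdot> (end0 H \<cdot> l)) = k"
    "vJ \<cdot> (v \<cdot> end1 H) = proj J \<cdot> (g \<cdot> \<beta>)"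
proof -
  note P = pathD[OF J] and fi = bi[THEN bifibrantD(2)]
  have d: "Dom C \<iota> = a" "Dom C g = G" using t by (simp_all add: Hom_iff)
  obtain M p q where M: "pushout (op C) (end1 J) g M p q" "p \<in> hom M (cyl J)" "q \<in> hom M G" "end1 J \<cdot> p = g \<cdot> q"
    using pullback_exists[OF P(2) t(2)] .
  note MC = model_category.mapping_cylinder(1,2)[OF dual J, unfolded dualize, OF t(2) fi(3,2) M(1)]
  obtain E xE mE where E: "pushout (op C) \<iota> (end0 J \<cdot> p) E xE mE" "xE \<in> hom E a" "mE \<in> hom E M"
    "\<iota> \<cdot> xE = (end0 J \<cdot> p) \<cdot> mE"
    using pullback_exists[OF t(1) MC(1)] .
  have DE: "double_mapping_cylinder (op C) \<iota> g J E xE (p \<cdot> mE) (q \<cdot> mE)"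
    using model_category.dmc_from_pushout[OF dual J, of \<iota> a g G M p q E xE mE] t M(1) E(1) by simp
  have fE: "fibrant C E"
    using fibrant_fib[OF fi(1) E(2) pullback_fib[OF small_category.pushout_sym[OF small_dual E(1)] MC(1) t(1) MC(2)]] .
  obtain F eF where F: "cofibrant C F" "eF \<in> hom F E" "eF \<in> Fib C" "eF \<in> Weq C"
    using cofibrant_replacement[OF fibrant_obj[OF fE]] .
  have bF: "bifibrant C F" using F(1) fibrant_fib[OF fE F(2,3)] by (simp add: bifibrant_def)
  note oF = bifibrantD(3)[OF bF]
  define \<eta> \<beta> \<kappa> where "\<eta> = xE \<cdot> eF" and "\<beta> = q \<cdot> mE \<cdot> eF" and "\<kappa> = p \<cdot> mE \<cdot> eF"
  have h: "\<eta> \<in> hom F a" "\<beta> \<in> hom F G" "\<kappa> \<in> hom F (cyl J)"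
    unfolding \<eta>_def \<beta>_def \<kappa>_def using comp_in E F M by blast+
  have k0: "end0 J \<cdot> \<kappa> = \<iota> \<cdot> \<eta>"
    unfolding \<eta>_def \<kappa>_def using P(1) M(2) E(2,3) F(2) t by (simp add: cs E(4)[THEN pre])
  have k1: "end1 J \<cdot> \<kappa> = g \<cdot> \<beta>"
    unfolding \<beta>_def \<kappa>_def using P(2) M(2,3) E(2,3) F(2) t by (simp add: cs M(4)[THEN pre])
  have gb: "g \<cdot> \<beta> \<in> hom F x" "\<iota> \<cdot> \<eta> \<in> hom F x" using comp_in h t by blast+
  let ?K = "J\<lparr>hmap := \<kappa>\<rparr>"
  have RK: "right_homotopy C ?K (\<iota> \<cdot> \<eta>) (g \<cdot> \<beta>)"
    using J h(3) k0 k1 by (intro right_homotopyI[of x _ F]) simp_all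
  obtain V vJ vF where V: "pushout (op C) (end1 J) (g \<cdot> \<beta>) V vJ vF" "vJ \<in> hom V (cyl J)" "vF \<in> hom V F"
    "end1 J \<cdot> vJ = (g \<cdot> \<beta>) \<cdot> vF"
    using pullback_exists[OF P(2) gb(1)] .
  have vF: "vF \<in> Weq C"
    using pullback_afib[OF V(1) P(2) gb(1)] path_ends[OF J] fi(3) by blast
  obtain l0 where l0: "l0 \<in> hom F V" "vJ \<cdot> l0 = \<kappa>" "vF \<cdot> l0 = Id C F"
    using pullback_univ[OF V(1) P(2) gb(1) h(3) Id_in[OF oF]] k1 gb by (simp add: cs) metis
  have jg: "proj J \<cdot> (g \<cdot> \<beta>) \<in> hom F (cyl J)" using comp_in P gb by blast
  have "end1 J \<cdot> (proj J \<cdot> (g \<cdot> \<beta>)) = (g \<cdot> \<beta>) \<cdot> Id C F" using P gb t h oF by (simp add: cs P(6)[THEN pre])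
  then obtain l1 where l1: "l1 \<in> hom F V" "vJ \<cdot> l1 = proj J \<cdot> (g \<cdot> \<beta>)" "vF \<cdot> l1 = Id C F"
    using pullback_univ[OF V(1) P(2) gb(1) jg Id_in[OF oF]] by metis
  obtain S j0 j1 where S: "coproduct C F F S j0 j1" using coproduct_exists[OF oF oF] .
  note j = coproductD[OF S]
  obtain u where u: "u \<in> hom S V" "u \<cdot> j0 = l0" "u \<cdot> j1 = l1" using coproduct_univ[OF S l0(1) l1(1)] .
  obtain y i v where v: "i \<in> hom S y" "v \<in> hom y V" "i \<in> Cof C" "v \<in> Fib C" "v \<in> Weq C" "v \<cdot> i = u"
    using factor_afib[OF u(1)] .
  let ?H = "\<lparr>cyl = y, end0 = i \<cdot> j0, end1 = i \<cdot> j1, proj = vF \<cdot> v, hmap = end0 J \<cdot> (vJ \<cdot> v)\<rparr>"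
  have H: "is_cylinder C F ?H"
    unfolding is_cylinder_def
    by (intro conjI exI[of _ S] exI[of _ j0] exI[of _ j1] bexI[of _ i])
      (use S j u(1) v(1-3) V(3) two_of_three(1)[OF v(2) V(3) v(5) vF] l0(1,3) l1(1,3)
        in \<open>simp_all add: cs v(6)[THEN pre] u(2,3)\<close>)
  have w: "vJ \<cdot> v \<in> hom y (cyl J)" using comp_in v V by blast
  have w0: "vJ \<cdot> (v \<cdot> (i \<cdot> j0)) = \<kappa>" "vJ \<cdot> (v \<cdot> (i \<cdot> j1)) = proj J \<cdot> (g \<cdot> \<beta>)"
    using V(2) v(1,2) u(1) j by (simp_all add: cs v(6)[THEN pre] u(2,3) l0(2) l1(2))
  have LH: "left_homotopy C ?H (\<iota> \<cdot> \<eta>) (g \<cdot> \<beta>)"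
  proof (rule left_homotopyI[OF H])
    show "hmap ?H \<in> hom (cyl ?H) x" using comp_in[OF w P(1)] by simp
    show "hmap ?H \<cdot> end0 ?H = \<iota> \<cdot> \<eta>" "hmap ?H \<cdot> end1 ?H = g \<cdot> \<beta>"
      using P(1,3) V(2) v(1,2) j w0 k0 gb h t by (simp_all add: cs P(5)[THEN pre])
  qed
  have co: "corresponds C (\<iota> \<cdot> \<eta>) (g \<cdot> \<beta>) ?H ?K"
    unfolding corresponds_def
    by (intro conjI LH RK bexI[of _ "vJ \<cdot> v"])
      (use w w0 V(2-4) P(2) v(1,2) j gb h t in \<open>simp_all add: cs V(4)[THEN pre]\<close>)
  have "dmc_map (op C) E xE (p \<cdot> mE) (q \<cdot> mE) (Cod (op C) \<eta>) \<eta> (hmap ?K) \<beta> eF"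
    unfolding dmc_map_def \<eta>_def \<beta>_def \<kappa>_def using F(2) E(2,3) M(2,3) by (simp add: cs)
  then have "dmc_comparison_weq (op C) \<iota> g \<eta> \<beta> ?K"
    unfolding dmc_comparison_weq_def model_category.dmc_more[OF dual] using DE F(4) by (simp; blast)
  moreover have "hsquare C \<eta> \<beta> \<iota> g ?H" using hsquareI[OF bF bi h(1,2) t LH] .
  ultimately have hp: "hpullback C \<eta> \<beta> \<iota> g ?H" unfolding hpullback_def using co by blast
  have lift: "\<exists>l \<in> hom T F. \<eta> \<cdot> l = r \<and> \<beta> \<cdot> l = s \<and> vJ \<cdot> (v \<cdot> (end0 ?H \<cdot> l)) = k"
    if T: "cofibrant C T" "r \<in> hom T a" "s \<in> hom T G" "k \<in> hom T (cyl J)"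
      "end0 J \<cdot> k = \<iota> \<cdot> r" "end1 J \<cdot> k = g \<cdot> s" for T r s k
  proof -
    obtain m where m: "m \<in> hom T M" "p \<cdot> m = k" "q \<cdot> m = s" using pullback_univ[OF M(1) P(2) t(2) T(4,3,6)] .
    have "\<iota> \<cdot> r = (end0 J \<cdot> p) \<cdot> m" using m P(1) M(2) T(5) by (simp add: cs)
    then obtain e where e: "e \<in> hom T E" "xE \<cdot> e = r" "mE \<cdot> e = m"
      using pullback_univ[OF E(1) t(1) MC(1) T(2) m(1)] by metis
    obtain l where l: "l \<in> hom T F" "eF \<cdot> l = e" using cofibrant_lift[OF T(1) F(3,4,2) e(1)] .
    have "\<eta> \<cdot> l = r" "\<beta> \<cdot> l = s" "\<kappa> \<cdot> l = k"
      unfolding \<eta>_def \<beta>_def \<kappa>_def using E(2,3) F(2) M(2,3) l e(1) m(1) by (simp_all add: cs e(2,3) m(2,3))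
    moreover have "vJ \<cdot> (v \<cdot> (end0 ?H \<cdot> l)) = \<kappa> \<cdot> l"
      unfolding w0(1)[symmetric] using V(2) v(1,2) j l(1) by (simp add: cs)
    ultimately show ?thesis using l by auto
  qed
  show ?thesis
    by (rule that[OF bF h(1,2) hp, of v V vJ vF]) (use v V(1) lift w0(2) in simp_all)
qed

text \<open>One stage of the Ganea construction, built so that it strictly receives every homotopy commutative
  square of the right shape.\<close>

lemma ganea_extend:
  assumes gn: "ganea C \<iota> n g \<alpha>" and t: "\<iota> \<in> hom a x" "g \<in> hom G x"
    and bi: "bifibrant C a" "bifibrant C G" "bifibrant C x"
  obtains G' g' \<alpha>' \<gamma> where "ganea C \<iota> (Suc n) g' \<alpha>'" "bifibrant C G'" "g' \<in> hom G' x" "\<alpha>' \<in> hom a G'" "\<gamma> \<in> hom G G'"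
    "g' \<cdot> \<alpha>' = \<iota>" "g' \<cdot> \<gamma> = g"
    "\<And>Z r y (K :: ('o,'m) htpy). cofibrant C Z \<Longrightarrow> r \<in> hom Z a \<Longrightarrow> y \<in> hom Z G \<Longrightarrow> left_homotopy C K (\<iota> \<cdot> r) (g \<cdot> y) \<Longrightarrow>
      \<exists>k \<in> hom (cyl K) G'. k \<cdot> end0 K = \<alpha>' \<cdot> r \<and> k \<cdot> end1 K = \<gamma> \<cdot> y \<and> g' \<cdot> k = hmap K"
proof -
  obtain J :: "('o,'m) htpy" where J: "is_cylinder (op C) x J" using path_exists bifibrantD(3)[OF bi(3)] by metis
  note P = pathD[OF J]
  obtain F \<eta> \<beta> H V vJ vF v where F: "bifibrant C F" "\<eta> \<in> hom F a" "\<beta> \<in> hom F G" "hpullback C \<eta> \<beta> \<iota> g H"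
    "v \<in> hom (cyl H) V" "v \<in> Fib C" "v \<in> Weq C"
    "pushout (op C) (end1 J) (g \<cdot> \<beta>) V vJ vF" "vF \<cdot> v = proj H" "end0 J \<cdot> (vJ \<cdot> v) = hmap H"
    and lift: "\<And>T r s k. cofibrant C T \<Longrightarrow> r \<in> hom T a \<Longrightarrow> s \<in> hom T G \<Longrightarrow> k \<in> hom T (cyl J) \<Longrightarrow>
      end0 J \<cdot> k = \<iota> \<cdot> r \<Longrightarrow> end1 J \<cdot> k = g \<cdot> s \<Longrightarrow>
      \<exists>l \<in> hom T F. \<eta> \<cdot> l = r \<and> \<beta> \<cdot> l = s \<and> vJ \<cdot> (v \<cdot> (end0 H \<cdot> l)) = k"
    and v1: "vJ \<cdot> (v \<cdot> end1 H) = proj J \<cdot> (g \<cdot> \<beta>)"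
    using homotopy_pullback_model[OF t bi J] by (metis (no_types, lifting))
  have hs: "hsquare C \<eta> \<beta> \<iota> g H" using F(4) by (simp add: hpullback_def)
  note S = hsquareD[OF hs F(2,3) t(1)] and co = F(1)[THEN bifibrantD(1)] bi(1)[THEN bifibrantD(1)] bi(2)[THEN bifibrantD(1)]
  note Y = cylinderD[OF S(7)]
  have gb: "g \<cdot> \<beta> \<in> hom F x" using comp_in F t by blast
  note DV = pullbackD[OF F(8) P(2) gb]
  obtain M p q where M: "pushout C (end1 H) \<beta> M p q" "p \<in> hom (cyl H) M" "q \<in> hom G M" "p \<cdot> end1 H = q \<cdot> \<beta>"
    using pushout_exists[OF Y(2) F(3)] .
  note MC = mapping_cylinder[OF S(7) F(3) co(1,3) M(1)]
  obtain D da m where D: "pushout C \<eta> (p \<cdot> end0 H) D da m" "da \<in> hom a D" "m \<in> hom M D" "da \<cdot> \<eta> = m \<cdot> (p \<cdot> end0 H)"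
    using pushout_exists[OF F(2) MC(1)] .
  have DM: "double_mapping_cylinder C \<eta> \<beta> H D da (m \<cdot> p) (m \<cdot> q)"
    using dmc_from_pushout[OF S(7) F(2,3) M(1) D(1)] .
  obtain y where y: "y \<in> hom M x" "y \<cdot> p = hmap H" "y \<cdot> q = g" using pushout_univ[OF M(1) Y(2) F(3) S(8,1,10)] .
  have "\<iota> \<cdot> \<eta> = y \<cdot> (p \<cdot> end0 H)" using y(1) M(2) Y(1) by (simp add: y(2)[THEN pre] S(9) cs)
  then obtain d where d: "d \<in> hom D x" "d \<cdot> da = \<iota>" "d \<cdot> m = y" using pushout_univ[OF D(1) F(2) MC(1) t(1) y(1)] by metis
  obtain G' e g' where e: "e \<in> hom D G'" "g' \<in> hom G' x" "e \<in> Cof C" "e \<in> Weq C" "g' \<in> Fib C" "g' \<cdot> e = d"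
    using factor_acof[OF d(1)] .
  have cD: "cofibrant C D" using dmc_cofibrant(1)[OF S(7) F(2,3) co DM] .
  have bG': "bifibrant C G'"
    using cofibrant_cof[OF cD e(1,3)] fibrant_fib[OF bifibrantD(2)[OF bi(3)] e(2,5)] by (simp add: bifibrant_def)
  define \<alpha>' \<gamma> h where "\<alpha>' = e \<cdot> da" and "\<gamma> = e \<cdot> m \<cdot> q" and "h = e \<cdot> m \<cdot> p"
  have ty: "\<alpha>' \<in> hom a G'" "\<gamma> \<in> hom G G'" "h \<in> hom (cyl H) G'"
    unfolding \<alpha>'_def \<gamma>_def h_def using comp_in D M e by blast+
  have h0: "h \<cdot> end0 H = \<alpha>' \<cdot> \<eta>" "h \<cdot> end1 H = \<gamma> \<cdot> \<beta>"
    unfolding \<alpha>'_def \<gamma>_def h_def using e(1) D(2,3) M(2,3) Y(1,2) F(2,3) by (simp_all add: cs D(4) M(4))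
  have gs: "g' \<cdot> \<alpha>' = \<iota>" "g' \<cdot> \<gamma> = g" "g' \<cdot> h = hmap H"
    unfolding \<alpha>'_def \<gamma>_def h_def using e(1,2) D(2,3) M(2,3) d(1) y(1)
    by (simp_all add: cs e(6)[THEN pre] d(2) d(3)[THEN pre] y(2,3))
  have "left_homotopy C (H\<lparr>hmap := h\<rparr>) (\<alpha>' \<cdot> \<eta>) (\<gamma> \<cdot> \<beta>)"
    using S(7) ty(3) h0 by (intro left_homotopyI[of F _ G']) simp_all
  then have hs': "hsquare C \<eta> \<beta> \<alpha>' \<gamma> (H\<lparr>hmap := h\<rparr>)" using hsquareI[OF F(1) bi(1,2) bG' F(2,3) ty(1,2)] by blast
  have cods: "Cod C \<alpha>' = G'" "Cod C \<iota> = x" using ty t by (simp_all add: Hom_iff)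
  have em: "dmc_map C D da (m \<cdot> p) (m \<cdot> q) G' \<alpha>' (hmap (H\<lparr>hmap := h\<rparr>)) \<gamma> e"
    unfolding dmc_map_def \<alpha>'_def \<gamma>_def h_def using e(1) D(3) M(2,3) by (simp add: cs)
  have dm: "dmc_map C D da (m \<cdot> p) (m \<cdot> q) x \<iota> (hmap H) g d"
    unfolding dmc_map_def using d(1,2) D(3) M(2,3) by (simp add: cs d(3)[THEN pre] y(2,3))
  have hpu: "hpushout C \<eta> \<beta> \<alpha>' \<gamma> (H\<lparr>hmap := h\<rparr>)"
    unfolding hpushout_def dmc_comparison_weq_def cods dmc_more using hs' DM em e(4) by blast
  have "homotopic C (g' \<cdot> e) d" unfolding e(6) by (rule homotopic_refl[OF d(1)])
  then have wh: "whisker C \<eta> \<beta> \<alpha>' \<gamma> (H\<lparr>hmap := h\<rparr>) \<iota> g (hmap H) g'"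
    unfolding whisker_def cods dmc_more using DM em dm e(2) by blast
  have gan: "ganea C \<iota> (Suc n) g' \<alpha>'" using ganea.intros(2)[OF gn F(4) hpu wh] .
  have ext: "\<exists>k \<in> hom (cyl K) G'. k \<cdot> end0 K = \<alpha>' \<cdot> r \<and> k \<cdot> end1 K = \<gamma> \<cdot> s \<and> g' \<cdot> k = hmap K"
    if Z: "cofibrant C Z" "r \<in> hom Z a" "s \<in> hom Z G" "left_homotopy C K (\<iota> \<cdot> r) (g \<cdot> s)"
    for Z r s and K :: "('o,'m) htpy"
  proof -
    have ir: "\<iota> \<cdot> r \<in> hom Z x" "g \<cdot> s \<in> hom Z x" using comp_in Z t by blast+
    note L = left_homotopyD[OF Z(4) ir(1)] and YK = cylinderD[OF L(2)]
    \<comment> \<open>The homotopy as a map \<open>T\<close> into paths, which determines a map to \<open>F\<close> on one end and a map to \<open>V\<close> on the cylinder.\<close>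
    obtain k0 where "corresponds C (\<iota> \<cdot> r) (g \<cdot> s) K (J\<lparr>hmap := k0\<rparr>)"
      using corresponds_exists[OF Z(4) ir(1) Z(1) J] .
    then obtain T where T: "T \<in> hom (cyl K) (cyl J)" "T \<cdot> end0 K = k0" "T \<cdot> end1 K = proj J \<cdot> (g \<cdot> s)"
      "end0 J \<cdot> T = hmap K" "end1 J \<cdot> T = (g \<cdot> s) \<cdot> proj K"
      unfolding corresponds_def by auto
    have k0: "k0 \<in> hom Z (cyl J)" "end0 J \<cdot> k0 = \<iota> \<cdot> r" "end1 J \<cdot> k0 = g \<cdot> s"
      unfolding T(2)[symmetric] using comp_in[OF YK(1) T(1)] T(1) YK(1,3) P(1,2) ir L(3,4) t Z(2,3)
      by (simp_all add: T(4,5)[THEN pre] YK(5) cs)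
    obtain l where l: "l \<in> hom Z F" "\<eta> \<cdot> l = r" "\<beta> \<cdot> l = s" "vJ \<cdot> (v \<cdot> (end0 H \<cdot> l)) = k0"
      using lift[OF Z(1-3) k0] by blast
    have lp: "l \<cdot> proj K \<in> hom (cyl K) F" using comp_in l YK by blast
    have "end1 J \<cdot> T = (g \<cdot> \<beta>) \<cdot> (l \<cdot> proj K)"
      unfolding T(5) using t(2) F(3) l(1) YK(3) Z(3) by (simp add: cs l(3)[THEN pre])
    then obtain n where n: "n \<in> hom (cyl K) V" "vJ \<cdot> n = T" "vF \<cdot> n = l \<cdot> proj K"
      using pullback_univ[OF F(8) P(2) gb T(1) lp] by metis
    have el: "end0 H \<cdot> l \<in> hom Z (cyl H)" "end1 H \<cdot> l \<in> hom Z (cyl H)" using comp_in l Y by blast+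
    have n0: "v \<cdot> (end0 H \<cdot> l) = n \<cdot> end0 K"
    proof (rule pullback_eq[OF F(8) comp_in[OF el(1) F(5)] comp_in[OF YK(1) n(1)]])
      show "vJ \<cdot> (v \<cdot> (end0 H \<cdot> l)) = vJ \<cdot> (n \<cdot> end0 K)"
        using DV(2) n(1) YK(1) by (simp add: l(4) n(2)[THEN pre] T(2) cs)
      show "vF \<cdot> (v \<cdot> (end0 H \<cdot> l)) = vF \<cdot> (n \<cdot> end0 K)"
        using DV(3) n(1) YK(1,3) F(5) Y(1,3) l(1) by (simp add: cs n(3)[THEN pre] F(9)[THEN pre] Y(5)[THEN pre] YK(5))
    qed
    have n1: "v \<cdot> (end1 H \<cdot> l) = n \<cdot> end1 K"
    proof (rule pullback_eq[OF F(8) comp_in[OF el(2) F(5)] comp_in[OF YK(2) n(1)]])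
      have "vJ \<cdot> (v \<cdot> (end1 H \<cdot> l)) = (vJ \<cdot> (v \<cdot> end1 H)) \<cdot> l"
        using DV(2) F(5) Y(2) l(1) by (simp add: cs)
      also have "\<dots> = proj J \<cdot> (g \<cdot> s)" unfolding v1 using P(3) t(2) F(3) l(1) by (simp add: cs l(3))
      also have "\<dots> = vJ \<cdot> (n \<cdot> end1 K)" using DV(2) n(1) YK(2) by (simp add: n(2)[THEN pre] T(3) cs)
      finally show "vJ \<cdot> (v \<cdot> (end1 H \<cdot> l)) = vJ \<cdot> (n \<cdot> end1 K)" .
      show "vF \<cdot> (v \<cdot> (end1 H \<cdot> l)) = vF \<cdot> (n \<cdot> end1 K)"
        using DV(3) n(1) YK(2,3) F(5) Y(2,3) l(1) by (simp add: cs n(3)[THEN pre] F(9)[THEN pre] Y(6)[THEN pre] YK(6))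
    qed
    obtain w where w: "w \<in> hom (cyl K) (cyl H)" "w \<cdot> end0 K = end0 H \<cdot> l" "w \<cdot> end1 K = end1 H \<cdot> l" "v \<cdot> w = n"
      using cylinder_lift[OF L(2) F(5-7) el n(1) n0 n1] .
    have "(h \<cdot> w) \<cdot> end0 K = \<alpha>' \<cdot> r" "(h \<cdot> w) \<cdot> end1 K = \<gamma> \<cdot> s"
      using ty w(1) YK(1,2) Y(1,2) l(1) F(2,3) by (simp_all add: cs w(2,3) h0[THEN pre] l(2,3))
    moreover have "g' \<cdot> (h \<cdot> w) = hmap K"
    proof -
      have "g' \<cdot> (h \<cdot> w) = hmap H \<cdot> w" using e(2) ty(3) w(1) by (simp add: gs(3)[THEN pre] cs)
      also have "\<dots> = end0 J \<cdot> (vJ \<cdot> (v \<cdot> w))" unfolding F(10)[symmetric] using P(1) DV(2) F(5) w(1) by (simp add: cs)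
      also have "\<dots> = hmap K" unfolding w(4) n(2) by (rule T(4))
      finally show ?thesis .
    qed
    ultimately show ?thesis using comp_in[OF w(1) ty(3)] by blast
  qed
  show ?thesis by (rule that[OF gan bG' e(2) ty(1,2) gs(1,2) ext])
qed

text \<open>Let \<open>D\<close> be the double mapping cylinder that models \<open>K\<close>. The composite \<open>D \<rightarrow> K \<rightarrow> x\<close> is deformed so that it
  restricts strictly to \<open>\<iota>\<close> and to \<open>g \<cdot> s\<close> on the ends. The universal property of the next Ganea stage then gives a map \<open>kD\<close>
  out of \<open>D\<close> that lies strictly over \<open>x\<close>, and hence a map out of \<open>K\<close> that lies over \<open>x\<close> up to homotopy. Compatibility with \<open>r\<close> is preserved by the
  induction; compatibility with the structure map \<open>\<alpha>\<close> is recreated in each step.\<close>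

lemma ganea_of_strong_relcat:
  assumes "strong_relcat_le C f n" "f \<in> hom a K" "r \<in> hom K x" "homotopic C (r \<cdot> f) \<iota>"
    and t: "\<iota> \<in> hom a x" and "bifibrant C K" and bi: "bifibrant C a" "bifibrant C x"
  shows "\<exists>G g \<alpha> s. ganea C \<iota> n g \<alpha> \<and> bifibrant C G \<and> g \<in> hom G x \<and> \<alpha> \<in> hom a G \<and> s \<in> hom K G \<and>
    homotopic C (g \<cdot> s) r \<and> homotopic C (s \<cdot> f) \<alpha>"
  using assms(1-4,6)
proof (induction n arbitrary: f K r)
  case 0
  have o: "Dom C \<iota> = a" "a \<in> Obj C" using t by (simp_all add: Hom_iff)
  have fw: "f \<in> Weq C" using strong_relcat_le_0[OF 0(2) bi(1) 0(5)] 0(1) by simp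
  obtain s where s: "s \<in> hom K a" "homotopic C (s \<cdot> f) (Id C a)" "homotopic C (f \<cdot> s) (Id C K)"
    using homotopy_inverse[OF 0(2) fw bi(1) 0(5)] .
  have fs: "f \<cdot> s \<in> hom K K" "r \<cdot> f \<in> hom a x" using comp_in s 0 by blast+
  have "homotopic C ((r \<cdot> f) \<cdot> s) (\<iota> \<cdot> s)"
    using homotopic_pre[OF 0(4) fs(2) s(1)] bi 0(5) by (simp add: bifibrant_def)
  then have 1: "homotopic C (\<iota> \<cdot> s) (r \<cdot> (f \<cdot> s))" using homotopic_sym 0(2,3) s(1) by (simp add: cs)
  have 2: "homotopic C (r \<cdot> (f \<cdot> s)) r" using homotopic_post[OF s(3) fs(1) 0(3)] 0(3) by (simp add: cs)
  have "homotopic C (\<iota> \<cdot> s) r"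
    using homotopic_trans[OF 1 2 comp_in[OF s(1) t]] bi 0(5) by (simp add: bifibrant_def)
  moreover have "ganea C \<iota> 0 \<iota> (Id C a)" using ganea.intros(1)[of C \<iota>] o by simp
  ultimately show ?case using s bi t Id_in[OF o(2)] by blast
next
  case (Suc n)
  note ft = Suc.prems(2) and rt = Suc.prems(3) and bK = Suc.prems(5)
  obtain x0 f0 z \<rho> \<tau> \<chi> H \<sigma> j where *: "strong_relcat_le C f0 n" "f0 \<in> hom a x0" "bifibrant C x0" "j \<in> hom a K"
    "\<rho> \<in> hom z a" "\<tau> \<in> hom z x0" "\<chi> \<in> hom x0 K" "hpushout C \<rho> \<tau> j \<chi> H" "\<sigma> \<in> hom a z"
    "homotopic C (\<rho> \<cdot> \<sigma>) (Id C a)" "homotopic C (\<tau> \<cdot> \<sigma>) f0" "homotopic C j f"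
    using strong_relcat_le_SucE[OF Suc.prems(1) ft] .
  have hs: "hsquare C \<rho> \<tau> j \<chi> H" and dw: "dmc_comparison_weq C \<rho> \<tau> j \<chi> H"
    using *(8) by (simp_all add: hpushout_def)
  note S = hsquareD[OF hs *(5,6,4)] and Y = cylinderD[OF hsquareD(7)[OF hs *(5,6,4)]]
  note co = S(2,3,4)[THEN bifibrantD(1)] and fx = bifibrantD(2)[OF bi(2)] and ca = bifibrantD(1)[OF bi(1)]
  have rj: "r \<cdot> j \<in> hom a x" "r \<cdot> \<chi> \<in> hom x0 x" "r \<cdot> \<chi> \<cdot> f0 \<in> hom a x" using comp_in rt * by blast+
  have rji: "homotopic C (r \<cdot> j) \<iota>"
    using homotopic_trans[OF homotopic_post[OF *(12,4) rt] Suc.prems(4) rj(1) ca fx] .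
  have "homotopic C (r \<cdot> \<chi> \<cdot> f0) \<iota>"
  proof -
    have ts: "\<tau> \<cdot> \<sigma> \<in> hom a x0" "\<rho> \<cdot> \<sigma> \<in> hom a a" using comp_in * by blast+
    have "homotopic C (j \<cdot> \<rho>) (\<chi> \<cdot> \<tau>)" using S(6) by (auto simp: homotopic_def)
    from homotopic_pre[OF homotopic_post[OF this comp_in[OF *(5,4)] rt] comp_in[OF comp_in[OF *(5,4)] rt] *(9) co(1) ca fx]
    have "homotopic C ((r \<cdot> \<chi>) \<cdot> (\<tau> \<cdot> \<sigma>)) ((r \<cdot> j) \<cdot> (\<rho> \<cdot> \<sigma>))"
      using homotopic_sym rt * by (simp add: cs)
    moreover have "homotopic C ((r \<cdot> j) \<cdot> (\<rho> \<cdot> \<sigma>)) (r \<cdot> j)"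
      using homotopic_post[OF *(10) ts(2) rj(1)] rt *(4) by (simp add: cs)
    ultimately have "homotopic C ((r \<cdot> \<chi>) \<cdot> (\<tau> \<cdot> \<sigma>)) (r \<cdot> j)"
      using homotopic_trans[OF _ _ comp_in[OF ts(1) rj(2)] ca fx] by blast
    then have "homotopic C ((r \<cdot> \<chi>) \<cdot> (\<tau> \<cdot> \<sigma>)) \<iota>"
      using homotopic_trans[OF _ rji comp_in[OF ts(1) rj(2)] ca fx] by blast
    then show ?thesis
      using homotopic_trans[OF homotopic_sym[OF homotopic_post[OF *(11) ts(1) rj(2)]] _ rj(3) ca fx] by blast
  qed
  then obtain G g \<alpha> s where G: "ganea C \<iota> n g \<alpha>" "bifibrant C G" "g \<in> hom G x" "s \<in> hom x0 G"
    "homotopic C (g \<cdot> s) (r \<cdot> \<chi>)"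
    using Suc.IH[OF *(1,2) rj(2) _ *(3)] by blast
  obtain G' g' \<alpha>' \<gamma> where G': "ganea C \<iota> (Suc n) g' \<alpha>'" "bifibrant C G'" "g' \<in> hom G' x" "\<alpha>' \<in> hom a G'" "\<gamma> \<in> hom G G'"
    "g' \<cdot> \<alpha>' = \<iota>" "g' \<cdot> \<gamma> = g"
    and ext: "\<And>Z r y (K :: ('o,'m) htpy). cofibrant C Z \<Longrightarrow> r \<in> hom Z a \<Longrightarrow> y \<in> hom Z G \<Longrightarrow> left_homotopy C K (\<iota> \<cdot> r) (g \<cdot> y) \<Longrightarrow>
      \<exists>k \<in> hom (cyl K) G'. k \<cdot> end0 K = \<alpha>' \<cdot> r \<and> k \<cdot> end1 K = \<gamma> \<cdot> y \<and> g' \<cdot> k = hmap K"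
    using ganea_extend[OF G(1) t G(3) bi(1) G(2) bi(2)] by (metis (no_types, lifting))
  obtain M p q where M: "pushout C (end1 H) \<tau> M p q" "p \<in> hom (cyl H) M" "q \<in> hom x0 M" "p \<cdot> end1 H = q \<cdot> \<tau>"
    using pushout_exists[OF Y(2) *(6)] .
  note MC = mapping_cylinder[OF S(7) *(6) co(1,3) M(1)]
  obtain y0 where y0: "y0 \<in> hom M K" "y0 \<cdot> p = hmap H" "y0 \<cdot> q = \<chi>"
    using pushout_univ[OF M(1) Y(2) *(6) S(8,1,10)] .
  define c where "c = p \<cdot> end0 H"
  have c: "c \<in> hom z M" "c \<in> Cof C" unfolding c_def using MC(1,2) .
  have hp: "hpo C \<rho> c j y0" unfolding c_def using comparison_iff[OF S(7) *(5,6,4) co M(1) y0 S(9)] dw by blast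
  note sq = hpoD[OF hp *(5) c(1) *(4)]
  obtain D da m where D: "pushout C \<rho> c D da m" "da \<in> hom a D" "m \<in> hom M D" "da \<cdot> \<rho> = m \<cdot> c"
    using pushout_exists[OF *(5) c(1)] .
  have cD: "cofibrant C D"
    using cofibrant_cof[OF co(2) D(2) pushout_cof[OF pushout_sym[OF D(1)] c(1) *(5) c(2)]] .
  obtain e where e: "e \<in> hom D K" "e \<cdot> da = j" "e \<cdot> m = y0" using pushout_univ[OF D(1) *(5) c(1) *(4) y0(1) sq(3)] .
  have ew: "e \<in> Weq C" using hpo_pushout_iff[OF D(1) *(5) c co(1,2) e(1)] hp e by simp
  \<comment> \<open>Deform \<open>r \<cdot> e\<close> so that it agrees strictly with \<open>\<iota>\<close> and \<open>g \<cdot> s\<close> on the two ends.\<close>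
  obtain J :: "('o,'m) htpy" where J: "is_cylinder (op C) x J" using path_exists bifibrantD(3)[OF bi(2)] by metis
  note P = pathD[OF J] and PE = path_ends[OF J]
  define \<phi> where "\<phi> = r \<cdot> e"
  have \<phi>: "\<phi> \<in> hom D x" "\<phi> \<cdot> da = r \<cdot> j" "\<phi> \<cdot> m \<cdot> q = r \<cdot> \<chi>"
    unfolding \<phi>_def using comp_in[OF e(1) rt] e rt D(2,3) M(3) y0(1) by (simp_all add: cs e(3)[THEN pre] y0(3))
  obtain k1 where k1: "right_homotopy C (J\<lparr>hmap := k1\<rparr>) (r \<cdot> j) \<iota>" using right_of_left[OF rji rj(1) ca J] .
  note K1 = right_homotopyD[OF k1 rj(1), simplified]
  have gs: "g \<cdot> s \<in> hom x0 x" using comp_in G by blast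
  obtain k2 where k2: "right_homotopy C (J\<lparr>hmap := k2\<rparr>) (r \<cdot> \<chi>) (g \<cdot> s)"
    using right_of_left[OF homotopic_sym[OF G(5)] rj(2) co(3) J] .
  note K2 = right_homotopyD[OF k2 rj(2), simplified]
  have ends: "end0 J \<in> Fib C" "end0 J \<in> Weq C" using PE fx by blast+
  have k1r: "k1 \<cdot> \<rho> \<in> hom z (cyl J)" and pm: "\<phi> \<cdot> m \<in> hom M x" using comp_in K1 * \<phi> D by blast+
  have "end0 J \<cdot> (k1 \<cdot> \<rho>) = (\<phi> \<cdot> m) \<cdot> c"
    using P(1) K1(3) *(5) \<phi>(1) D(2,3) c(1) rt *(4) by (simp add: K1(4)[THEN pre] D(4)[symmetric] \<phi>(2)[THEN pre] cs)
  moreover have "end0 J \<cdot> k2 = (\<phi> \<cdot> m) \<cdot> q" using K2(4) \<phi>(3) by simp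
  ultimately obtain N where N: "N \<in> hom M (cyl J)" "N \<cdot> c = k1 \<cdot> \<rho>" "N \<cdot> q = k2" "end0 J \<cdot> N = \<phi> \<cdot> m"
    using MC(5)[OF P(1) ends k1r K2(3) pm] unfolding c_def by blast
  obtain \<Theta> where \<Theta>: "\<Theta> \<in> hom D (cyl J)" "\<Theta> \<cdot> da = k1" "\<Theta> \<cdot> m = N"
    using pushout_univ[OF D(1) *(5) c(1) K1(3) N(1) N(2)[symmetric]] .
  have e0: "end0 J \<cdot> \<Theta> = \<phi>"
    by (rule pushout_eq[OF D(1) comp_in[OF \<Theta>(1) P(1)] \<phi>(1)])
      (use P(1) \<Theta>(1) D(2,3) \<phi>(1) in \<open>simp_all add: cs \<Theta>(2,3) K1(4) N(4) \<phi>(2)\<close>)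
  define d where "d = end1 J \<cdot> \<Theta>"
  have d: "d \<in> hom D x" unfolding d_def using comp_in \<Theta> P by blast
  have da: "d \<cdot> da = \<iota>" "d \<cdot> (m \<cdot> q) = g \<cdot> s"
    unfolding d_def using P(2) \<Theta>(1) D(2,3) M(3) N(1)
    by (simp_all add: cs \<Theta>(2) \<Theta>(3)[THEN pre] N(3) K1(5) K2(5))
  have "right_homotopy C (J\<lparr>hmap := \<Theta>\<rparr>) \<phi> d"
    using J \<Theta>(1) e0 d_def by (intro right_homotopyI[of x _ D]) simp_all
  then have "homotopic (op C) \<phi> d" unfolding homotopic_def by blast
  then have pd: "homotopic C \<phi> d" using left_homotopic[OF _ \<phi>(1) fx] by blast
  have dmp: "d \<cdot> (m \<cdot> p) \<in> hom (cyl H) x" using comp_in d D M by blast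
  have st: "s \<cdot> \<tau> \<in> hom z G" using comp_in G * by blast
  have "left_homotopy C (H\<lparr>hmap := d \<cdot> (m \<cdot> p)\<rparr>) (\<iota> \<cdot> \<rho>) (g \<cdot> (s \<cdot> \<tau>))"
  proof (rule left_homotopyI[of z _ x])
    have "d \<cdot> (m \<cdot> p) \<cdot> end0 H = d \<cdot> (m \<cdot> c)" unfolding c_def using d D(3) M(2) Y(1) by (simp add: cs)
    also have "\<dots> = \<iota> \<cdot> \<rho>" unfolding D(4)[symmetric] using d D(2) *(5) by (simp add: da(1)[THEN pre] cs)
    finally show "hmap (H\<lparr>hmap := d \<cdot> (m \<cdot> p)\<rparr>) \<cdot> end0 (H\<lparr>hmap := d \<cdot> (m \<cdot> p)\<rparr>) = \<iota> \<cdot> \<rho>" by simp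
    have "d \<cdot> (m \<cdot> p) \<cdot> end1 H = d \<cdot> (m \<cdot> q) \<cdot> \<tau>"
      using d D(3) M(2,3) Y(2) *(6) by (simp add: cs M(4))
    also have "\<dots> = g \<cdot> (s \<cdot> \<tau>)" unfolding da(2) using G(3,4) *(6) by (simp add: cs)
    finally show "hmap (H\<lparr>hmap := d \<cdot> (m \<cdot> p)\<rparr>) \<cdot> end1 (H\<lparr>hmap := d \<cdot> (m \<cdot> p)\<rparr>) = g \<cdot> (s \<cdot> \<tau>)" by simp
  qed (use S(7) dmp in simp_all)
  then obtain k where k: "k \<in> hom (cyl H) G'" "k \<cdot> end0 H = \<alpha>' \<cdot> \<rho>" "k \<cdot> end1 H = \<gamma> \<cdot> (s \<cdot> \<tau>)" "g' \<cdot> k = d \<cdot> (m \<cdot> p)"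
    using ext[OF co(1) *(5) st] by fastforce
  have gams: "\<gamma> \<cdot> s \<in> hom x0 G'" using comp_in G' G by blast
  have "k \<cdot> end1 H = (\<gamma> \<cdot> s) \<cdot> \<tau>" using k(3) G'(5) G(4) *(6) by (simp add: cs)
  then obtain kM where kM: "kM \<in> hom M G'" "kM \<cdot> p = k" "kM \<cdot> q = \<gamma> \<cdot> s"
    using pushout_univ[OF M(1) Y(2) *(6) k(1) gams] by metis
  have "\<alpha>' \<cdot> \<rho> = kM \<cdot> c" unfolding c_def using kM(1) M(2) Y(1) by (simp add: kM(2)[THEN pre] k(2) cs)
  then obtain kD where kD: "kD \<in> hom D G'" "kD \<cdot> da = \<alpha>'" "kD \<cdot> m = kM"
    using pushout_univ[OF D(1) *(5) c(1) G'(4) kM(1)] by metis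
  have gkM: "g' \<cdot> kM = d \<cdot> m"
    by (rule pushout_eq[OF M(1) comp_in[OF kM(1) G'(3)] comp_in[OF D(3) d]])
      (use G'(3,5) kM(1) M(2,3) d D(3) G(4) in \<open>simp_all add: cs kM(2,3) k(4) da(2) G'(7)[THEN pre]\<close>)
  have gkD: "g' \<cdot> kD = d"
    by (rule pushout_eq[OF D(1) comp_in[OF kD(1) G'(3)] d])
      (use G'(3) kD(1) D(2,3) d in \<open>simp_all add: cs kD(2,3) G'(6) da(1) gkM\<close>)
  obtain w where w: "w \<in> hom K G'" "homotopic C (w \<cdot> e) kD"
    using weq_extend[OF e(1) ew cD bifibrantD(1)[OF bK] kD(1) bifibrantD(2)[OF G'(2)]] .
  have we: "w \<cdot> e \<in> hom D G'" and gw: "g' \<cdot> w \<in> hom K x" using comp_in w e G' by blast+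
  have "homotopic C (g' \<cdot> (w \<cdot> e)) d" using homotopic_post[OF w(2) we G'(3)] gkD by simp
  then have "homotopic C (g' \<cdot> (w \<cdot> e)) \<phi>"
    using homotopic_trans[OF _ homotopic_sym[OF pd] comp_in[OF we G'(3)] cD fx] by blast
  then have "homotopic C ((g' \<cdot> w) \<cdot> e) (r \<cdot> e)" unfolding \<phi>_def using w e G'(3) by (simp add: cs)
  then have 1: "homotopic C (g' \<cdot> w) r" using weq_cancel[OF e(1) ew cD bifibrantD(1)[OF bK] gw rt fx] by blast
  have wf: "w \<cdot> f \<in> hom a G'" "w \<cdot> j \<in> hom a G'" using comp_in w ft * by blast+
  have "homotopic C ((w \<cdot> e) \<cdot> da) (kD \<cdot> da)"
    using homotopic_pre[OF w(2) we D(2) cD co(2) bifibrantD(2)[OF G'(2)]] .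
  then have "homotopic C (w \<cdot> j) \<alpha>'" using w(1) e(1) D(2) by (simp add: cs e(2) kD(2))
  then have 2: "homotopic C (w \<cdot> f) \<alpha>'"
    using homotopic_trans[OF homotopic_post[OF homotopic_sym[OF *(12)] ft w(1)] _ wf(1) ca bifibrantD(2)[OF G'(2)]] by blast
  show ?case using G'(1-4) w(1) 1 2 by blast
qed

lemma relcat_iff_retract_built:
  assumes t: "\<iota> \<in> hom a x" and bi: "bifibrant C a" "bifibrant C x"
  shows "(\<exists>g \<alpha>. ganea C \<iota> n g \<alpha> \<and> (\<exists>\<sigma> \<in> hom x (Dom C g).
      homotopic C (g \<cdot> \<sigma>) (Id C x) \<and> homotopic C (\<sigma> \<cdot> \<iota>) \<alpha>)) \<longleftrightarrow> retract_built C n \<iota>"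
proof
  assume "\<exists>g \<alpha>. ganea C \<iota> n g \<alpha> \<and> (\<exists>\<sigma> \<in> hom x (Dom C g).
      homotopic C (g \<cdot> \<sigma>) (Id C x) \<and> homotopic C (\<sigma> \<cdot> \<iota>) \<alpha>)"
  then obtain g \<alpha> \<sigma> where g: "ganea C \<iota> n g \<alpha>" "\<sigma> \<in> hom x (Dom C g)"
      "homotopic C (g \<cdot> \<sigma>) (Id C x)" "homotopic C (\<sigma> \<cdot> \<iota>) \<alpha>" by blast
  obtain G where G: "bifibrant C G" "g \<in> hom G x" "\<alpha> \<in> hom a G" "built C n \<alpha>"
    using ganea_built[OF g(1) t bi] by blast
  have s: "\<sigma> \<in> hom x G" using g(2) G(2) by (simp add: Hom_iff)
  have "built C n (\<sigma> \<cdot> \<iota>)" using built_homotopic[OF G(4) homotopic_sym[OF g(4)] G(3) bi(1) G(1)] .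
  then show "retract_built C n \<iota>" using retract_builtI[OF t G(1,2) s g(3)] by blast
next
  assume "retract_built C n \<iota>"
  then obtain K r s where K: "bifibrant C K" "r \<in> hom K x" "s \<in> hom x K" "homotopic C (r \<cdot> s) (Id C x)" "built C n (s \<cdot> \<iota>)"
    using retract_builtE[OF _ t] by blast
  note co = bi[THEN bifibrantD(1)] and fx = bifibrantD(2)[OF bi(2)]
  have si: "s \<cdot> \<iota> \<in> hom a K" "r \<cdot> s \<in> hom x x" using comp_in t K by blast+
  have "homotopic C ((r \<cdot> s) \<cdot> \<iota>) (Id C x \<cdot> \<iota>)" using homotopic_pre[OF K(4) si(2) t co(2,1) fx] .
  then have "homotopic C (r \<cdot> (s \<cdot> \<iota>)) \<iota>" using K t by (simp add: cs)
  then obtain G g \<alpha> u where G: "ganea C \<iota> n g \<alpha>" "bifibrant C G" "g \<in> hom G x" "u \<in> hom K G"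
    "homotopic C (g \<cdot> u) r" "homotopic C (u \<cdot> (s \<cdot> \<iota>)) \<alpha>"
    using ganea_of_strong_relcat[OF strong_relcat_of_built[OF K(5)] si(1) K(2) _ t K(1) bi] by blast
  have gu: "g \<cdot> u \<in> hom K x" "u \<cdot> s \<in> hom x G" "g \<cdot> u \<cdot> s \<in> hom x x" using comp_in G K by blast+
  have "homotopic C (g \<cdot> u \<cdot> s) (Id C x)"
    using homotopic_trans[OF homotopic_pre[OF G(5) gu(1) K(3) bifibrantD(1)[OF K(1)] co(2) fx] K(4) gu(3) co(2) fx]
      by blast
  then have "homotopic C (g \<cdot> (u \<cdot> s)) (Id C x)" "homotopic C ((u \<cdot> s) \<cdot> \<iota>) \<alpha>" "u \<cdot> s \<in> hom x (Dom C g)"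
    using G(3-6) K(3) t gu by (simp_all add: cs)
  then show "\<exists>g \<alpha>. ganea C \<iota> n g \<alpha> \<and> (\<exists>\<sigma> \<in> hom x (Dom C g).
      homotopic C (g \<cdot> \<sigma>) (Id C x) \<and> homotopic C (\<sigma> \<cdot> \<iota>) \<alpha>)" using G(1) by blast
qed

lemma Relcat_built:
  assumes "\<iota> \<in> hom a x" "bifibrant C a" "bifibrant C x"
  shows "Relcat C \<iota> = Inf {enat n | n. built C n \<iota>}"
  unfolding Relcat_def strong_relcat_iff_built[OF assms] ..

lemma relcat_retract_built:
  assumes "\<iota> \<in> hom a x" "bifibrant C a" "bifibrant C x"
  shows "relcat C \<iota> = Inf {enat n | n. retract_built C n \<iota>}"
proof -
  have "Cod C \<iota> = x" using assms(1) by (simp add: Hom_iff)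
  then show ?thesis unfolding relcat_def by (simp only: relcat_iff_retract_built[OF assms])
qed

section \<open>Base change and cobase change\<close>

text \<open>The given homotopy pullback is rectified to a strict square over a fibration \<open>Q \<rightarrow> Y\<close>, where \<open>Q\<close> is weakly equivalent to
  \<open>M\<close>.\<close>

lemma hpullback_base_change:
  assumes cube: "cube_axiom C" and h0: "hpullback C \<pi> \<iota>M' \<iota>Y \<phi> H"
    and t: "\<iota>Y \<in> hom A Y" "\<phi> \<in> hom M Y" "\<pi> \<in> hom P A" "\<iota>M' \<in> hom P M"
    and bi: "bifibrant C A" "bifibrant C Y" "bifibrant C M" "bifibrant C P"
  shows "built C n \<iota>Y \<Longrightarrow> built C n \<iota>M'" and "retract_built C n \<iota>Y \<Longrightarrow> retract_built C n \<iota>M'"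
proof -
  note co = bi[THEN bifibrantD(1)] and o = bi[THEN bifibrantD(3)]
  obtain E z y w q where E: "fibrant C E" "z \<in> hom E Y" "z \<in> Fib C" "y \<in> hom P E" "w \<in> hom M E" "w \<in> Weq C"
    "z \<cdot> w = \<phi>" "q \<in> hom E M" "q \<cdot> w = Id C M" "q \<cdot> y = \<iota>M'" "hpb C \<pi> y \<iota>Y z"
    using hpullbackE[OF h0 t(3,4,1)] .
  obtain Q c where Q: "cofibrant C Q" "c \<in> hom Q E" "c \<in> Fib C" "c \<in> Weq C"
    using cofibrant_replacement[OF fibrant_obj[OF E(1)]] .
  have bQ: "bifibrant C Q" using Q(1) fibrant_fib[OF E(1) Q(2,3)] by (simp add: bifibrant_def)
  obtain k where k: "k \<in> hom P Q" "c \<cdot> k = y" using cofibrant_lift[OF co(4) Q(3,4,2) E(4)] .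
  have zc: "z \<cdot> c \<in> hom Q Y" "z \<cdot> c \<in> Fib C" using comp_in[OF Q(2) E(2)] fib_comp[OF E(2,3) Q(2,3)] .
  note sq = hpbD[OF E(11) t(3) E(4) t(1)]
  have sq2: "square C P A Q Y \<pi> k \<iota>Y (z \<cdot> c)"
    unfolding square_def using t(1,3) k zc(1) E(2) Q(2) sq(3) by (simp add: cs)
  have h: "hpb C \<pi> k \<iota>Y (z \<cdot> c)"
    using hpb_invariant[OF sq2 sq(1) Id_in_weq[OF o(4)] Id_in_weq[OF o(1)] Q(2,4) Id_in_weq[OF o(2)]]
      E(11,4) k t(1,3) E(2) Q(2) by (simp add: cs)
  have "q \<in> Weq C" using weq_section[OF E(5,8,9)] E(6) by blast
  then have qc: "q \<cdot> c \<in> hom Q M" "q \<cdot> c \<in> Weq C" using comp_in[OF Q(2) E(8)] two_of_three(1)[OF Q(2) E(8) Q(4)] by blast+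
  have qck: "(q \<cdot> c) \<cdot> k = \<iota>M'" using E(8) Q(2) k E(10) by (simp add: cs)
  have "(q \<cdot> c) \<cdot> k = \<iota>M' \<cdot> Id C P" unfolding qck using t(4) by (simp add: cs)
  then show "built C n \<iota>M'" if "built C n \<iota>Y"
    using built_forward[OF built_base_change[OF cube that h t(1) zc(1) t(3) k(1) bQ bi(4,1,2)] bi(4) bQ bi(4,3) k(1) t(4)
        Id_in[OF o(4)] qc(1) Id_weq[OF o(4)] qc(2)] by blast
  show "retract_built C n \<iota>M'" if "retract_built C n \<iota>Y"
    using retract_built_base_change[OF cube that h t(1) zc t(3) k(1) bQ bi(4,1,2)]
      retract_built_target[OF k(1) qc bi(4) bQ bi(3)] qck by simp
qed

text \<open>Dually, \<open>M\<close> is replaced by a fibrant replacement \<open>N\<close> of the mapping cylinder.\<close>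

lemma hpushout_cobase_change:
  assumes h0: "hpushout C \<pi> \<iota>M' \<iota>Mt \<mu> K"
    and t: "\<pi> \<in> hom P A" "\<iota>M' \<in> hom P M" "\<iota>Mt \<in> hom A Mt"
    and bi: "bifibrant C A" "bifibrant C M" "bifibrant C P" "bifibrant C Mt"
  shows "built C n \<iota>M' \<Longrightarrow> built C n \<iota>Mt" and "retract_built C n \<iota>M' \<Longrightarrow> retract_built C n \<iota>Mt"
proof -
  note fi = bi[THEN bifibrantD(2)] and o = bi[THEN bifibrantD(3)]
  obtain E z y w q where E: "cofibrant C E" "z \<in> hom P E" "z \<in> Cof C" "y \<in> hom E Mt" "w \<in> hom E M" "w \<in> Weq C"
    "w \<cdot> z = \<iota>M'" "hpo C \<pi> z \<iota>Mt y"
    using hpushoutE[OF h0 t(1,2,3)] by metis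
  obtain N i where N: "fibrant C N" "i \<in> hom E N" "i \<in> Cof C" "i \<in> Weq C"
    using fibrant_replacement[OF cofibrant_obj[OF E(1)]] .
  have bN: "bifibrant C N" using N(1) cofibrant_cof[OF E(1) N(2,3)] by (simp add: bifibrant_def)
  obtain y' where y': "y' \<in> hom N Mt" "y' \<cdot> i = y" using fibrant_extend[OF fi(4) N(3,4,2) E(4)] .
  obtain w' where w': "w' \<in> hom N M" "w' \<cdot> i = w" using fibrant_extend[OF fi(2) N(3,4,2) E(5)] .
  have ww: "w' \<in> Weq C" using two_of_three(2)[OF N(2) w'(1) N(4)] w'(2) E(6) by simp
  have iz: "i \<cdot> z \<in> hom P N" using comp_in E N by blast
  note sq = hpoD[OF E(8) t(1) E(2) t(3)]
  have sq2: "square C P A N Mt \<pi> (i \<cdot> z) \<iota>Mt y'"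
    unfolding square_def using t(1,3) iz y' E(2) N(2) E(4) by (simp add: y'(2)[THEN pre] sq(3) cs)
  have h: "hpo C \<pi> (i \<cdot> z) \<iota>Mt y'"
    using hpo_invariant[OF sq(1) sq2 Id_in_weq[OF o(3)] Id_in_weq[OF o(1)] N(2,4) Id_in_weq[OF o(4)]]
      E(8,2,4) t(1,3) N(2) y' by (simp add: cs)
  have wiz: "w' \<cdot> (i \<cdot> z) = \<iota>M'" using w' N(2) E(2) E(7) E(5) by (simp add: w'(2)[THEN pre] cs)
  have "w' \<cdot> (i \<cdot> z) = \<iota>M' \<cdot> Id C P" unfolding wiz using t(2) by (simp add: cs)
  then have "built C n (i \<cdot> z)" if "built C n \<iota>M'"
    using built_backward[OF that bi(3) bN bi(3,2) iz t(2) Id_in[OF o(3)] w'(1) Id_weq[OF o(3)] ww] by blast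
  then show "built C n \<iota>Mt" if "built C n \<iota>M'"
    using built_cobase_change[OF _ h iz t(1,3) y'(1) bi(3) bN bi(1,4)] that by blast
  show "retract_built C n \<iota>Mt" if "retract_built C n \<iota>M'"
    using retract_built_cobase_change[OF _ h iz t(1,3) y'(1) bi(3) bN bi(1,4)]
      retract_built_target[OF iz w'(1) ww bi(3) bN bi(2)] that wiz by simp
qed

end

theorem lemma14:
  fixes C :: "('o, 'm) mcat"
    and A Y M P Mt :: 'o
    and \<iota>Y \<phi> \<pi> \<iota>M' \<iota>Mt \<mu> :: 'm
    and H K :: "('o, 'm) htpy"
  assumes "closed_model_category C" and "cube_axiom C"
    and "bifibrant C A" and "bifibrant C Y" and "bifibrant C M"
    and "bifibrant C P" and "bifibrant C Mt"
    and "\<iota>Y \<in> Hom C A Y" and "\<phi> \<in> Hom C M Y"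
    and "\<pi> \<in> Hom C P A" and "\<iota>M' \<in> Hom C P M"
    and "hpullback C \<pi> \<iota>M' \<iota>Y \<phi> H"
    and "\<iota>Mt \<in> Hom C A Mt" and "\<mu> \<in> Hom C M Mt"
    and "hpushout C \<pi> \<iota>M' \<iota>Mt \<mu> K"
  shows "Relcat C \<iota>Mt \<le> Relcat C \<iota>M' \<and> Relcat C \<iota>M' \<le> Relcat C \<iota>Y \<and>
         relcat C \<iota>Mt \<le> relcat C \<iota>M' \<and> relcat C \<iota>M' \<le> relcat C \<iota>Y"
proof -
  interpret model_category C by (rule model_category.intro) (rule assms(1))
  note base = hpullback_base_change[OF assms(2,12,8-11,3-6)]
    and cobase = hpushout_cobase_change[OF assms(15,10,11,13,3,5,6,7)]
  show ?thesis
    unfolding Relcat_built[OF assms(8,3,4)] Relcat_built[OF assms(11,6,5)] Relcat_built[OF assms(13,3,7)]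
      relcat_retract_built[OF assms(8,3,4)] relcat_retract_built[OF assms(11,6,5)] relcat_retract_built[OF assms(13,3,7)]
    by (intro conjI Inf_superset_mono) (use base cobase in blast)+
qed

end
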